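(* Let $0\neq g\in\mathbf{SOC}(0,\infty)$, let $-1\leq p\leq 1$, and let $A,B$ be positive invertible operators on a complex Hilbert space. If $AB+BA\geq 0$, then $$g(A^{p})B+Bg(A^{p})\geq 0.$$
   Context: Operators are bounded linear operators on a complex Hilbert space $\mathcal{H}$ (nonzero, otherwise arbitrary). $A\ge 0$ (positive) means $\langle Ax,x\rangle\ge 0$ for all $x\in\mathcal{H}$; for self-adjoint $A,B$, $A\le B$ means $B-A\ge 0$. $g(A)$ denotes the continuous functional calculus. A continuous real-valued function $g$ on an interval $J$ is strongly operator convex on $J$, written $g\in\mathbf{SOC}(J)$, if $P g(PAP)P\le g(A)$ for every self-adjoint operator $A$ (on any complex Hilbert space) with spectrum in $J$ and every orthogonal projection $P$; here $g(PAP)$ is computed for the compression of $A$ to the range of $P$, so $Pg(PAP)P$ equals $g(PAP|_{P\mathcal{H}})$ on $P\mathcal{H}$ and $0$ on $(P\mathcal{H})^\perp$. *)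

theory Defs
  imports
    "HOL-Analysis.Analysis"
    "HOL-Algebra.Algebraic_Closure_Type"
begin

text \<open>
  A complex Hilbert space is an explicit structure: a HOL-Algebra module over \<open>\<complex>\<close> with an inner
  product, whose carrier is a subset of some type. This keeps the range of a projection a Hilbert
  space in its own right and allows one to quantify over all Hilbert spaces inside a formula. The
  fields \<open>mult\<close> and \<open>one\<close>, which a HOL-Algebra module inherits from rings, play no role.
\<close>

record 'a hilbert = "(complex, 'a) module" +
  cinner :: "'a \<Rightarrow> 'a \<Rightarrow> complex"

definition cnorm :: "'a hilbert \<Rightarrow> 'a \<Rightarrow> real" where
  "cnorm H x = sqrt (Re (cinner H x x))"

text \<open>The locale \<open>Metric_space\<close> requires symmetry and nonnegativity off the carrier as well.\<close>

definition cdist :: "'a hilbert \<Rightarrow> 'a \<Rightarrow> 'a \<Rightarrow> real" where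
  "cdist H x y = (if x \<in> carrier H \<and> y \<in> carrier H then cnorm H (x \<ominus>\<^bsub>H\<^esub> y) else 0)"

locale complex_hilbert_space =
  module "ring_of_type_algebra :: complex ring" H for H :: "'a hilbert" (structure) +
  assumes cinner_add_left:
      "\<lbrakk>x \<in> carrier H; y \<in> carrier H; z \<in> carrier H\<rbrakk>
        \<Longrightarrow> cinner H (x \<oplus>\<^bsub>H\<^esub> y) z = cinner H x z + cinner H y z"
    and cinner_smult_left:
      "\<lbrakk>x \<in> carrier H; y \<in> carrier H\<rbrakk> \<Longrightarrow> cinner H (c \<odot>\<^bsub>H\<^esub> x) y = c * cinner H x y"
    and cinner_commute:
      "\<lbrakk>x \<in> carrier H; y \<in> carrier H\<rbrakk> \<Longrightarrow> cinner H y x = cnj (cinner H x y)"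
    and cinner_pos:
      "\<lbrakk>x \<in> carrier H; x \<noteq> \<zero>\<^bsub>H\<^esub>\<rbrakk> \<Longrightarrow> 0 < Re (cinner H x x)"
    and complete:
      "Metric_space.mcomplete (carrier H) (cdist H)"

text \<open>
  An operator on \<open>H\<close> is a function on the ambient type of which only the values on \<open>carrier H\<close>
  matter.
\<close>

definition bounded_op :: "'a hilbert \<Rightarrow> ('a \<Rightarrow> 'a) \<Rightarrow> bool" where
  "bounded_op H T \<longleftrightarrow>
     T \<in> carrier H \<rightarrow> carrier H \<and>
     (\<forall>x\<in>carrier H. \<forall>y\<in>carrier H. T (x \<oplus>\<^bsub>H\<^esub> y) = T x \<oplus>\<^bsub>H\<^esub> T y) \<and>
     (\<forall>c. \<forall>x\<in>carrier H. T (c \<odot>\<^bsub>H\<^esub> x) = c \<odot>\<^bsub>H\<^esub> T x) \<and>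
     (\<exists>K. \<forall>x\<in>carrier H. cnorm H (T x) \<le> K * cnorm H x)"

definition op_norm :: "'a hilbert \<Rightarrow> ('a \<Rightarrow> 'a) \<Rightarrow> real" where
  "op_norm H T = Inf {K. 0 \<le> K \<and> (\<forall>x\<in>carrier H. cnorm H (T x) \<le> K * cnorm H x)}"

definition selfadjoint_op :: "'a hilbert \<Rightarrow> ('a \<Rightarrow> 'a) \<Rightarrow> bool" where
  "selfadjoint_op H T \<longleftrightarrow>
     bounded_op H T \<and>
     (\<forall>x\<in>carrier H. \<forall>y\<in>carrier H. cinner H (T x) y = cinner H x (T y))"

definition positive_op :: "'a hilbert \<Rightarrow> ('a \<Rightarrow> 'a) \<Rightarrow> bool" where
  "positive_op H T \<longleftrightarrow>
     bounded_op H T \<and> (\<forall>x\<in>carrier H. cinner H (T x) x \<in> \<real>\<^sub>\<ge>\<^sub>0)"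

definition op_le :: "'a hilbert \<Rightarrow> ('a \<Rightarrow> 'a) \<Rightarrow> ('a \<Rightarrow> 'a) \<Rightarrow> bool" where
  "op_le H S T \<longleftrightarrow> positive_op H (\<lambda>x. T x \<ominus>\<^bsub>H\<^esub> S x)"

definition projection_op :: "'a hilbert \<Rightarrow> ('a \<Rightarrow> 'a) \<Rightarrow> bool" where
  "projection_op H P \<longleftrightarrow> selfadjoint_op H P \<and> (\<forall>x\<in>carrier H. P (P x) = P x)"

definition invertible_op :: "'a hilbert \<Rightarrow> ('a \<Rightarrow> 'a) \<Rightarrow> bool" where
  "invertible_op H T \<longleftrightarrow>
     bounded_op H T \<and>
     (\<exists>S. bounded_op H S \<and> (\<forall>x\<in>carrier H. S (T x) = x \<and> T (S x) = x))"

definition op_spectrum :: "'a hilbert \<Rightarrow> ('a \<Rightarrow> 'a) \<Rightarrow> complex set" where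
  "op_spectrum H T = {z. \<not> invertible_op H (\<lambda>x. T x \<ominus>\<^bsub>H\<^esub> z \<odot>\<^bsub>H\<^esub> x)}"

definition poly_op :: "'a hilbert \<Rightarrow> real poly \<Rightarrow> ('a \<Rightarrow> 'a) \<Rightarrow> 'a \<Rightarrow> 'a" where
  "poly_op H p A x =
     finsum H (\<lambda>i. complex_of_real (Polynomial.coeff p i) \<odot>\<^bsub>H\<^esub> (A ^^ i) x) {..Polynomial.degree p}"

text \<open>
  Continuous functional calculus of a self-adjoint \<open>A\<close> for real-valued \<open>g\<close> continuous on the
  spectrum (which is real): \<open>g(A)\<close> is the norm limit of \<open>p\<^sub>n(A)\<close> for polynomials \<open>p\<^sub>n\<close> converging to
  \<open>g\<close> uniformly on the spectrum. Extensionality makes the operator unique as a function.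
\<close>

definition cfc :: "'a hilbert \<Rightarrow> (real \<Rightarrow> real) \<Rightarrow> ('a \<Rightarrow> 'a) \<Rightarrow> 'a \<Rightarrow> 'a" where
  "cfc H g A = (THE T. T \<in> extensional (carrier H) \<and> bounded_op H T \<and>
     (\<exists>p :: nat \<Rightarrow> real poly.
        uniform_limit (Re ` op_spectrum H A) (\<lambda>n. poly (p n)) g sequentially \<and>
        (\<lambda>n. op_norm H (\<lambda>x. poly_op H (p n) A x \<ominus>\<^bsub>H\<^esub> T x)) \<longlonglongrightarrow> 0))"

definition powr_op :: "'a hilbert \<Rightarrow> ('a \<Rightarrow> 'a) \<Rightarrow> real \<Rightarrow> 'a \<Rightarrow> 'a" where
  "powr_op H A p = cfc H (\<lambda>t. t powr p) A"

definition range_space :: "'a hilbert \<Rightarrow> ('a \<Rightarrow> 'a) \<Rightarrow> 'a hilbert" where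
  "range_space H P = H\<lparr>carrier := P ` carrier H\<rparr>"

text \<open>
  Strongly operator convex functions. HOL cannot quantify over types within a formula, so the
  definition refers to all Hilbert spaces whose carrier is a subset of the type \<open>'a\<close>. As soon as
  \<open>'a\<close> carries one nonzero Hilbert space it has at least continuum many elements and hence also
  carries a copy of \<open>\<ell>\<^sup>2(\<nat>)\<close>, so that the choice of \<open>'a\<close> does not affect the resulting class.
  The function \<open>y \<mapsto> P (A y)\<close> on \<open>range_space H P\<close> is the compression of \<open>A\<close>, so the left-hand
  operator below is \<open>g(PAP)\<close> on the range of \<open>P\<close> and \<open>0\<close> on its orthogonal complement.
\<close>

definition SOC :: "'a itself \<Rightarrow> real set \<Rightarrow> (real \<Rightarrow> real) set" where
  "SOC _ J = {g. is_interval J \<and> continuous_on J g \<and>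
     (\<forall>H :: 'a hilbert. complex_hilbert_space H \<longrightarrow>
       (\<forall>A P. selfadjoint_op H A \<longrightarrow> op_spectrum H A \<subseteq> complex_of_real ` J \<longrightarrow>
          projection_op H P \<longrightarrow>
          op_le H (\<lambda>x. P (cfc (range_space H P) g (\<lambda>y. P (A y)) (P x))) (cfc H g A)))}"

end

theory Submission
  imports Defs
begin

text \<open>
  Suppose first that \<open>B \<ge> \<epsilon>\<close> and \<open>AB + BA \<ge> 2\<epsilon>\<close> for some \<open>\<epsilon> > 0\<close>, and take \<open>p = 1\<close>. For small \<open>t > 0\<close> put
  \<open>C = 1 - tB\<close> and \<open>S = (1 - C\<^sup>2)\<^bsup>1/2\<^esup>\<close>, which is positive and invertible because
  \<open>1 - C\<^sup>2 = 2tB - t\<^sup>2B\<^sup>2\<close> is. The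
  operator \<open>Vx = (Cx, Sx)\<close> is an isometry of \<open>H\<close> into \<open>H \<oplus> H\<close>, since \<open>V*V = C\<^sup>2 + S\<^sup>2 = 1\<close>. Moreover
  \<open>A - CAC = t(AB + BA) - t\<^sup>2BAB\<close> is positive and invertible for small \<open>t\<close>, and hence so is
  \<open>Y = S\<^bsup>-1\<^esup>(A - CAC)S\<^bsup>-1\<^esup>\<close>. This \<open>Y\<close> is chosen such that \<open>V*(A \<oplus> Y)V = CAC + SYS = A\<close>: the
  compression of \<open>A \<oplus> Y\<close> to the range of \<open>V\<close> is again a copy of \<open>A\<close>. The defining inequality of
  strong operator convexity for \<open>A \<oplus> Y\<close> and the projection \<open>VV*\<close> therefore reads
  \<open>V g(A) V* \<le> g(A) \<oplus> g(Y)\<close>, whose upper left corner is \<open>C g(A) C \<le> g(A)\<close> (lemma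
  \<open>SOC_contraction\<close>). Expanding \<open>C = 1 - tB\<close> gives
  \<open>t(g(A)B + B g(A)) \<ge> t\<^sup>2 B g(A) B\<close>; division by \<open>t\<close> and \<open>t \<rightarrow> 0\<close> finish this case (lemma
  \<open>SOC_anticommutator_strict\<close>). A general \<open>B\<close> is replaced by \<open>B + s\<close>, because
  \<open>A(B + s) + (B + s)A \<ge> 2sA\<close>, and \<open>s \<rightarrow> 0\<close> (lemma \<open>SOC_anticommutator\<close>).

  To pass from \<open>A\<close> to \<open>A\<^sup>p\<close> it remains to see that \<open>AB + BA \<ge> 0\<close> implies \<open>K\<^sub>p = A\<^sup>pB + BA\<^sup>p \<ge> 0\<close>
  (lemma \<open>powr_op_anticommutator\<close>). The set of \<open>p \<in> [0, 1]\<close> with \<open>K\<^sub>p \<ge> 0\<close> is closed and contains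
  \<open>0\<close> and \<open>1\<close>. It is closed under midpoints: with \<open>r = (p + q)/2\<close> and \<open>d = (q - p)/2\<close> one has
  \<open>A\<^sup>dK\<^sub>r + K\<^sub>rA\<^sup>d = K\<^sub>q + A\<^sup>dK\<^sub>pA\<^sup>d \<ge> 0\<close>, and a self-adjoint \<open>D\<close> with \<open>TD + DT \<ge> 0\<close> for some positive
  invertible \<open>T\<close> is positive (lemma \<open>Lyapunov_positive\<close>). Negative exponents follow from
  \<open>K\<^bsub>-p\<^esub> = A\<^bsup>-p\<^esup>K\<^sub>pA\<^bsup>-p\<^esup>\<close>.

  The functional calculus behind all this rests on the estimate
  \<open>\<parallel>p(A)\<parallel> \<le> sup {\<bar>p(t)\<bar>. t \<in> \<sigma>(A)}\<close> for real polynomials \<open>p\<close> (lemma \<open>norm_poly_op_le\<close>). It holds because a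
  polynomial without zeros on \<open>\<sigma>(A)\<close> becomes invertible at \<open>A\<close>, as one sees from its linear
  factors, whereas \<open>\<parallel>S\<parallel>\<^sup>2 - S\<^sup>2\<close> is never invertible for self-adjoint \<open>S\<close>.
\<close>

section \<open>Inner product spaces as modules\<close>

lemma ring_of_complex_simps [simp]:
  "carrier (ring_of_type_algebra :: complex ring) = UNIV"
  "a \<otimes>\<^bsub>(ring_of_type_algebra :: complex ring)\<^esub> b = a * b"
  "a \<oplus>\<^bsub>(ring_of_type_algebra :: complex ring)\<^esub> b = a + b"
  "\<one>\<^bsub>(ring_of_type_algebra :: complex ring)\<^esub> = 1"
  "\<zero>\<^bsub>(ring_of_type_algebra :: complex ring)\<^esub> = 0"
  by (simp_all add: ring_of_type_algebra_def)

text \<open>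
  The algebraic axioms of a Hilbert space, without completeness. Completeness speaks about the metric
  \<open>cdist\<close>, and that this is a metric, and what it means for it to be complete, must be available
  before completeness of a direct sum or of a subspace can be proved.
\<close>

locale pre_hilbert = module "ring_of_type_algebra :: complex ring" H
  for H :: "'a hilbert" (structure) +
  assumes inner_add_left:
      "\<lbrakk>x \<in> carrier H; y \<in> carrier H; z \<in> carrier H\<rbrakk>
        \<Longrightarrow> cinner H (x \<oplus>\<^bsub>H\<^esub> y) z = cinner H x z + cinner H y z"
    and inner_smult_left:
      "\<lbrakk>x \<in> carrier H; y \<in> carrier H\<rbrakk> \<Longrightarrow> cinner H (c \<odot>\<^bsub>H\<^esub> x) y = c * cinner H x y"
    and inner_commute:
      "\<lbrakk>x \<in> carrier H; y \<in> carrier H\<rbrakk> \<Longrightarrow> cinner H y x = cnj (cinner H x y)"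
    and inner_pos:
      "\<lbrakk>x \<in> carrier H; x \<noteq> \<zero>\<^bsub>H\<^esub>\<rbrakk> \<Longrightarrow> 0 < Re (cinner H x x)"
begin

lemma add_in [simp]: "x \<in> carrier H \<Longrightarrow> y \<in> carrier H \<Longrightarrow> x \<oplus> y \<in> carrier H"
  by (rule M.add.m_closed)

lemma smult_in [simp]: "x \<in> carrier H \<Longrightarrow> c \<odot> x \<in> carrier H"
  by simp

lemma zero_in [simp]: "\<zero> \<in> carrier H"
  by (rule M.zero_closed)

lemma diff_in [simp]: "x \<in> carrier H \<Longrightarrow> y \<in> carrier H \<Longrightarrow> x \<ominus> y \<in> carrier H"
  by (rule M.minus_closed)

lemma uminus_eq_smult: "x \<in> carrier H \<Longrightarrow> \<ominus> x = (-1) \<odot> x"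
proof -
  assume x: "x \<in> carrier H"
  have "x \<oplus> (-1) \<odot> x = (1 + (-1)) \<odot> x"
    using smult_l_distr[of 1 "-1" x] x smult_one[OF x] by simp
  also have "\<dots> = \<zero>"
    using x smult_l_null by simp
  finally show ?thesis
    using x by (simp add: M.minus_equality M.add.m_comm)
qed

lemma diff_eq_smult: "x \<in> carrier H \<Longrightarrow> y \<in> carrier H \<Longrightarrow> x \<ominus> y = x \<oplus> (-1) \<odot> y"
  by (simp add: a_minus_def uminus_eq_smult)

lemma inner_diff_left:
  "\<lbrakk>x \<in> carrier H; y \<in> carrier H; z \<in> carrier H\<rbrakk>
    \<Longrightarrow> cinner H (x \<ominus> y) z = cinner H x z - cinner H y z"
  by (simp add: diff_eq_smult inner_add_left inner_smult_left)

lemma inner_add_right: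
  "\<lbrakk>x \<in> carrier H; y \<in> carrier H; z \<in> carrier H\<rbrakk>
    \<Longrightarrow> cinner H z (x \<oplus> y) = cinner H z x + cinner H z y"
  by (metis inner_add_left inner_commute complex_cnj_add add_in)

lemma inner_smult_right:
  "\<lbrakk>x \<in> carrier H; y \<in> carrier H\<rbrakk> \<Longrightarrow> cinner H x (c \<odot> y) = cnj c * cinner H x y"
  by (metis inner_smult_left inner_commute complex_cnj_mult smult_in)

lemma inner_diff_right:
  "\<lbrakk>x \<in> carrier H; y \<in> carrier H; z \<in> carrier H\<rbrakk>
    \<Longrightarrow> cinner H z (x \<ominus> y) = cinner H z x - cinner H z y"
  by (simp add: diff_eq_smult inner_add_right inner_smult_right)

lemma inner_zero_left: "x \<in> carrier H \<Longrightarrow> cinner H \<zero> x = 0"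
  using inner_add_left[of \<zero> \<zero> x] by simp

lemma inner_zero_right: "x \<in> carrier H \<Longrightarrow> cinner H x \<zero> = 0"
  using inner_add_right[of \<zero> \<zero> x] by simp

lemmas inner_simps = inner_add_left inner_smult_left inner_diff_left inner_zero_left
  inner_add_right inner_smult_right inner_diff_right inner_zero_right

lemma Re_inner_self_nonneg: "x \<in> carrier H \<Longrightarrow> 0 \<le> Re (cinner H x x)"
  using inner_pos[of x] inner_zero_left[of \<zero>] by (cases "x = \<zero>") auto

lemma cnorm_power2: "x \<in> carrier H \<Longrightarrow> (cnorm H x)\<^sup>2 = Re (cinner H x x)"
  by (simp add: cnorm_def Re_inner_self_nonneg)

lemma inner_self: "x \<in> carrier H \<Longrightarrow> cinner H x x = complex_of_real ((cnorm H x)\<^sup>2)"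
  using inner_commute[of x x] by (simp add: cnorm_power2 complex_eq_iff)

lemma cnorm_nonneg: "x \<in> carrier H \<Longrightarrow> 0 \<le> cnorm H x"
  by (simp add: cnorm_def Re_inner_self_nonneg)

lemma cnorm_zero: "cnorm H \<zero> = 0"
  by (simp add: cnorm_def inner_zero_left)

lemma cnorm_eq_0: "x \<in> carrier H \<Longrightarrow> cnorm H x = 0 \<longleftrightarrow> x = \<zero>"
  using inner_pos[of x] cnorm_power2[of x] cnorm_zero by fastforce

lemma diff_eq_zero_iff:
  assumes "x \<in> carrier H" "y \<in> carrier H"
  shows "x \<ominus> y = \<zero> \<longleftrightarrow> x = y"
proof
  assume "x \<ominus> y = \<zero>"
  then have "(x \<oplus> \<ominus> y) \<oplus> y = y"
    using assms by (simp add: a_minus_def)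
  then show "x = y"
    using assms by (simp add: M.a_assoc M.l_neg)
qed (use assms in \<open>simp add: a_minus_def M.r_neg\<close>)

lemma eqI_diff: "\<lbrakk>x \<in> carrier H; y \<in> carrier H; cnorm H (x \<ominus> y) = 0\<rbrakk> \<Longrightarrow> x = y"
  by (simp add: cnorm_eq_0 diff_eq_zero_iff)

text \<open>
  Testing against all vectors turns an identity between vectors into one between complex numbers,
  where arithmetic is automatic; most vector identities below are proved this way.
\<close>

lemma vec_eqI:
  assumes "x \<in> carrier H" "y \<in> carrier H"
    and "\<And>z. z \<in> carrier H \<Longrightarrow> cinner H x z = cinner H y z"
  shows "x = y"
proof (rule eqI_diff)
  have "cinner H (x \<ominus> y) (x \<ominus> y) = 0"
    using assms by (simp add: inner_simps)
  then show "cnorm H (x \<ominus> y) = 0"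
    by (simp add: cnorm_def)
qed (use assms in auto)

lemma cnorm_smult: "x \<in> carrier H \<Longrightarrow> cnorm H (c \<odot> x) = cmod c * cnorm H x"
proof -
  assume x: "x \<in> carrier H"
  have "(cnorm H (c \<odot> x))\<^sup>2 = (cmod c * cnorm H x)\<^sup>2"
    using x inner_self[OF x] cmod_power2[of c]
    by (simp add: cnorm_power2 inner_simps power_mult_distrib)
      (simp add: algebra_simps power2_eq_square)
  then show ?thesis
    using x by (simp add: cnorm_nonneg)
qed

lemma Cauchy_Schwarz:
  assumes x: "x \<in> carrier H" and y: "y \<in> carrier H"
  shows "cmod (cinner H x y) \<le> cnorm H x * cnorm H y"
proof (cases "y = \<zero>")
  case True
  then show ?thesis using x by (simp add: inner_simps cnorm_zero)
next
  case False
  define c where "c = cinner H x y / complex_of_real ((cnorm H y)\<^sup>2)"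
  have ny: "cnorm H y \<noteq> 0" using False y by (simp add: cnorm_eq_0)
  have "0 \<le> Re (cinner H (x \<ominus> c \<odot> y) (x \<ominus> c \<odot> y))"
    using x y by (simp add: Re_inner_self_nonneg)
  also have "cinner H (x \<ominus> c \<odot> y) (x \<ominus> c \<odot> y)
      = cinner H x x - cinner H x y * cnj (cinner H x y) / complex_of_real ((cnorm H y)\<^sup>2)"
    using x y ny inner_commute[OF x y] inner_self[OF y]
    by (simp add: inner_simps c_def field_simps power2_eq_square)
  also have "\<dots> = complex_of_real ((cnorm H x)\<^sup>2 - (cmod (cinner H x y))\<^sup>2 / (cnorm H y)\<^sup>2)"
    using inner_self[OF x] complex_norm_square[of "cinner H x y"] by simp
  finally have "(cmod (cinner H x y))\<^sup>2 \<le> (cnorm H x * cnorm H y)\<^sup>2"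
    using ny by (simp add: field_simps power_mult_distrib)
  then show ?thesis
    using cnorm_nonneg x y by (meson mult_nonneg_nonneg power2_le_imp_le)
qed

lemma cnorm_triangle:
  assumes x: "x \<in> carrier H" and y: "y \<in> carrier H"
  shows "cnorm H (x \<oplus> y) \<le> cnorm H x + cnorm H y"
proof (rule power2_le_imp_le)
  have "Re (cinner H x y) \<le> cnorm H x * cnorm H y"
    using Cauchy_Schwarz[OF x y] complex_Re_le_cmod order_trans by blast
  then show "(cnorm H (x \<oplus> y))\<^sup>2 \<le> (cnorm H x + cnorm H y)\<^sup>2"
    using x y inner_commute[OF x y]
    by (simp add: cnorm_power2 inner_simps power2_sum)
qed (use x y in \<open>simp add: cnorm_nonneg\<close>)

lemma cnorm_diff_commute:
  "x \<in> carrier H \<Longrightarrow> y \<in> carrier H \<Longrightarrow> cnorm H (x \<ominus> y) = cnorm H (y \<ominus> x)"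
  by (simp add: cnorm_def inner_simps)

lemma cnorm_diff_triangle:
  assumes "x \<in> carrier H" "y \<in> carrier H" "z \<in> carrier H"
  shows "cnorm H (x \<ominus> z) \<le> cnorm H (x \<ominus> y) + cnorm H (y \<ominus> z)"
proof -
  have "x \<ominus> z = (x \<ominus> y) \<oplus> (y \<ominus> z)"
    using assms by (intro vec_eqI) (simp_all add: inner_simps)
  then show ?thesis
    using assms cnorm_triangle[of "x \<ominus> y" "y \<ominus> z"] by simp
qed

lemma cnorm_diff_le: 
  assumes "x \<in> carrier H" "y \<in> carrier H"
  shows "cnorm H (x \<ominus> y) \<le> cnorm H x + cnorm H y"
proof -
  have "x \<ominus> \<zero> = x" "\<zero> \<ominus> y = (-1) \<odot> y"
    using assms by (auto intro!: vec_eqI simp: inner_simps)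
  then show ?thesis
    using cnorm_diff_triangle[of x \<zero> y] assms by (simp add: cnorm_smult)
qed

lemma metric: "Metric_space (carrier H) (cdist H)"
proof
  fix x y z
  show "0 \<le> cdist H x y"
    by (simp add: cdist_def cnorm_nonneg)
  show "cdist H x y = cdist H y x"
    using cnorm_diff_commute by (simp add: cdist_def)
  show "x \<in> carrier H \<Longrightarrow> y \<in> carrier H \<Longrightarrow> (cdist H x y = 0) = (x = y)"
    by (simp add: cdist_def cnorm_eq_0 diff_eq_zero_iff)
  show "\<lbrakk>x \<in> carrier H; y \<in> carrier H; z \<in> carrier H\<rbrakk>
      \<Longrightarrow> cdist H x z \<le> cdist H x y + cdist H y z"
    by (simp add: cdist_def cnorm_diff_triangle)
qed

definition Cauchy_seq :: "(nat \<Rightarrow> 'a) \<Rightarrow> bool" where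
  "Cauchy_seq s \<longleftrightarrow> (\<forall>n. s n \<in> carrier H) \<and>
     (\<forall>e>0. \<exists>N. \<forall>m\<ge>N. \<forall>n\<ge>N. cnorm H (s m \<ominus> s n) < e)"

definition converges :: "(nat \<Rightarrow> 'a) \<Rightarrow> 'a \<Rightarrow> bool" where
  "converges s l \<longleftrightarrow> l \<in> carrier H \<and> (\<lambda>n. cnorm H (s n \<ominus> l)) \<longlonglongrightarrow> 0"

lemma mcomplete_iff:
  "Metric_space.mcomplete (carrier H) (cdist H) \<longleftrightarrow>
     (\<forall>s. Cauchy_seq s \<longrightarrow> (\<exists>l. converges s l))"
proof -
  interpret X: Metric_space "carrier H" "cdist H" by (rule metric)
  have "X.MCauchy s \<longleftrightarrow> Cauchy_seq s" for s
  proof -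
    have "range s \<subseteq> carrier H \<longleftrightarrow> (\<forall>n. s n \<in> carrier H)" by auto
    then show ?thesis
      unfolding X.MCauchy_def Cauchy_seq_def by (auto simp: cdist_def)
  qed
  moreover have "limitin X.mtopology s l sequentially \<longleftrightarrow> converges s l" if "Cauchy_seq s" for s l
    using that unfolding X.limitin_metric_dist_null converges_def Cauchy_seq_def
    by (auto simp: cdist_def)
  ultimately show ?thesis
    unfolding X.mcomplete_def by metis
qed

end

sublocale complex_hilbert_space \<subseteq> pre_hilbert
  by (intro pre_hilbert.intro pre_hilbert_axioms.intro module_axioms
      cinner_add_left cinner_smult_left cinner_commute cinner_pos)

lemma (in pre_hilbert) complex_hilbert_spaceI:
  assumes "\<And>s. Cauchy_seq s \<Longrightarrow> \<exists>l. converges s l"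
  shows "complex_hilbert_space H"
  using assms
  by (intro complex_hilbert_space.intro complex_hilbert_space_axioms.intro module_axioms
      inner_add_left inner_smult_left inner_commute inner_pos) (simp_all add: mcomplete_iff)

section \<open>Bounded, self-adjoint and invertible operators\<close>

context pre_hilbert
begin

lemma bounded_opI:
  assumes "\<And>x. x \<in> carrier H \<Longrightarrow> T x \<in> carrier H"
    and "\<And>x y. x \<in> carrier H \<Longrightarrow> y \<in> carrier H \<Longrightarrow> T (x \<oplus> y) = T x \<oplus> T y"
    and "\<And>c x. x \<in> carrier H \<Longrightarrow> T (c \<odot> x) = c \<odot> T x"
    and "\<And>x. x \<in> carrier H \<Longrightarrow> cnorm H (T x) \<le> K * cnorm H x"
  shows "bounded_op H T"
  unfolding bounded_op_def
proof (intro conjI exI[of _ K])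
qed (use assms in auto)

lemma bounded_op_in: "bounded_op H T \<Longrightarrow> x \<in> carrier H \<Longrightarrow> T x \<in> carrier H"
  by (auto simp: bounded_op_def)

lemma bounded_op_add:
  "bounded_op H T \<Longrightarrow> x \<in> carrier H \<Longrightarrow> y \<in> carrier H \<Longrightarrow> T (x \<oplus> y) = T x \<oplus> T y"
  by (auto simp: bounded_op_def)

lemma bounded_op_smult: "bounded_op H T \<Longrightarrow> x \<in> carrier H \<Longrightarrow> T (c \<odot> x) = c \<odot> T x"
  by (auto simp: bounded_op_def)

lemma bounded_op_diff:
  "bounded_op H T \<Longrightarrow> x \<in> carrier H \<Longrightarrow> y \<in> carrier H \<Longrightarrow> T (x \<ominus> y) = T x \<ominus> T y"
  by (simp add: diff_eq_smult bounded_op_add bounded_op_smult bounded_op_in)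

lemma bounded_op_bound:
  assumes "bounded_op H T"
  obtains K where "0 < K" "\<And>x. x \<in> carrier H \<Longrightarrow> cnorm H (T x) \<le> K * cnorm H x"
proof -
  obtain K where K: "\<forall>x\<in>carrier H. cnorm H (T x) \<le> K * cnorm H x"
    using assms unfolding bounded_op_def by blast
  have "cnorm H (T x) \<le> max K 1 * cnorm H x" if "x \<in> carrier H" for x
    using bspec[OF K that] cnorm_nonneg[OF that] by (meson max.cobounded1 mult_right_mono order_trans)
  then show ?thesis
    by (intro that[of "max K 1"]) auto
qed

lemma bounded_op_cong:
  assumes "bounded_op H S" "\<And>x. x \<in> carrier H \<Longrightarrow> T x = S x"
  shows "bounded_op H T"
  using assms unfolding bounded_op_def by auto

lemma bounded_op_ident: "bounded_op H (\<lambda>x. x)"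
  by (rule bounded_opI[where K = 1]) auto

lemma bounded_op_comp:
  assumes "bounded_op H S" "bounded_op H T"
  shows "bounded_op H (\<lambda>x. S (T x))"
proof -
  obtain K where K: "0 < K" "\<And>x. x \<in> carrier H \<Longrightarrow> cnorm H (S x) \<le> K * cnorm H x"
    using bounded_op_bound[OF assms(1)] by blast
  obtain L where L: "0 < L" "\<And>x. x \<in> carrier H \<Longrightarrow> cnorm H (T x) \<le> L * cnorm H x"
    using bounded_op_bound[OF assms(2)] by blast
  have "cnorm H (S (T x)) \<le> (K * L) * cnorm H x" if "x \<in> carrier H" for x
  proof -
    have "cnorm H (S (T x)) \<le> K * cnorm H (T x)"
      using K that assms bounded_op_in by blast
    also have "\<dots> \<le> K * (L * cnorm H x)"
      using K L that by simp
    finally show ?thesis by simp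
  qed
  then show ?thesis
    using assms by (intro bounded_opI[where K = "K * L"])
      (simp_all add: bounded_op_add bounded_op_smult bounded_op_in)
qed

lemma bounded_op_scale:
  assumes "bounded_op H T"
  shows "bounded_op H (\<lambda>x. c \<odot> T x)"
proof -
  obtain K where K: "0 < K" "\<And>x. x \<in> carrier H \<Longrightarrow> cnorm H (T x) \<le> K * cnorm H x"
    using bounded_op_bound[OF assms(1)] by blast
  show ?thesis
  proof (rule bounded_opI[where K = "cmod c * K"])
    fix x y d assume x: "x \<in> carrier H"
    show "c \<odot> T (d \<odot> x) = d \<odot> (c \<odot> T x)"
      using x assms by (intro vec_eqI) (simp_all add: bounded_op_smult bounded_op_in inner_simps)
    show "cnorm H (c \<odot> T x) \<le> cmod c * K * cnorm H x"
      using K(2)[OF x] x assms by (simp add: cnorm_smult bounded_op_in mult.assoc mult_left_mono)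
    assume y: "y \<in> carrier H"
    show "c \<odot> T (x \<oplus> y) = c \<odot> T x \<oplus> c \<odot> T y"
      using x y assms
      by (intro vec_eqI) (simp_all add: bounded_op_add bounded_op_in inner_simps algebra_simps)
  qed (use assms in \<open>simp add: bounded_op_in\<close>)
qed

lemma bounded_op_plus:
  assumes "bounded_op H S" "bounded_op H T"
  shows "bounded_op H (\<lambda>x. S x \<oplus> T x)"
proof -
  obtain K where K: "0 < K" "\<And>x. x \<in> carrier H \<Longrightarrow> cnorm H (S x) \<le> K * cnorm H x"
    using bounded_op_bound[OF assms(1)] by blast
  obtain L where L: "0 < L" "\<And>x. x \<in> carrier H \<Longrightarrow> cnorm H (T x) \<le> L * cnorm H x"
    using bounded_op_bound[OF assms(2)] by blast
  show ?thesis
  proof (rule bounded_opI[where K = "K + L"])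
    fix x y d assume x: "x \<in> carrier H"
    show "S (d \<odot> x) \<oplus> T (d \<odot> x) = d \<odot> (S x \<oplus> T x)"
      using x assms
      by (intro vec_eqI) (simp_all add: bounded_op_smult bounded_op_in inner_simps algebra_simps)
    show "cnorm H (S x \<oplus> T x) \<le> (K + L) * cnorm H x"
      using cnorm_triangle[of "S x" "T x"] K(2)[OF x] L(2)[OF x] x assms
      by (simp add: bounded_op_in algebra_simps)
    assume y: "y \<in> carrier H"
    show "S (x \<oplus> y) \<oplus> T (x \<oplus> y) = S x \<oplus> T x \<oplus> (S y \<oplus> T y)"
      using x y assms
      by (intro vec_eqI) (simp_all add: bounded_op_add bounded_op_in inner_simps)
  qed (use assms in \<open>simp add: bounded_op_in\<close>)
qed

lemma bounded_op_minus:
  assumes "bounded_op H S" "bounded_op H T"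
  shows "bounded_op H (\<lambda>x. S x \<ominus> T x)"
  by (rule bounded_op_cong[OF bounded_op_plus[OF assms(1) bounded_op_scale[OF assms(2), of "-1"]]])
    (use assms in \<open>simp add: diff_eq_smult bounded_op_in\<close>)

lemmas bounded_op_intros = bounded_op_ident bounded_op_scale bounded_op_plus
  bounded_op_minus

lemma selfadjoint_bounded: "selfadjoint_op H T \<Longrightarrow> bounded_op H T"
  by (simp add: selfadjoint_op_def)

lemma selfadjoint_swap:
  "selfadjoint_op H T \<Longrightarrow> x \<in> carrier H \<Longrightarrow> y \<in> carrier H \<Longrightarrow> cinner H (T x) y = cinner H x (T y)"
  by (simp add: selfadjoint_op_def)

lemma selfadjoint_real:
  assumes "selfadjoint_op H T" "x \<in> carrier H"
  shows "cinner H (T x) x = complex_of_real (Re (cinner H (T x) x))"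
  using selfadjoint_swap[OF assms assms(2)] inner_commute[of x "T x"] assms
  by (simp add: bounded_op_in selfadjoint_bounded complex_eq_iff)

lemma positive_op_iff:
  "selfadjoint_op H T \<Longrightarrow> positive_op H T \<longleftrightarrow> (\<forall>x\<in>carrier H. 0 \<le> Re (cinner H (T x) x))"
  unfolding positive_op_def using selfadjoint_real[of T]
  by (auto simp: selfadjoint_bounded complex_nonneg_Reals_iff complex_eq_iff)

lemma positive_op_Re: "positive_op H T \<Longrightarrow> x \<in> carrier H \<Longrightarrow> 0 \<le> Re (cinner H (T x) x)"
  by (auto simp: positive_op_def complex_nonneg_Reals_iff)

text \<open>
  Polarization: the form of a positive operator is real at \<open>x + y\<close> and at \<open>x + \<i>y\<close>, which gives the
  imaginary and the real part of \<open>\<langle>Tx, y\<rangle> = cnj \<langle>Ty, x\<rangle>\<close>.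
\<close>

lemma positive_selfadjoint:
  assumes "positive_op H T"
  shows "selfadjoint_op H T"
  unfolding selfadjoint_op_def
proof (intro conjI ballI)
  show T: "bounded_op H T" using assms by (simp add: positive_op_def)
  fix x y assume x: "x \<in> carrier H" and y: "y \<in> carrier H"
  have real: "Im (cinner H (T z) z) = 0" if "z \<in> carrier H" for z
    using assms that by (auto simp: positive_op_def complex_nonneg_Reals_iff)
  note [simp] = bounded_op_in[OF T] bounded_op_add[OF T] bounded_op_smult[OF T]
  have 1: "Im (cinner H (T x) y) = - Im (cinner H (T y) x)"
    using real[of "x \<oplus> y"] real[OF x] real[OF y] x y by (simp add: inner_simps)
  have "cinner H (T (x \<oplus> \<i> \<odot> y)) (x \<oplus> \<i> \<odot> y)
      = cinner H (T x) x + cinner H (T y) y + \<i> * (cinner H (T y) x - cinner H (T x) y)"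
    using x y by (simp add: inner_simps) (simp add: algebra_simps)
  moreover have "Im (cinner H (T (x \<oplus> \<i> \<odot> y)) (x \<oplus> \<i> \<odot> y)) = 0"
    by (rule real) (use x y in simp)
  ultimately have "Im (cinner H (T x) x + cinner H (T y) y
      + \<i> * (cinner H (T y) x - cinner H (T x) y)) = 0"
    by (simp only:)
  then have 2: "Re (cinner H (T x) y) = Re (cinner H (T y) x)"
    using real[OF x] real[OF y] by (simp only: plus_complex.sel minus_complex.sel Im_i_times)
  have "cinner H x (T y) = cnj (cinner H (T y) x)"
    using x y by (intro inner_commute) simp_all
  then show "cinner H (T x) y = cinner H x (T y)"
    using 1 2 by (simp add: complex_eq_iff)
qed

lemma invertible_opI:
  assumes T: "bounded_op H T" and c: "0 < c"
    and below: "\<And>x. x \<in> carrier H \<Longrightarrow> c * cnorm H x \<le> cnorm H (T x)"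
    and surj: "\<And>y. y \<in> carrier H \<Longrightarrow> \<exists>x\<in>carrier H. T x = y"
  shows "invertible_op H T"
proof -
  have inj: "x = y" if "x \<in> carrier H" "y \<in> carrier H" "T x = T y" for x y
  proof (rule eqI_diff)
    have "T (x \<ominus> y) = \<zero>"
      using that T by (simp add: bounded_op_diff bounded_op_in diff_eq_zero_iff)
    then have "c * cnorm H (x \<ominus> y) \<le> 0"
      using below[of "x \<ominus> y"] that cnorm_zero by simp
    then show "cnorm H (x \<ominus> y) = 0"
      using c cnorm_nonneg[of "x \<ominus> y"] that by (simp add: mult_le_0_iff)
  qed (use that in auto)
  define S where "S = (\<lambda>y. SOME x. x \<in> carrier H \<and> T x = y)"
  have S: "S y \<in> carrier H" "T (S y) = y" if "y \<in> carrier H" for y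
    using someI_ex[of "\<lambda>x. x \<in> carrier H \<and> T x = y"] surj[OF that] by (auto simp: S_def)
  have "bounded_op H S"
  proof (rule bounded_opI[where K = "1 / c"])
    fix x y d assume x: "x \<in> carrier H"
    show "S x \<in> carrier H" using S x by simp
    show "S (d \<odot> x) = d \<odot> S x"
      by (rule inj) (use S x T in \<open>simp_all add: bounded_op_smult\<close>)
    show "cnorm H (S x) \<le> 1 / c * cnorm H x"
      using below[of "S x"] S x c by (simp add: field_simps)
    assume y: "y \<in> carrier H"
    show "S (x \<oplus> y) = S x \<oplus> S y"
      by (rule inj) (use S x y T in \<open>simp_all add: bounded_op_add\<close>)
  qed
  moreover have "S (T x) = x" if "x \<in> carrier H" for x
    by (rule inj) (use S that T in \<open>simp_all add: bounded_op_in\<close>)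
  ultimately show ?thesis
    unfolding invertible_op_def using T S by auto
qed

lemma invertible_op_below:
  assumes "invertible_op H T"
  obtains c where "0 < c" "\<And>x. x \<in> carrier H \<Longrightarrow> c * cnorm H x \<le> cnorm H (T x)"
proof -
  obtain S where S: "bounded_op H S" "\<And>x. x \<in> carrier H \<Longrightarrow> S (T x) = x"
    using assms by (auto simp: invertible_op_def)
  obtain K where K: "0 < K" "\<And>x. x \<in> carrier H \<Longrightarrow> cnorm H (S x) \<le> K * cnorm H x"
    using bounded_op_bound[OF S(1)] by blast
  have "1 / K * cnorm H x \<le> cnorm H (T x)" if "x \<in> carrier H" for x
    using K(1) K(2)[of "T x"] S(2)[OF that] that assms
    by (simp add: field_simps invertible_op_def bounded_op_in)
  then show ?thesis using that K by (metis divide_pos_pos zero_less_one)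
qed

lemma invertible_op_cong:
  assumes "invertible_op H S" "\<And>x. x \<in> carrier H \<Longrightarrow> T x = S x"
  shows "invertible_op H T"
proof -
  have T: "bounded_op H T" using assms bounded_op_cong by (auto simp: invertible_op_def)
  obtain R where R: "bounded_op H R" "\<forall>x\<in>carrier H. R (S x) = x \<and> S (R x) = x"
    using assms by (auto simp: invertible_op_def)
  then have "\<forall>x\<in>carrier H. R (T x) = x \<and> T (R x) = x"
    using assms bounded_op_in[OF R(1)] by simp
  then show ?thesis using T R by (auto simp: invertible_op_def)
qed

lemma invertible_op_comp:
  assumes "invertible_op H S" "invertible_op H T"
  shows "invertible_op H (\<lambda>x. S (T x))"
proof -
  obtain S' where S': "bounded_op H S'" "\<forall>x\<in>carrier H. S' (S x) = x \<and> S (S' x) = x"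
    using assms by (auto simp: invertible_op_def)
  obtain T' where T': "bounded_op H T'" "\<forall>x\<in>carrier H. T' (T x) = x \<and> T (T' x) = x"
    using assms by (auto simp: invertible_op_def)
  have ST: "bounded_op H S" "bounded_op H T" using assms by (auto simp: invertible_op_def)
  have "bounded_op H (\<lambda>x. S (T x))" "bounded_op H (\<lambda>x. T' (S' x))"
    using bounded_op_comp[OF ST] bounded_op_comp[OF T'(1) S'(1)] by auto
  moreover have "\<forall>x\<in>carrier H. T' (S' (S (T x))) = x \<and> S (T (T' (S' x))) = x"
    using S' T' ST by (simp add: bounded_op_in)
  ultimately show ?thesis
    unfolding invertible_op_def by blast
qed

lemma invertible_op_inverse:
  assumes "invertible_op H T"
  obtains S where "bounded_op H S" "invertible_op H S"
    "\<And>x. x \<in> carrier H \<Longrightarrow> S (T x) = x" "\<And>x. x \<in> carrier H \<Longrightarrow> T (S x) = x"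
proof -
  obtain S where S: "bounded_op H S" "\<forall>x\<in>carrier H. S (T x) = x \<and> T (S x) = x"
    using assms by (auto simp: invertible_op_def)
  moreover from this have "invertible_op H S"
    using assms unfolding invertible_op_def by blast
  ultimately show ?thesis
    using that by blast
qed

lemma invertible_op_cancel_left:
  assumes "invertible_op H (\<lambda>x. S (T x))" "invertible_op H S" "bounded_op H T"
  shows "invertible_op H T"
proof -
  obtain R where R: "invertible_op H R" "\<And>x. x \<in> carrier H \<Longrightarrow> R (S x) = x"
    using invertible_op_inverse[OF assms(2)] by metis
  show ?thesis
    by (rule invertible_op_cong[OF invertible_op_comp[OF R(1) assms(1)]])
      (use R assms in \<open>simp add: bounded_op_in\<close>)
qed

lemma invertible_op_scale:
  assumes "c \<noteq> 0" "invertible_op H T"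
  shows "invertible_op H (\<lambda>x. c \<odot> T x)"
proof -
  have "invertible_op H (\<lambda>x. c \<odot> x)"
    unfolding invertible_op_def
  proof (intro conjI exI[of _ "\<lambda>x. (1 / c) \<odot> x"] ballI)
    show "bounded_op H (\<lambda>x. c \<odot> x)" "bounded_op H (\<lambda>x. (1 / c) \<odot> x)"
      by (rule bounded_op_scale[OF bounded_op_ident])+
  qed (use assms in \<open>auto intro!: vec_eqI simp: inner_simps\<close>)
  then show ?thesis
    using invertible_op_comp[of "\<lambda>x. c \<odot> x" T] assms by simp
qed

end

section \<open>Coercive operators and the spectrum\<close>

context complex_hilbert_space
begin

lemma Cauchy_converges: "Cauchy_seq s \<Longrightarrow> \<exists>l. converges s l"
  using complete mcomplete_iff by blast

text \<open>
  The Lax-Milgram lemma. The equation \<open>Tx = y\<close> is the fixed point equation of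
  \<open>f(x) = x - s(Tx - y)\<close>, and \<open>\<parallel>d - sTd\<parallel>\<^sup>2 \<le> (1 - 2sc + s\<^sup>2K\<^sup>2) \<parallel>d\<parallel>\<^sup>2\<close> if \<open>\<parallel>T\<parallel> \<le> K\<close>. The best value
  \<open>s = c/K\<^sup>2\<close> makes \<open>f\<close> a contraction.
\<close>

lemma coercive_invertible:
  assumes T: "bounded_op H T" and c: "0 < c"
    and coercive: "\<And>x. x \<in> carrier H \<Longrightarrow> c * (cnorm H x)\<^sup>2 \<le> Re (cinner H (T x) x)"
  shows "invertible_op H T"
proof (rule invertible_opI[OF T c])
  show below: "c * cnorm H x \<le> cnorm H (T x)" if x: "x \<in> carrier H" for x
  proof (cases "cnorm H x = 0")
    case False
    have "c * (cnorm H x)\<^sup>2 \<le> cnorm H (T x) * cnorm H x"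
      using coercive[OF x] Cauchy_Schwarz[of "T x" x] complex_Re_le_cmod[of "cinner H (T x) x"] x T
      by (simp add: bounded_op_in)
    then show ?thesis
      using False cnorm_nonneg[OF x] by (simp add: power2_eq_square field_simps)
  qed (use x T in \<open>simp add: cnorm_nonneg bounded_op_in\<close>)
  fix y assume y: "y \<in> carrier H"
  obtain K0 where K0: "0 < K0" "\<And>x. x \<in> carrier H \<Longrightarrow> cnorm H (T x) \<le> K0 * cnorm H x"
    using bounded_op_bound[OF T] by blast
  define K where "K = max c K0"
  have K: "0 < K" "c \<le> K" "\<And>x. x \<in> carrier H \<Longrightarrow> cnorm H (T x) \<le> K * cnorm H x"
    using K0 c unfolding K_def
    by (auto intro: order_trans[OF K0(2)] simp: mult_right_mono cnorm_nonneg)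
  define s where "s = c / K\<^sup>2"
  define q where "q = sqrt (1 - c\<^sup>2 / K\<^sup>2)"
  have q2: "0 \<le> 1 - c\<^sup>2 / K\<^sup>2" and q1: "q < 1"
    using K(1,2) c by (auto simp: q_def power_mono)
  define f where "f = (\<lambda>x. x \<ominus> complex_of_real s \<odot> (T x \<ominus> y))"
  have f_in: "f x \<in> carrier H" if "x \<in> carrier H" for x
    using that y T by (simp add: f_def bounded_op_in)
  interpret X: Metric_space "carrier H" "cdist H" by (rule metric)
  have contr: "cdist H (f u) (f v) \<le> q * cdist H u v" if u: "u \<in> carrier H" and v: "v \<in> carrier H" for u v
  proof -
    define d where "d = u \<ominus> v"
    have d: "d \<in> carrier H" using u v by (simp add: d_def)
    have Td: "T d \<in> carrier H" using d T by (simp add: bounded_op_in)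
    have fd: "f u \<ominus> f v = d \<ominus> complex_of_real s \<odot> T d"
      using u v y T d unfolding f_def d_def
      by (intro vec_eqI) (simp_all add: bounded_op_in bounded_op_diff inner_simps algebra_simps)
    have "(cnorm H (f u \<ominus> f v))\<^sup>2
        = (cnorm H d)\<^sup>2 - 2 * s * Re (cinner H (T d) d) + s\<^sup>2 * (cnorm H (T d))\<^sup>2"
      using d Td inner_commute[OF d Td] unfolding fd
      by (simp add: cnorm_power2 inner_simps) (simp add: algebra_simps power2_eq_square)
    also have "\<dots> \<le> (cnorm H d)\<^sup>2 - 2 * s * (c * (cnorm H d)\<^sup>2) + s\<^sup>2 * (K * cnorm H d)\<^sup>2"
      using coercive[OF d] K(3)[OF d] c Td
      by (intro add_mono diff_left_mono mult_left_mono power_mono) (auto simp: s_def cnorm_nonneg)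
    also have "\<dots> = (1 - c\<^sup>2 / K\<^sup>2) * (cnorm H d)\<^sup>2"
      using K(1) by (simp add: s_def field_simps power2_eq_square)
    also have "\<dots> = (q * cnorm H d)\<^sup>2"
      using q2 by (simp add: q_def power_mult_distrib)
    finally have "cnorm H (f u \<ominus> f v) \<le> q * cnorm H d"
      by (rule power2_le_imp_le) (use q2 d in \<open>auto simp: q_def cnorm_nonneg\<close>)
    then show ?thesis using u v f_in by (simp add: cdist_def d_def)
  qed
  obtain x where x: "x \<in> carrier H" "f x = x"
    by (rule X.Banach_fixedpoint_thm[OF complete, of f q]) (use f_in q1 contr y in auto)
  have "x \<ominus> f x = complex_of_real s \<odot> (T x \<ominus> y)"
    using x(1) y T by (intro vec_eqI) (simp_all add: f_def inner_simps bounded_op_in)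
  then have "cnorm H (complex_of_real s \<odot> (T x \<ominus> y)) = 0"
    using x diff_eq_zero_iff[of x x] by (simp add: cnorm_zero)
  then have "cnorm H (T x \<ominus> y) = 0"
    using x(1) y T K(1) c by (simp add: cnorm_smult bounded_op_in s_def)
  then have "T x = y"
    using x(1) y T by (intro eqI_diff) (auto simp: bounded_op_in)
  then show "\<exists>x\<in>carrier H. T x = y" using x by blast
qed

text \<open>
  Outside \<open>[m, M]\<close> some scalar multiple of \<open>T - z\<close> is coercive: the multiple by \<open>\<i>\<close> or \<open>-\<i>\<close> if \<open>z\<close> is not
  real, by \<open>1\<close> if \<open>z < m\<close>, and by \<open>-1\<close> if \<open>z > M\<close>.
\<close>

lemma selfadjoint_spectrum_bounds:
  assumes T: "selfadjoint_op H T"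
    and lower: "\<And>x. x \<in> carrier H \<Longrightarrow> m * (cnorm H x)\<^sup>2 \<le> Re (cinner H (T x) x)"
    and upper: "\<And>x. x \<in> carrier H \<Longrightarrow> Re (cinner H (T x) x) \<le> M * (cnorm H x)\<^sup>2"
  shows "op_spectrum H T \<subseteq> complex_of_real ` {m..M}"
proof
  fix z assume z: "z \<in> op_spectrum H T"
  define S where "S = (\<lambda>x. T x \<ominus> z \<odot> x)"
  have S: "bounded_op H S"
    unfolding S_def using T by (intro bounded_op_intros) (simp add: selfadjoint_bounded)
  have not: "\<not> invertible_op H S" using z by (simp add: op_spectrum_def S_def)
  have Tx: "T x \<in> carrier H" "Im (cinner H (T x) x) = 0" if "x \<in> carrier H" for x
    using that T selfadjoint_real[OF T that] by (auto simp: bounded_op_in selfadjoint_bounded complex_eq_iff)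
  have coerc: False if "c \<noteq> 0" "0 < e"
    "\<And>x. x \<in> carrier H \<Longrightarrow> e * (cnorm H x)\<^sup>2 \<le> Re (c * cinner H (S x) x)" for c e
  proof -
    have "invertible_op H (\<lambda>x. c \<odot> S x)"
      using that S by (intro coercive_invertible[of _ e] bounded_op_scale)
        (auto simp: inner_simps bounded_op_in)
    then have "invertible_op H (\<lambda>x. (1 / c) \<odot> (c \<odot> S x))"
      using that by (intro invertible_op_scale[of "1 / c" "\<lambda>x. c \<odot> S x"]) auto
    then have "invertible_op H S"
      by (rule invertible_op_cong) (use that S in \<open>auto intro!: vec_eqI simp: inner_simps bounded_op_in\<close>)
    then show False using not by blast
  qed
  have inner: "cinner H (S x) x = cinner H (T x) x - z * complex_of_real ((cnorm H x)\<^sup>2)"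
    if "x \<in> carrier H" for x
    using that Tx by (simp add: S_def inner_simps inner_self)
  have "Im z = 0"
  proof (rule ccontr)
    assume "Im z \<noteq> 0"
    then show False
      by (intro coerc[of "\<i> * complex_of_real (sgn (Im z))" "\<bar>Im z\<bar>"])
        (auto simp: inner Tx sgn_if)
  qed
  moreover have "m \<le> Re z"
  proof (rule ccontr)
    assume "\<not> m \<le> Re z"
    then show False
      using lower by (intro coerc[of 1 "m - Re z"]) (auto simp: inner algebra_simps)
  qed
  moreover have "Re z \<le> M"
  proof (rule ccontr)
    assume "\<not> Re z \<le> M"
    then show False
      using upper by (intro coerc[of "-1" "Re z - M"]) (auto simp: inner algebra_simps)
  qed
  ultimately show "z \<in> complex_of_real ` {m..M}"
    by (intro image_eqI[of _ _ "Re z"]) (auto simp: complex_eq_iff)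
qed

end

section \<open>Polynomials of an operator\<close>

lemma of_real_poly_add:
  "map_poly complex_of_real (p + q) = map_poly complex_of_real p + map_poly complex_of_real q"
  by (simp add: poly_eq_iff coeff_map_poly)

lemma of_real_poly_mult:
  "map_poly complex_of_real (p * q) = map_poly complex_of_real p * map_poly complex_of_real q"
  by (simp add: poly_eq_iff coeff_map_poly coeff_mult)

lemma of_real_poly_smult:
  "map_poly complex_of_real (Polynomial.smult c q)
    = Polynomial.smult (complex_of_real c) (map_poly complex_of_real q)"
  by (simp add: poly_eq_iff coeff_map_poly)

lemma poly_of_real_poly:
  "poly (map_poly complex_of_real p) (complex_of_real t) = complex_of_real (poly p t)"
  by (induction p) (simp_all add: map_poly_pCons)

text \<open>
  Complex polynomials of an operator, although the functional calculus only uses real ones: the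
  factorization into linear factors needs complex roots.
\<close>

definition cpoly_op :: "'a hilbert \<Rightarrow> complex poly \<Rightarrow> ('a \<Rightarrow> 'a) \<Rightarrow> 'a \<Rightarrow> 'a" where
  "cpoly_op H q A x =
     finsum H (\<lambda>i. Polynomial.coeff q i \<odot>\<^bsub>H\<^esub> (A ^^ i) x) {..Polynomial.degree q}"

lemma poly_op_eq_cpoly_op: "poly_op H p A x = cpoly_op H (map_poly complex_of_real p) A x"
  by (simp add: poly_op_def cpoly_op_def degree_map_poly coeff_map_poly)

context pre_hilbert
begin

lemma inner_finsum_left:
  assumes "finite I" "\<And>i. i \<in> I \<Longrightarrow> f i \<in> carrier H" "z \<in> carrier H"
  shows "cinner H (finsum H f I) z = (\<Sum>i\<in>I. cinner H (f i) z)"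
  using assms
proof (induction I)
  case (insert a I)
  then have "finsum H f I \<in> carrier H" by (intro M.finsum_closed) auto
  with insert show ?case
    by (subst M.finsum_insert) (auto simp: inner_add_left)
qed (simp add: inner_zero_left)

lemma bounded_op_funpow_in: "bounded_op H A \<Longrightarrow> x \<in> carrier H \<Longrightarrow> (A ^^ i) x \<in> carrier H"
  by (induction i) (auto simp: bounded_op_in)

lemma cpoly_op_in: "bounded_op H A \<Longrightarrow> x \<in> carrier H \<Longrightarrow> cpoly_op H q A x \<in> carrier H"
  unfolding cpoly_op_def by (intro M.finsum_closed) (auto simp: bounded_op_funpow_in)

lemma inner_cpoly_op:
  assumes "bounded_op H A" "x \<in> carrier H" "z \<in> carrier H" "Polynomial.degree q \<le> n"
  shows "cinner H (cpoly_op H q A x) z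
    = (\<Sum>i\<le>n. Polynomial.coeff q i * cinner H ((A ^^ i) x) z)"
proof -
  have "cinner H (cpoly_op H q A x) z
      = (\<Sum>i\<le>Polynomial.degree q. Polynomial.coeff q i * cinner H ((A ^^ i) x) z)"
    unfolding cpoly_op_def using assms
    by (subst inner_finsum_left) (auto simp: bounded_op_funpow_in inner_smult_left)
  also have "\<dots> = (\<Sum>i\<le>n. Polynomial.coeff q i * cinner H ((A ^^ i) x) z)"
    using assms(4) by (intro sum.mono_neutral_left) (auto simp: coeff_eq_0)
  finally show ?thesis .
qed

lemma bounded_op_zero: "bounded_op H A \<Longrightarrow> A \<zero> = \<zero>"
  using bounded_op_diff[of A \<zero> \<zero>] diff_eq_zero_iff[of \<zero> \<zero>] diff_eq_zero_iff[of "A \<zero>" "A \<zero>"]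
  by (simp add: bounded_op_in)

lemma bounded_op_finsum:
  assumes "bounded_op H A" "finite I" "\<And>i. i \<in> I \<Longrightarrow> f i \<in> carrier H"
  shows "A (finsum H f I) = finsum H (\<lambda>i. A (f i)) I"
  using assms(2,3)
proof (induction I)
  case empty
  show ?case using assms(1) by (simp add: bounded_op_zero)
next
  case (insert a I)
  then have "finsum H f I \<in> carrier H" "(\<lambda>i. A (f i)) \<in> I \<rightarrow> carrier H"
    using assms by (auto simp: bounded_op_in)
  with insert assms(1) show ?case
    by (simp add: M.finsum_insert Pi_iff bounded_op_in bounded_op_add)
qed

lemma cpoly_op_0: "bounded_op H A \<Longrightarrow> x \<in> carrier H \<Longrightarrow> cpoly_op H 0 A x = \<zero>"
  by (intro vec_eqI) (auto simp: cpoly_op_in inner_cpoly_op[of _ _ _ _ 0] inner_zero_left)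

lemma cpoly_op_pCons:
  assumes A: "bounded_op H A" and x: "x \<in> carrier H"
  shows "cpoly_op H (pCons a q) A x = a \<odot> x \<oplus> A (cpoly_op H q A x)"
proof (rule vec_eqI)
  fix z assume z: "z \<in> carrier H"
  define n where "n = Polynomial.degree q"
  have "A (cpoly_op H q A x) = finsum H (\<lambda>i. Polynomial.coeff q i \<odot> (A ^^ Suc i) x) {..n}"
    unfolding cpoly_op_def n_def using A x
    by (subst bounded_op_finsum)
      (auto simp: bounded_op_funpow_in bounded_op_smult bounded_op_in intro!: M.finsum_cong')
  then have "cinner H (A (cpoly_op H q A x)) z
      = (\<Sum>i\<le>n. Polynomial.coeff q i * cinner H ((A ^^ Suc i) x) z)"
    using A x z by (simp add: inner_finsum_left bounded_op_funpow_in bounded_op_in inner_smult_left)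
  moreover have "cinner H (cpoly_op H (pCons a q) A x) z
      = (\<Sum>i\<le>Suc n. Polynomial.coeff (pCons a q) i * cinner H ((A ^^ i) x) z)"
    using A x z by (intro inner_cpoly_op) (auto simp: n_def degree_pCons_le)
  ultimately show "cinner H (cpoly_op H (pCons a q) A x) z
      = cinner H (a \<odot> x \<oplus> A (cpoly_op H q A x)) z"
    using A x z unfolding sum.atMost_Suc_shift by (simp add: inner_simps cpoly_op_in bounded_op_in)
qed (use A x in \<open>auto simp: cpoly_op_in bounded_op_in\<close>)

lemma bounded_cpoly_op:
  assumes A: "bounded_op H A"
  shows "bounded_op H (cpoly_op H q A)"
proof (induction q)
  case 0
  show ?case
    by (rule bounded_op_cong[OF bounded_op_minus[OF bounded_op_ident bounded_op_ident]])
      (use A diff_eq_zero_iff[THEN iffD2] in \<open>simp add: cpoly_op_0\<close>)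
next
  case (pCons a q)
  show ?case
    by (rule bounded_op_cong[OF bounded_op_plus[OF bounded_op_scale[OF bounded_op_ident, of a]
            bounded_op_comp[OF A pCons.IH]]])
      (use A in \<open>simp add: cpoly_op_pCons\<close>)
qed

lemma cpoly_op_add:
  assumes A: "bounded_op H A" and x: "x \<in> carrier H"
  shows "cpoly_op H (p + q) A x = cpoly_op H p A x \<oplus> cpoly_op H q A x"
proof (rule vec_eqI)
  fix z assume z: "z \<in> carrier H"
  define n where "n = max (Polynomial.degree p) (Polynomial.degree q)"
  have "Polynomial.degree (p + q) \<le> n" "Polynomial.degree p \<le> n" "Polynomial.degree q \<le> n"
    by (auto simp: n_def degree_add_le_max)
  then show "cinner H (cpoly_op H (p + q) A x) z = cinner H (cpoly_op H p A x \<oplus> cpoly_op H q A x) z"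
    using A x z
    by (simp add: inner_cpoly_op[where n = n] inner_add_left cpoly_op_in sum.distrib ring_distribs)
qed (use A x in \<open>auto simp: cpoly_op_in\<close>)

lemma cpoly_op_smult:
  assumes A: "bounded_op H A" and x: "x \<in> carrier H"
  shows "cpoly_op H (Polynomial.smult c q) A x = c \<odot> cpoly_op H q A x"
proof (rule vec_eqI)
  fix z assume z: "z \<in> carrier H"
  have "Polynomial.degree (Polynomial.smult c q) \<le> Polynomial.degree q"
    by (rule degree_smult_le)
  then show "cinner H (cpoly_op H (Polynomial.smult c q) A x) z = cinner H (c \<odot> cpoly_op H q A x) z"
    using A x z
    by (simp add: inner_cpoly_op[where n = "Polynomial.degree q"] inner_smult_left cpoly_op_in
        sum_distrib_left mult.assoc)
qed (use A x in \<open>auto simp: cpoly_op_in\<close>)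

lemma cpoly_op_mult:
  assumes A: "bounded_op H A" and x: "x \<in> carrier H"
  shows "cpoly_op H (p * q) A x = cpoly_op H p A (cpoly_op H q A x)"
proof (induction p)
  case (pCons a p)
  have "cpoly_op H (pCons a p * q) A x
      = cpoly_op H (Polynomial.smult a q) A x \<oplus> (0 \<odot> x \<oplus> A (cpoly_op H (p * q) A x))"
    using A x by (simp add: mult_pCons_left cpoly_op_add cpoly_op_pCons)
  also have "0 \<odot> x \<oplus> A (cpoly_op H (p * q) A x) = A (cpoly_op H (p * q) A x)"
    using A x by (intro vec_eqI) (auto simp: inner_simps cpoly_op_in bounded_op_in)
  finally show ?case
    using A x pCons.IH by (simp add: cpoly_op_smult cpoly_op_pCons cpoly_op_in)
qed (use A x in \<open>simp add: cpoly_op_0 cpoly_op_in\<close>)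

lemma cpoly_op_linear:
  assumes A: "bounded_op H A" and x: "x \<in> carrier H"
  shows "cpoly_op H [:-z, 1:] A x = A x \<ominus> z \<odot> x"
  using A x
  by (intro vec_eqI)
    (auto simp: inner_simps cpoly_op_pCons cpoly_op_0 cpoly_op_in bounded_op_in bounded_op_add
      bounded_op_smult bounded_op_zero)

text \<open>
  In the factorization \<open>q(A) = c (A - z\<^sub>1) \<cdots> (A - z\<^sub>n)\<close> no root lies in the spectrum, so every factor is
  invertible.
\<close>

lemma invertible_cpoly_op:
  assumes A: "bounded_op H A" and q: "q \<noteq> 0"
    and roots: "\<And>z. z \<in> op_spectrum H A \<Longrightarrow> poly q z \<noteq> 0"
  shows "invertible_op H (cpoly_op H q A)"
proof -
  obtain R where R: "q = Polynomial.smult (Polynomial.lead_coeff q) (\<Prod>z\<in>#R. [:-z, 1:])"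
    using alg_closed_imp_factorization[OF q] by blast
  define c where "c = Polynomial.lead_coeff q"
  have c: "c \<noteq> 0" using q by (simp add: c_def)
  have "poly q z = 0" if "z \<in># R" for z
  proof -
    have "[:-z, 1:] dvd (\<Prod>z\<in>#R. [:-z, 1:])"
      using that by (auto intro!: dvd_prod_mset)
    then have "[:-z, 1:] dvd q"
      by (subst R) (rule dvd_smult)
    then show ?thesis by (simp add: poly_eq_0_iff_dvd)
  qed
  then have "\<forall>z\<in>#R. z \<notin> op_spectrum H A" using roots by blast
  then have "invertible_op H (cpoly_op H (\<Prod>z\<in>#R. [:-z, 1:]) A)"
  proof (induction R)
    case empty
    have "invertible_op H (\<lambda>x. x)"
      unfolding invertible_op_def by (intro conjI exI[of _ "\<lambda>x. x"] bounded_op_ident) auto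
    then show ?case
      by (rule invertible_op_cong)
        (use A in \<open>auto intro!: vec_eqI simp: one_pCons cpoly_op_pCons cpoly_op_0 cpoly_op_in bounded_op_in
            inner_simps  bounded_op_zero\<close>)
  next
    case (add z R)
    have "invertible_op H (cpoly_op H [:-z, 1:] A)"
    proof (rule invertible_op_cong)
      show "invertible_op H (\<lambda>x. A x \<ominus> z \<odot> x)"
        using add.prems by (simp add: op_spectrum_def)
    qed (rule cpoly_op_linear[OF A])
    moreover have "invertible_op H (cpoly_op H (\<Prod>z\<in>#R. [:-z, 1:]) A)"
      using add by simp
    ultimately show ?case
      by (rule invertible_op_cong[OF invertible_op_comp])
        (simp add: cpoly_op_mult[OF A] del: mult_pCons_left)
  qed
  from invertible_op_scale[OF c this] show ?thesis
    by (rule invertible_op_cong) (subst R, simp add: c_def cpoly_op_smult[OF A])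
qed

lemma bounded_poly_op: "bounded_op H A \<Longrightarrow> bounded_op H (poly_op H p A)"
  by (rule bounded_op_cong[OF bounded_cpoly_op[where q = "map_poly complex_of_real p"]])
    (simp_all add: poly_op_eq_cpoly_op)

lemma poly_op_add:
  assumes "bounded_op H A" "x \<in> carrier H"
  shows "poly_op H (p + q) A x = poly_op H p A x \<oplus> poly_op H q A x"
  using assms by (simp add: poly_op_eq_cpoly_op of_real_poly_add cpoly_op_add)

lemma poly_op_smult:
  assumes "bounded_op H A" "x \<in> carrier H"
  shows "poly_op H (Polynomial.smult c p) A x = complex_of_real c \<odot> poly_op H p A x"
  using assms by (simp add: poly_op_eq_cpoly_op of_real_poly_smult cpoly_op_smult)

lemma poly_op_diff:
  assumes "bounded_op H A" "x \<in> carrier H"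
  shows "poly_op H (p - q) A x = poly_op H p A x \<ominus> poly_op H q A x"
proof -
  have "p - q = p + Polynomial.smult (-1) q" by simp
  then show ?thesis
    using assms
    by (simp only: poly_op_add poly_op_smult) (simp add: diff_eq_smult bounded_op_in bounded_poly_op)
qed

lemma poly_op_mult:
  assumes "bounded_op H A" "x \<in> carrier H"
  shows "poly_op H (p * q) A x = poly_op H p A (poly_op H q A x)"
  using assms by (simp add: poly_op_eq_cpoly_op of_real_poly_mult cpoly_op_mult)

lemma poly_op_const: 
  assumes "bounded_op H A" "x \<in> carrier H"
  shows "poly_op H [:c:] A x = complex_of_real c \<odot> x"
  using assms
  by (intro vec_eqI) (auto simp: poly_op_eq_cpoly_op map_poly_pCons cpoly_op_pCons cpoly_op_0
      cpoly_op_in bounded_op_in inner_simps bounded_op_zero)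

lemma poly_op_X:
  assumes "bounded_op H A" "x \<in> carrier H"
  shows "poly_op H [:0, 1:] A x = A x"
  using assms cpoly_op_linear[OF assms, of 0]
  by (auto simp: poly_op_eq_cpoly_op map_poly_pCons inner_simps bounded_op_in intro!: vec_eqI)

lemma selfadjoint_poly_op:
  assumes A: "selfadjoint_op H A"
  shows "selfadjoint_op H (poly_op H p A)"
proof -
  have b: "bounded_op H A" using A by (simp add: selfadjoint_bounded)
  have pow: "cinner H ((A ^^ i) x) y = cinner H x ((A ^^ i) y)"
    if "x \<in> carrier H" "y \<in> carrier H" for i x y
    using that
  proof (induction i arbitrary: y)
    case (Suc i)
    have "cinner H (A ((A ^^ i) x)) y = cinner H ((A ^^ i) x) (A y)"
      using Suc.prems b by (intro selfadjoint_swap[OF A]) (simp_all add: bounded_op_funpow_in)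
    then show ?case
      using Suc b by (simp add: bounded_op_in funpow_swap1)
  qed simp
  have "cinner H (poly_op H p A x) y = cinner H x (poly_op H p A y)"
    if x: "x \<in> carrier H" and y: "y \<in> carrier H" for x y
  proof -
    have sum: "cinner H (poly_op H p A u) v
        = (\<Sum>i\<le>Polynomial.degree p. complex_of_real (Polynomial.coeff p i) * cinner H ((A ^^ i) u) v)"
      if "u \<in> carrier H" "v \<in> carrier H" for u v
      using inner_cpoly_op[OF b that, of "map_poly complex_of_real p" "Polynomial.degree p"]
      by (simp add: poly_op_eq_cpoly_op degree_map_poly coeff_map_poly)
    have "cinner H x (poly_op H p A y) = cnj (cinner H (poly_op H p A y) x)"
      by (rule inner_commute) (use x y b in \<open>simp_all add: bounded_op_in bounded_poly_op\<close>)
    also have "\<dots> = (\<Sum>i\<le>Polynomial.degree p. complex_of_real (Polynomial.coeff p i) * cinner H x ((A ^^ i) y))"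
      unfolding sum[OF y x]
      using inner_commute[of "(A ^^ _) y" x] x y b by (simp add: bounded_op_funpow_in)
    finally show ?thesis
      using sum[OF x y] pow[OF x y] by simp
  qed
  then show ?thesis
    using b by (simp add: selfadjoint_op_def bounded_poly_op)
qed

lemma op_norm_bound:
  assumes T: "bounded_op H T" and x: "x \<in> carrier H"
  shows "cnorm H (T x) \<le> op_norm H T * cnorm H x"
proof (cases "cnorm H x = 0")
  case True
  then show ?thesis using bounded_op_bound[OF T] x
    by (metis mult_zero_right)
next
  case False
  then have pos: "0 < cnorm H x" using cnorm_nonneg[OF x] by simp
  define B where "B = {K. 0 \<le> K \<and> (\<forall>x\<in>carrier H. cnorm H (T x) \<le> K * cnorm H x)}"
  obtain K where "0 < K" "\<And>x. x \<in> carrier H \<Longrightarrow> cnorm H (T x) \<le> K * cnorm H x"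
    using bounded_op_bound[OF T] by metis
  then have "K \<in> B" by (auto simp: B_def)
  then have "cnorm H (T x) / cnorm H x \<le> Inf B"
    using x pos by (intro cInf_greatest) (auto simp: B_def field_simps)
  then show ?thesis
    using pos by (simp add: op_norm_def B_def field_simps)
qed

lemma op_norm_le:
  assumes "0 \<le> K" "\<And>x. x \<in> carrier H \<Longrightarrow> cnorm H (T x) \<le> K * cnorm H x"
  shows "op_norm H T \<le> K"
  unfolding op_norm_def using assms by (intro cInf_lower) (auto intro!: bdd_belowI[of _ 0])

lemma op_norm_nonneg: "bounded_op H T \<Longrightarrow> 0 \<le> op_norm H T"
  unfolding op_norm_def
  by (rule cInf_greatest) (auto elim!: bounded_op_bound intro: less_imp_le)

text \<open>
  With \<open>m = \<parallel>S\<parallel>\<close> one has \<open>\<parallel>(m\<^sup>2 - S\<^sup>2)x\<parallel>\<^sup>2 = m\<^sup>4\<parallel>x\<parallel>\<^sup>2 - 2m\<^sup>2\<parallel>Sx\<parallel>\<^sup>2 + \<parallel>S\<^sup>2x\<parallel>\<^sup>2 \<le> m\<^sup>2(m\<^sup>2\<parallel>x\<parallel>\<^sup>2 - \<parallel>Sx\<parallel>\<^sup>2)\<close>.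
  If \<open>m\<^sup>2 - S\<^sup>2\<close> were invertible, it would be bounded below by some \<open>c > 0\<close>, and the inequality would
  bound \<open>\<parallel>Sx\<parallel>\<close> by \<open>(m\<^sup>4 - c\<^sup>2)\<^bsup>1/2\<^esup>/m \<cdot> \<parallel>x\<parallel>\<close> with a factor smaller than \<open>m\<close>.
\<close>

lemma not_invertible_norm_sq_minus_square:
  assumes S: "selfadjoint_op H S" and m: "op_norm H S = m"
    and ne: "carrier H \<noteq> {\<zero>}"
  shows "\<not> invertible_op H (\<lambda>x. complex_of_real (m\<^sup>2) \<odot> x \<ominus> S (S x))"
proof
  define T where "T = (\<lambda>x. complex_of_real (m\<^sup>2) \<odot> x \<ominus> S (S x))"
  have b: "bounded_op H S" using S by (simp add: selfadjoint_bounded)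
  note [simp] = bounded_op_in[OF b]
  have m0: "0 \<le> m" using op_norm_nonneg[OF b] m by simp
  have T2: "(cnorm H (T x))\<^sup>2 \<le> m\<^sup>2 * (m\<^sup>2 * (cnorm H x)\<^sup>2 - (cnorm H (S x))\<^sup>2)" if x: "x \<in> carrier H" for x
  proof -
    have "cinner H (S (S x)) x = cinner H (S x) (S x)" "cinner H x (S (S x)) = cinner H (S x) (S x)"
      using selfadjoint_swap[OF S] x by simp_all
    then have "cinner H (T x) (T x)
        = complex_of_real (m^4) * cinner H x x - 2 * complex_of_real (m\<^sup>2) * cinner H (S x) (S x) + cinner H (S (S x)) (S (S x))"
      using x by (simp add: T_def inner_simps) (simp add: algebra_simps power2_eq_square power4_eq_xxxx)
    then have "(cnorm H (T x))\<^sup>2 = m^4 * (cnorm H x)\<^sup>2 - 2 * m\<^sup>2 * (cnorm H (S x))\<^sup>2 + (cnorm H (S (S x)))\<^sup>2"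
      using x by (simp add: cnorm_power2 T_def)
    also have "(cnorm H (S (S x)))\<^sup>2 \<le> (m * cnorm H (S x))\<^sup>2"
      using op_norm_bound[OF b, of "S x"] m x by (intro power_mono) (auto simp: cnorm_nonneg)
    finally show ?thesis by (simp add: algebra_simps power2_eq_square power4_eq_xxxx)
  qed
  assume "invertible_op H (\<lambda>x. complex_of_real (m\<^sup>2) \<odot> x \<ominus> S (S x))"
  then obtain c where c: "0 < c" "\<And>x. x \<in> carrier H \<Longrightarrow> c * cnorm H x \<le> cnorm H (T x)"
    using invertible_op_below unfolding T_def by blast
  have le: "(cnorm H (S x))\<^sup>2 * m\<^sup>2 \<le> (m^4 - c\<^sup>2) * (cnorm H x)\<^sup>2" if "x \<in> carrier H" for x
  proof -
    have "(c * cnorm H x)\<^sup>2 \<le> (cnorm H (T x))\<^sup>2"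
      using c that by (intro power_mono) (auto simp: cnorm_nonneg)
    then show ?thesis
      using T2[OF that] by (simp add: algebra_simps power2_eq_square power4_eq_xxxx)
  qed
  obtain u where u: "u \<in> carrier H" "u \<noteq> \<zero>" using ne by auto
  have u0: "0 < cnorm H u" using u cnorm_eq_0[of u] cnorm_nonneg[of u] by simp
  have "0 \<le> (m^4 - c\<^sup>2) * (cnorm H u)\<^sup>2"
    using le[OF u(1)] by (meson order_trans mult_nonneg_nonneg zero_le_power2)
  then have k: "0 \<le> m^4 - c\<^sup>2" using u0 by (simp add: zero_le_mult_iff)
  then have "m \<noteq> 0" using c(1) by auto
  then have mpos: "0 < m" using m0 by simp
  have "op_norm H S \<le> sqrt (m^4 - c\<^sup>2) / m"
  proof (rule op_norm_le)
    fix x assume x: "x \<in> carrier H"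
    have "(cnorm H (S x))\<^sup>2 \<le> (sqrt (m^4 - c\<^sup>2) / m * cnorm H x)\<^sup>2"
      using le[OF x] mpos k by (simp add: power_mult_distrib power_divide field_simps)
    then show "cnorm H (S x) \<le> sqrt (m^4 - c\<^sup>2) / m * cnorm H x"
      by (rule power2_le_imp_le) (use mpos k x in \<open>simp add: cnorm_nonneg\<close>)
  qed (use mpos k in simp)
  then have "m * m \<le> sqrt (m^4 - c\<^sup>2)"
    using mpos m by (simp add: field_simps)
  also have "\<dots> < sqrt (m^4)" using c(1) by simp
  also have "\<dots> = m * m" using mpos by (intro real_sqrt_unique) (auto simp: power2_eq_square power4_eq_xxxx)
  finally show False by simp
qed

end

section \<open>Continuous functional calculus\<close>

lemma polynomial_approximation:
  fixes f :: "real \<Rightarrow> real"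
  assumes "continuous_on {a..b} f" "0 < e"
  obtains p :: "real poly" where "\<And>t. t \<in> {a..b} \<Longrightarrow> \<bar>poly p t - f t\<bar> \<le> e"
proof -
  obtain g where "real_polynomial_function g" and g: "\<And>t. t \<in> {a..b} \<Longrightarrow> \<bar>f t - g t\<bar> < e"
    using Stone_Weierstrass_real_polynomial_function[OF _ assms] by (metis compact_Icc)
  then obtain c n where c: "g = (\<lambda>x. \<Sum>i\<le>n. c i * x ^ i)"
    by (auto simp: real_polynomial_function_iff_sum)
  have "poly (\<Sum>i\<le>n. Polynomial.monom (c i) i) t = g t" for t
    by (simp add: c poly_sum poly_monom)
  then show ?thesis
    using g by (intro that[of "\<Sum>i\<le>n. Polynomial.monom (c i) i"]) (force simp: abs_minus_commute)
qed

lemma le_if_le_add_mult: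
  fixes a b c :: real
  assumes "\<And>e. 0 < e \<Longrightarrow> a \<le> b + e * c" "0 \<le> c"
  shows "a \<le> b"
proof (rule field_le_epsilon)
  fix d :: real assume d: "0 < d"
  have "a \<le> b + (d / (c + 1)) * c" by (rule assms(1)) (use assms(2) d in simp)
  also have "(d / (c + 1)) * c \<le> d" using assms(2) d by (simp add: field_simps)
  finally show "a \<le> b + d" by simp
qed

context pre_hilbert
begin

text \<open>
  The relation \<open>T = f(A)\<close> in a form without sequences: every tolerance \<open>e\<close> is met by one polynomial,
  both on the spectrum and in operator norm. Sums of errors are then handled without choosing
  sequences; \<open>has_cfc_iff\<close> connects this with the sequences in the definition of \<open>cfc\<close>.
\<close>

definition has_cfc :: "('a \<Rightarrow> 'a) \<Rightarrow> (real \<Rightarrow> real) \<Rightarrow> ('a \<Rightarrow> 'a) \<Rightarrow> bool" where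
  "has_cfc A f T \<longleftrightarrow> bounded_op H T \<and>
     (\<forall>e>0. \<exists>p. (\<forall>t\<in>Re ` op_spectrum H A. \<bar>poly p t - f t\<bar> \<le> e) \<and>
        (\<forall>x\<in>carrier H. cnorm H (poly_op H p A x \<ominus> T x) \<le> e * cnorm H x))"

lemma has_cfc_bounded: "has_cfc A f T \<Longrightarrow> bounded_op H T"
  by (simp add: has_cfc_def)

lemma has_cfc_approx:
  assumes "has_cfc A f T" "0 < e"
  obtains p where "\<And>t. t \<in> Re ` op_spectrum H A \<Longrightarrow> \<bar>poly p t - f t\<bar> \<le> e"
    "\<And>x. x \<in> carrier H \<Longrightarrow> cnorm H (poly_op H p A x \<ominus> T x) \<le> e * cnorm H x"
  using assms unfolding has_cfc_def by metis

lemma has_cfc_poly: "bounded_op H A \<Longrightarrow> has_cfc A (poly p) (poly_op H p A)"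
  unfolding has_cfc_def
  by (auto intro!: exI[of _ p] bounded_poly_op
      simp: diff_eq_zero_iff[THEN iffD2] bounded_op_in bounded_poly_op cnorm_zero cnorm_nonneg)

lemma has_cfc_cong:
  assumes "has_cfc A f S" "\<And>t. t \<in> Re ` op_spectrum H A \<Longrightarrow> f t = g t"
    and "\<And>x. x \<in> carrier H \<Longrightarrow> S x = T x"
  shows "has_cfc A g T"
proof -
  have "bounded_op H T"
    by (rule bounded_op_cong[OF has_cfc_bounded[OF assms(1)]]) (simp add: assms(3))
  then show ?thesis
    using assms unfolding has_cfc_def by auto
qed

lemma has_cfc_iff:
  assumes A: "bounded_op H A"
  shows "has_cfc A f T \<longleftrightarrow> bounded_op H T \<and>
     (\<exists>p :: nat \<Rightarrow> real poly.
        uniform_limit (Re ` op_spectrum H A) (\<lambda>n. poly (p n)) f sequentially \<and>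
        (\<lambda>n. op_norm H (\<lambda>x. poly_op H (p n) A x \<ominus> T x)) \<longlonglongrightarrow> 0)"
    (is "_ \<longleftrightarrow> _ \<and> (\<exists>p. ?lim p)")
proof (intro iffI conjI)
  assume fc: "has_cfc A f T"
  then show "bounded_op H T" by (rule has_cfc_bounded)
  define e where "e = (\<lambda>n. 1 / (real n + 1))"
  have e0: "0 < e n" for n by (simp add: e_def)
  have e: "e \<longlonglongrightarrow> 0"
    unfolding e_def using LIMSEQ_inverse_real_of_nat by (simp add: inverse_eq_divide add.commute)
  have "\<exists>p. \<forall>n. (\<forall>t\<in>Re ` op_spectrum H A. \<bar>poly (p n) t - f t\<bar> \<le> e n) \<and>
        (\<forall>x\<in>carrier H. cnorm H (poly_op H (p n) A x \<ominus> T x) \<le> e n * cnorm H x)"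
    using fc e0 unfolding has_cfc_def by (intro choice) blast
  then obtain p where p: "\<And>n t. t\<in>Re ` op_spectrum H A \<Longrightarrow> \<bar>poly (p n) t - f t\<bar> \<le> e n"
    "\<And>n x. x \<in> carrier H \<Longrightarrow> cnorm H (poly_op H (p n) A x \<ominus> T x) \<le> e n * cnorm H x"
    by blast
  have "uniform_limit (Re ` op_spectrum H A) (\<lambda>n. poly (p n)) f sequentially"
  proof (rule uniform_limitI)
    fix d :: real assume "0 < d"
    then have "\<forall>\<^sub>F n in sequentially. e n < d"
      using e by (rule order_tendstoD(2)[rotated])
    then show "\<forall>\<^sub>F n in sequentially. \<forall>t\<in>Re ` op_spectrum H A. dist (poly (p n) t) (f t) < d"
      by eventually_elim (auto simp: dist_real_def intro: le_less_trans[OF p(1)])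
  qed
  moreover have "(\<lambda>n. op_norm H (\<lambda>x. poly_op H (p n) A x \<ominus> T x)) \<longlonglongrightarrow> 0"
  proof (rule tendsto_sandwich[OF _ _ tendsto_const e])
    show "\<forall>\<^sub>F n in sequentially. 0 \<le> op_norm H (\<lambda>x. poly_op H (p n) A x \<ominus> T x)"
      using A fc by (intro always_eventually allI op_norm_nonneg bounded_op_minus bounded_poly_op)
        (auto simp: has_cfc_bounded)
    show "\<forall>\<^sub>F n in sequentially. op_norm H (\<lambda>x. poly_op H (p n) A x \<ominus> T x) \<le> e n"
      using p(2) less_imp_le[OF e0] by (intro always_eventually allI op_norm_le) auto
  qed
  ultimately show "\<exists>p. ?lim p" by blast
next
  assume "bounded_op H T \<and> (\<exists>p. ?lim p)"
  then obtain p where T: "bounded_op H T" and p: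
    "uniform_limit (Re ` op_spectrum H A) (\<lambda>n. poly (p n)) f sequentially"
    "(\<lambda>n. op_norm H (\<lambda>x. poly_op H (p n) A x \<ominus> T x)) \<longlonglongrightarrow> 0" by blast
  have "\<exists>p. (\<forall>t\<in>Re ` op_spectrum H A. \<bar>poly p t - f t\<bar> \<le> e) \<and>
        (\<forall>x\<in>carrier H. cnorm H (poly_op H p A x \<ominus> T x) \<le> e * cnorm H x)" if e: "0 < e" for e
  proof -
    have "\<forall>\<^sub>F n in sequentially. (\<forall>t\<in>Re ` op_spectrum H A. dist (poly (p n) t) (f t) < e)
        \<and> op_norm H (\<lambda>x. poly_op H (p n) A x \<ominus> T x) < e"
      using uniform_limitD[OF p(1) e] order_tendstoD(2)[OF p(2) e] by (rule eventually_conj)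
    then obtain n where n: "\<forall>t\<in>Re ` op_spectrum H A. dist (poly (p n) t) (f t) < e"
        "op_norm H (\<lambda>x. poly_op H (p n) A x \<ominus> T x) < e"
      by (auto dest: eventually_happens)
    have "cnorm H (poly_op H (p n) A x \<ominus> T x) \<le> e * cnorm H x" if x: "x \<in> carrier H" for x
    proof -
      have "cnorm H (poly_op H (p n) A x \<ominus> T x)
          \<le> op_norm H (\<lambda>x. poly_op H (p n) A x \<ominus> T x) * cnorm H x"
        using op_norm_bound[OF bounded_op_minus[OF bounded_poly_op[OF A] T] x] .
      also have "\<dots> \<le> e * cnorm H x"
        using n(2) x by (intro mult_right_mono) (auto simp: cnorm_nonneg)
      finally show ?thesis .
    qed
    then show ?thesis
      using n(1) by (intro exI[of _ "p n"]) (auto simp: dist_real_def less_imp_le)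
  qed
  then show "has_cfc A f T" using T by (simp add: has_cfc_def)
qed

lemma converges_inner:
  assumes "converges s l" "\<And>n. s n \<in> carrier H" "z \<in> carrier H"
  shows "(\<lambda>n. cinner H (s n) z) \<longlonglongrightarrow> cinner H l z"
proof -
  have l: "l \<in> carrier H" and lim: "(\<lambda>n. cnorm H (s n \<ominus> l)) \<longlonglongrightarrow> 0"
    using assms(1) by (auto simp: converges_def)
  have "(\<lambda>n. cinner H (s n \<ominus> l) z) \<longlonglongrightarrow> 0"
  proof (rule Lim_null_comparison)
    show "\<forall>\<^sub>F n in sequentially. cmod (cinner H (s n \<ominus> l) z) \<le> cnorm H (s n \<ominus> l) * cnorm H z"
      using assms l by (intro always_eventually allI Cauchy_Schwarz) auto
    show "(\<lambda>n. cnorm H (s n \<ominus> l) * cnorm H z) \<longlonglongrightarrow> 0"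
      using tendsto_mult_right[OF lim, of "cnorm H z"] by simp
  qed
  then have "(\<lambda>n. cinner H (s n) z - cinner H l z) \<longlonglongrightarrow> 0"
    using assms l by (simp add: inner_diff_left)
  then show ?thesis by (simp add: LIM_zero_iff)
qed

end

context complex_hilbert_space
begin

lemma quadratic_form_bound:
  assumes "bounded_op H T"
  obtains K where "0 < K" "\<And>x. x \<in> carrier H \<Longrightarrow> \<bar>Re (cinner H (T x) x)\<bar> \<le> K * (cnorm H x)\<^sup>2"
proof -
  obtain K where K: "0 < K" "\<And>x. x \<in> carrier H \<Longrightarrow> cnorm H (T x) \<le> K * cnorm H x"
    using bounded_op_bound[OF assms] by metis
  have "\<bar>Re (cinner H (T x) x)\<bar> \<le> K * (cnorm H x)\<^sup>2" if x: "x \<in> carrier H" for x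
  proof -
    have "\<bar>Re (cinner H (T x) x)\<bar> \<le> cnorm H (T x) * cnorm H x"
      using abs_Re_le_cmod Cauchy_Schwarz[of "T x" x] x assms by (meson order_trans bounded_op_in)
    also have "\<dots> \<le> (K * cnorm H x) * cnorm H x"
      using K x by (intro mult_right_mono) (auto simp: cnorm_nonneg)
    finally show ?thesis by (simp add: power2_eq_square mult.assoc)
  qed
  with K(1) that show ?thesis by blast
qed

lemma selfadjoint_spectrum_bounded:
  assumes "selfadjoint_op H A"
  obtains K where "0 < K" "op_spectrum H A \<subseteq> complex_of_real ` {-K..K}"
proof -
  obtain K where "0 < K" "\<And>x. x \<in> carrier H \<Longrightarrow> \<bar>Re (cinner H (A x) x)\<bar> \<le> K * (cnorm H x)\<^sup>2"
    using quadratic_form_bound[OF selfadjoint_bounded[OF assms]] by metis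
  with assms that show ?thesis
    by (metis (no_types, lifting) selfadjoint_spectrum_bounds abs_le_iff minus_le_iff mult_minus_left)
qed

lemma selfadjoint_spectrum_real:
  assumes "selfadjoint_op H A" "z \<in> op_spectrum H A"
  shows "z = complex_of_real (Re z)"
  using selfadjoint_spectrum_bounded[OF assms(1)] assms(2) by (metis Re_complex_of_real imageE subsetD)

text \<open>
  If the spectrum were empty, every nonzero polynomial would be invertible at \<open>A\<close>, in particular
  \<open>\<parallel>A\<parallel>\<^sup>2 - t\<^sup>2\<close>.
\<close>

lemma selfadjoint_spectrum_nonempty:
  assumes A: "selfadjoint_op H A" and ne: "carrier H \<noteq> {\<zero>}"
  shows "op_spectrum H A \<noteq> {}"
proof
  assume empty: "op_spectrum H A = {}"
  have b: "bounded_op H A" using A by (rule selfadjoint_bounded)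
  define q where "q = [:complex_of_real ((op_norm H A)\<^sup>2), 0, -1:]"
  have "invertible_op H (cpoly_op H q A)"
    using b empty by (intro invertible_cpoly_op) (auto simp: q_def)
  then have "invertible_op H (\<lambda>x. complex_of_real ((op_norm H A)\<^sup>2) \<odot> x \<ominus> A (A x))"
    by (rule invertible_op_cong) (use b in \<open>auto intro!: vec_eqI
        simp: q_def cpoly_op_pCons cpoly_op_0 inner_simps bounded_op_in bounded_op_zero bounded_op_add bounded_op_smult\<close>)
  then show False
    using not_invertible_norm_sq_minus_square[OF A refl ne] by blast
qed

text \<open>
  If \<open>m = \<parallel>p(A)\<parallel>\<close> were larger than \<open>r\<close>, the polynomial \<open>m\<^sup>2 - p\<^sup>2\<close> would be positive on the spectrum and
  hence invertible at \<open>A\<close>, but \<open>\<parallel>p(A)\<parallel>\<^sup>2 - p(A)\<^sup>2\<close> is not invertible.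
\<close>

lemma norm_poly_op_le:
  assumes A: "selfadjoint_op H A" and r: "0 \<le> r"
    and p: "\<And>t. t \<in> Re ` op_spectrum H A \<Longrightarrow> \<bar>poly p t\<bar> \<le> r"
    and x: "x \<in> carrier H"
  shows "cnorm H (poly_op H p A x) \<le> r * cnorm H x"
proof (cases "carrier H = {\<zero>}")
  case True
  have b: "bounded_op H A" using A by (rule selfadjoint_bounded)
  have "poly_op H p A x = \<zero>" "x = \<zero>"
    using bounded_op_in[OF bounded_poly_op[OF b] x] x True by auto
  then show ?thesis by (simp add: cnorm_zero)
next
  case False
  have b: "bounded_op H A" using A by (rule selfadjoint_bounded)
  define m where "m = op_norm H (poly_op H p A)"
  have "m \<le> r"
  proof (rule ccontr)
    assume "\<not> m \<le> r"
    then have "r\<^sup>2 < m\<^sup>2" using r by (intro power_strict_mono) auto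
    define q where "q = [:m\<^sup>2:] - p * p"
    have q: "0 < poly q t" if "t \<in> Re ` op_spectrum H A" for t
    proof -
      have "(poly p t)\<^sup>2 \<le> r\<^sup>2" using p[OF that] by (metis abs_ge_zero power2_abs power_mono)
      then show ?thesis using \<open>r\<^sup>2 < m\<^sup>2\<close> by (simp add: q_def power2_eq_square)
    qed
    have nz: "poly (map_poly complex_of_real q) z \<noteq> 0" if z: "z \<in> op_spectrum H A" for z
      using q[of "Re z"] z poly_of_real_poly[of q "Re z"] selfadjoint_spectrum_real[OF A z] by force
    moreover have "map_poly complex_of_real q \<noteq> 0"
      using selfadjoint_spectrum_nonempty[OF A False] nz by fastforce
    ultimately have "invertible_op H (cpoly_op H (map_poly complex_of_real q) A)"
      using invertible_cpoly_op[OF b] by blast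
    then have "invertible_op H (poly_op H q A)"
      by (rule invertible_op_cong) (simp add: poly_op_eq_cpoly_op)
    then have "invertible_op H (\<lambda>x. complex_of_real (m\<^sup>2) \<odot> x \<ominus> poly_op H p A (poly_op H p A x))"
      by (rule invertible_op_cong) (use b in \<open>simp add: q_def poly_op_diff poly_op_mult poly_op_const\<close>)
    then show False
      using not_invertible_norm_sq_minus_square[OF selfadjoint_poly_op[OF A], of p m] False by (simp add: m_def)
  qed
  then have "m * cnorm H x \<le> r * cnorm H x"
    using x by (intro mult_right_mono) (auto simp: cnorm_nonneg)
  then show ?thesis
    using op_norm_bound[OF bounded_poly_op[OF b, of p] x] by (simp add: m_def)
qed

text \<open>
  The functional calculus is contractive for the supremum norm on the spectrum. Uniqueness of \<open>f(A)\<close> and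
  continuity of \<open>p \<mapsto> A\<^sup>p\<close> are special cases.
\<close>

lemma has_cfc_dist:
  assumes A: "selfadjoint_op H A" and S: "has_cfc A f S" and T: "has_cfc A g T"
    and r: "0 \<le> r" "\<And>t. t \<in> Re ` op_spectrum H A \<Longrightarrow> \<bar>f t - g t\<bar> \<le> r"
    and x: "x \<in> carrier H"
  shows "cnorm H (S x \<ominus> T x) \<le> r * cnorm H x"
proof (rule le_if_le_add_mult)
  fix e :: real assume e: "0 < e"
  have b: "bounded_op H A" using A by (rule selfadjoint_bounded)
  obtain p where p: "\<And>t. t \<in> Re ` op_spectrum H A \<Longrightarrow> \<bar>poly p t - f t\<bar> \<le> e"
    "cnorm H (poly_op H p A x \<ominus> S x) \<le> e * cnorm H x"
    using has_cfc_approx[OF S e] x by metis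
  obtain q where q: "\<And>t. t \<in> Re ` op_spectrum H A \<Longrightarrow> \<bar>poly q t - g t\<bar> \<le> e"
    "cnorm H (poly_op H q A x \<ominus> T x) \<le> e * cnorm H x"
    using has_cfc_approx[OF T e] x by metis
  have "cnorm H (poly_op H (p - q) A x) \<le> (r + 2 * e) * cnorm H x"
  proof (rule norm_poly_op_le[OF A _ _ x])
    fix t assume "t \<in> Re ` op_spectrum H A"
    then show "\<bar>poly (p - q) t\<bar> \<le> r + 2 * e"
      using p(1)[of t] q(1)[of t] r(2)[of t] by simp
  qed (use e r in simp)
  moreover have "poly_op H p A x \<in> carrier H" "poly_op H q A x \<in> carrier H" "S x \<in> carrier H" "T x \<in> carrier H"
    using x b S T by (auto simp: bounded_op_in bounded_poly_op has_cfc_bounded)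
  moreover from this have "cnorm H (S x \<ominus> T x) \<le> cnorm H (poly_op H p A x \<ominus> S x)
      + cnorm H (poly_op H p A x \<ominus> poly_op H q A x) + cnorm H (poly_op H q A x \<ominus> T x)"
    using cnorm_diff_triangle[of "S x" "poly_op H p A x" "T x"]
      cnorm_diff_triangle[of "poly_op H p A x" "poly_op H q A x" "T x"] cnorm_diff_commute by fastforce
  ultimately show "cnorm H (S x \<ominus> T x) \<le> r * cnorm H x + e * (4 * cnorm H x)"
    using p(2) q(2) b x by (simp add: poly_op_diff algebra_simps)
qed (use x in \<open>simp add: cnorm_nonneg\<close>)

lemma has_cfc_unique:
  assumes "selfadjoint_op H A" "has_cfc A f S" "has_cfc A f T" "x \<in> carrier H"
  shows "S x = T x"
  using has_cfc_dist[OF assms(1-3), of 0 x] assms cnorm_nonneg[of "S x \<ominus> T x"]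
  by (intro eqI_diff) (auto simp: has_cfc_bounded bounded_op_in)

text \<open>
  Polynomials that converge to \<open>f\<close> uniformly on \<open>[m, M]\<close> are uniformly Cauchy on the spectrum; their
  values at \<open>A\<close> are then Cauchy at each vector. The pointwise limit is linear because inner products
  with it are limits of inner products.
\<close>

lemma has_cfc_exists:
  assumes A: "selfadjoint_op H A" and spec: "Re ` op_spectrum H A \<subseteq> {m..M}"
    and f: "continuous_on {m..M} f"
  shows "\<exists>T. has_cfc A f T"
proof -
  have b: "bounded_op H A" using A by (rule selfadjoint_bounded)
  define e where "e = (\<lambda>n. 1 / (real n + 1))"
  have e0: "0 < e n" for n by (simp add: e_def)
  have e: "e \<longlonglongrightarrow> 0"
    unfolding e_def using LIMSEQ_inverse_real_of_nat by (simp add: inverse_eq_divide add.commute)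
  have "\<exists>p. \<forall>n. \<forall>t\<in>{m..M}. \<bar>poly (p n) t - f t\<bar> \<le> e n"
    using polynomial_approximation[OF f e0] by (intro choice) metis
  then obtain p where p: "\<And>n t. t \<in> Re ` op_spectrum H A \<Longrightarrow> \<bar>poly (p n) t - f t\<bar> \<le> e n"
    using spec by blast
  define s where "s = (\<lambda>x n. poly_op H (p n) A x)"
  have s_in: "s x n \<in> carrier H" if "x \<in> carrier H" for x n
    using that b by (simp add: s_def bounded_op_in bounded_poly_op)
  have s_diff: "cnorm H (s x i \<ominus> s x j) \<le> (e i + e j) * cnorm H x" if x: "x \<in> carrier H" for x i j
  proof -
    have "cnorm H (poly_op H (p i - p j) A x) \<le> (e i + e j) * cnorm H x"
    proof (rule norm_poly_op_le[OF A _ _ x])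
      fix t assume "t \<in> Re ` op_spectrum H A"
      then show "\<bar>poly (p i - p j) t\<bar> \<le> e i + e j"
        using p[of t i] p[of t j] by simp
    qed (use e0[of i] e0[of j] in simp)
    then show ?thesis using b x by (simp add: poly_op_diff s_def)
  qed
  have "Cauchy_seq (s x)" if x: "x \<in> carrier H" for x
    unfolding Cauchy_seq_def
  proof (intro conjI allI impI)
    fix d :: real assume d: "0 < d"
    have "(\<lambda>n. e n * cnorm H x) \<longlonglongrightarrow> 0"
      using tendsto_mult_right[OF e, of "cnorm H x"] by simp
    then have "\<forall>\<^sub>F n in sequentially. e n * cnorm H x < d / 2"
      using d by (intro order_tendstoD(2)) auto
    then obtain N where N: "\<And>n. N \<le> n \<Longrightarrow> e n * cnorm H x < d / 2"
      by (auto simp: eventually_sequentially)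
    have "cnorm H (s x i \<ominus> s x j) < d" if "N \<le> i" "N \<le> j" for i j
      using s_diff[OF x, of i j] N[OF that(1)] N[OF that(2)] unfolding distrib_right by linarith
    then show "\<exists>N. \<forall>m\<ge>N. \<forall>n\<ge>N. cnorm H (s x m \<ominus> s x n) < d" by blast
  qed (use x s_in in auto)
  then have "\<exists>l. converges (s x) l" if "x \<in> carrier H" for x
    using that Cauchy_converges by blast
  then obtain T where T: "\<And>x. x \<in> carrier H \<Longrightarrow> converges (s x) (T x)" by metis
  have T_in: "T x \<in> carrier H" if "x \<in> carrier H" for x
    using T[OF that] by (simp add: converges_def)
  have lim: "(\<lambda>n. cinner H (s x n) z) \<longlonglongrightarrow> cinner H (T x) z" if "x \<in> carrier H" "z \<in> carrier H" for x z
    using that T s_in by (intro converges_inner) auto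
  have approx: "cnorm H (s x n \<ominus> T x) \<le> e n * cnorm H x" if x: "x \<in> carrier H" for x n
  proof (rule LIMSEQ_le_const)
    have "(\<lambda>k. (e n + e k) * cnorm H x + cnorm H (s x k \<ominus> T x)) \<longlonglongrightarrow> (e n + 0) * cnorm H x + 0"
      using T[OF x] unfolding converges_def by (intro tendsto_intros e) auto
    then show "(\<lambda>k. (e n + e k) * cnorm H x + cnorm H (s x k \<ominus> T x)) \<longlonglongrightarrow> e n * cnorm H x"
      by simp
    have "cnorm H (s x n \<ominus> T x) \<le> (e n + e k) * cnorm H x + cnorm H (s x k \<ominus> T x)" for k
      using cnorm_diff_triangle[of "s x n" "s x k" "T x"] s_diff[OF x, of n k] s_in[OF x] T_in[OF x] by force
    then show "\<exists>N. \<forall>k\<ge>N. cnorm H (s x n \<ominus> T x) \<le> (e n + e k) * cnorm H x + cnorm H (s x k \<ominus> T x)"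
      by blast
  qed
  have pb: "bounded_op H (poly_op H (p n) A)" for n using b by (rule bounded_poly_op)
  have "bounded_op H T"
  proof -
    obtain K where K: "0 < K" "\<And>x. x \<in> carrier H \<Longrightarrow> cnorm H (s x 0) \<le> K * cnorm H x"
      using bounded_op_bound[OF pb[of 0]] unfolding s_def by metis
    show ?thesis
    proof (rule bounded_opI[where K = "K + 1"])
      fix x y c assume x: "x \<in> carrier H"
      show "T x \<in> carrier H" using x by (rule T_in)
      show "T (c \<odot> x) = c \<odot> T x"
      proof (rule vec_eqI)
        fix z assume z: "z \<in> carrier H"
        have "(\<lambda>n. cinner H (s (c \<odot> x) n) z) \<longlonglongrightarrow> c * cinner H (T x) z"
          using tendsto_mult_left[OF lim[OF x z], of c] x z s_in[OF x] pb
          by (simp add: s_def bounded_op_smult inner_smult_left)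
        then have "cinner H (T (c \<odot> x)) z = c * cinner H (T x) z"
          using lim[of "c \<odot> x" z] x z LIMSEQ_unique by simp
        then show "cinner H (T (c \<odot> x)) z = cinner H (c \<odot> T x) z"
          using x z T_in by (simp add: inner_smult_left)
      qed (use x T_in in auto)
      show "cnorm H (T x) \<le> (K + 1) * cnorm H x"
      proof -
        have "T x = s x 0 \<ominus> (s x 0 \<ominus> T x)"
          using s_in[OF x] T_in[OF x] by (intro vec_eqI) (auto simp: inner_simps)
        then have "cnorm H (T x) \<le> cnorm H (s x 0) + cnorm H (s x 0 \<ominus> T x)"
          using cnorm_diff_le[of "s x 0" "s x 0 \<ominus> T x"] s_in[OF x] T_in[OF x] by simp
        then show ?thesis
          using K(2)[OF x] approx[OF x, of 0] by (simp add: e_def algebra_simps)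
      qed
      assume y: "y \<in> carrier H"
      show "T (x \<oplus> y) = T x \<oplus> T y"
      proof (rule vec_eqI)
        fix z assume z: "z \<in> carrier H"
        have "(\<lambda>n. cinner H (s (x \<oplus> y) n) z) \<longlonglongrightarrow> cinner H (T x) z + cinner H (T y) z"
          using tendsto_add[OF lim[OF x z] lim[OF y z]] x y z s_in pb
          by (simp add: s_def bounded_op_add inner_add_left)
        then have "cinner H (T (x \<oplus> y)) z = cinner H (T x) z + cinner H (T y) z"
          using lim[of "x \<oplus> y" z] x y z LIMSEQ_unique by simp
        then show "cinner H (T (x \<oplus> y)) z = cinner H (T x \<oplus> T y) z"
          using x y z T_in by (simp add: inner_add_left)
      qed (use x y T_in in auto)
    qed
  qed
  moreover have "\<exists>p. (\<forall>t\<in>Re ` op_spectrum H A. \<bar>poly p t - f t\<bar> \<le> d) \<and>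
      (\<forall>x\<in>carrier H. cnorm H (poly_op H p A x \<ominus> T x) \<le> d * cnorm H x)" if d: "0 < d" for d
  proof -
    obtain n where n: "e n < d"
      using order_tendstoD(2)[OF e d] by (auto dest: eventually_happens)
    then have "\<bar>poly (p n) t - f t\<bar> \<le> d" if "t \<in> Re ` op_spectrum H A" for t
      using p[OF that, of n] by simp
    moreover have "cnorm H (poly_op H (p n) A x \<ominus> T x) \<le> d * cnorm H x" if "x \<in> carrier H" for x
      using approx[OF that, of n] n mult_right_mono[of "e n" d "cnorm H x"] cnorm_nonneg[OF that]
      by (simp add: s_def)
    ultimately show ?thesis by blast
  qed
  ultimately show ?thesis
    unfolding has_cfc_def by blast
qed

lemma has_cfc_cfc:
  assumes A: "selfadjoint_op H A" and spec: "Re ` op_spectrum H A \<subseteq> {m..M}"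
    and f: "continuous_on {m..M} f"
  shows "has_cfc A f (cfc H f A)"
proof -
  have b: "bounded_op H A" using A by (rule selfadjoint_bounded)
  obtain T0 where "has_cfc A f T0" using has_cfc_exists[OF assms] by blast
  then have T: "has_cfc A f (restrict T0 (carrier H))"
    by (rule has_cfc_cong) auto
  have "cfc H f A = (THE T. T \<in> extensional (carrier H) \<and> has_cfc A f T)"
    unfolding cfc_def has_cfc_iff[OF b] ..
  moreover have "\<exists>!T. T \<in> extensional (carrier H) \<and> has_cfc A f T"
  proof (rule ex1I)
    show "restrict T0 (carrier H) \<in> extensional (carrier H) \<and> has_cfc A f (restrict T0 (carrier H))"
      using T by simp
    fix S assume "S \<in> extensional (carrier H) \<and> has_cfc A f S"
    then show "S = restrict T0 (carrier H)"
      using has_cfc_unique[OF A _ T] by (intro extensionalityI[of _ "carrier H"]) auto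
  qed
  ultimately show ?thesis
    using theI'[of "\<lambda>T. T \<in> extensional (carrier H) \<and> has_cfc A f T"] by simp
qed

lemma has_cfc_selfadjoint:
  assumes A: "selfadjoint_op H A" and T: "has_cfc A f T"
  shows "selfadjoint_op H T"
  unfolding selfadjoint_op_def
proof (intro conjI ballI)
  show bT: "bounded_op H T" using T by (rule has_cfc_bounded)
  have b: "bounded_op H A" using A by (rule selfadjoint_bounded)
  fix x y assume x: "x \<in> carrier H" and y: "y \<in> carrier H"
  have "cmod (cinner H (T x) y - cinner H x (T y)) \<le> 0"
  proof (rule le_if_le_add_mult)
    fix e :: real assume e: "0 < e"
    obtain p where p: "\<And>x. x \<in> carrier H \<Longrightarrow> cnorm H (poly_op H p A x \<ominus> T x) \<le> e * cnorm H x"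
      using has_cfc_approx[OF T e] by metis
    note [simp] = bounded_op_in[OF bT] bounded_op_in[OF bounded_poly_op[OF b]]
    have "cinner H (poly_op H p A x) y = cinner H x (poly_op H p A y)"
      using selfadjoint_swap[OF selfadjoint_poly_op[OF A] x y] .
    then have "cinner H (T x) y - cinner H x (T y)
        = cinner H x (poly_op H p A y \<ominus> T y) - cinner H (poly_op H p A x \<ominus> T x) y"
      using x y by (simp add: inner_simps)
    then have "cmod (cinner H (T x) y - cinner H x (T y))
        \<le> cmod (cinner H x (poly_op H p A y \<ominus> T y)) + cmod (cinner H (poly_op H p A x \<ominus> T x) y)"
      by (simp only: norm_triangle_ineq4)
    also have "\<dots> \<le> cnorm H x * (e * cnorm H y) + (e * cnorm H x) * cnorm H y"
      using x y p by (intro add_mono order_trans[OF Cauchy_Schwarz] mult_left_mono mult_right_mono)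
        (auto simp: cnorm_nonneg)
    finally show "cmod (cinner H (T x) y - cinner H x (T y)) \<le> 0 + e * (2 * cnorm H x * cnorm H y)"
      by (simp add: algebra_simps)
  qed (use x y in \<open>simp add: cnorm_nonneg\<close>)
  then show "cinner H (T x) y = cinner H x (T y)" by simp
qed

lemma has_cfc_range_bounded:
  assumes A: "selfadjoint_op H A" and T: "has_cfc A f T"
  obtains B where "0 < B" "\<And>t. t \<in> Re ` op_spectrum H A \<Longrightarrow> \<bar>f t\<bar> \<le> B"
proof -
  obtain K where K: "op_spectrum H A \<subseteq> complex_of_real ` {-K..K}"
    using selfadjoint_spectrum_bounded[OF A] by metis
  obtain p where p: "\<And>t. t \<in> Re ` op_spectrum H A \<Longrightarrow> \<bar>poly p t - f t\<bar> \<le> 1"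
    using has_cfc_approx[OF T, of 1] by (metis zero_less_one)
  have "bounded (poly p ` {-K..K})"
    by (intro compact_imp_bounded compact_continuous_image continuous_intros) auto
  then obtain B where B: "0 < B" "\<And>t. t \<in> {-K..K} \<Longrightarrow> \<bar>poly p t\<bar> \<le> B"
    by (auto simp: bounded_pos)
  have "\<bar>f t\<bar> \<le> B + 1" if "t \<in> Re ` op_spectrum H A" for t
    using p[OF that] B(2)[of t] that K by fastforce
  then show ?thesis using that[of "B + 1"] B(1) by simp
qed

text \<open>
  If \<open>p(A)\<close> and \<open>q(A)\<close> approximate \<open>S\<close> and \<open>T\<close> up to \<open>e \<le> 1\<close>, the error of \<open>p(A)q(A)\<close> against \<open>ST\<close> is at
  most \<open>e(\<parallel>S\<parallel> + 1 + \<parallel>T\<parallel>)\<close>, and the error of \<open>pq\<close> against \<open>fg\<close> on the spectrum is at most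
  \<open>e(sup \<bar>f\<bar> + 1 + sup \<bar>g\<bar>)\<close>.
\<close>

lemma has_cfc_mult:
  assumes A: "selfadjoint_op H A" and S: "has_cfc A f S" and T: "has_cfc A g T"
  shows "has_cfc A (\<lambda>t. f t * g t) (\<lambda>x. S (T x))"
proof -
  have b: "bounded_op H A" using A by (rule selfadjoint_bounded)
  note bS = has_cfc_bounded[OF S] and bT = has_cfc_bounded[OF T]
  obtain KS where KS: "0 < KS" "\<And>x. x \<in> carrier H \<Longrightarrow> cnorm H (S x) \<le> KS * cnorm H x"
    using bounded_op_bound[OF bS] by metis
  obtain KT where KT: "0 < KT" "\<And>x. x \<in> carrier H \<Longrightarrow> cnorm H (T x) \<le> KT * cnorm H x"
    using bounded_op_bound[OF bT] by metis
  obtain F where F: "0 < F" "\<And>t. t \<in> Re ` op_spectrum H A \<Longrightarrow> \<bar>f t\<bar> \<le> F"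
    using has_cfc_range_bounded[OF A S] by metis
  obtain G where G: "0 < G" "\<And>t. t \<in> Re ` op_spectrum H A \<Longrightarrow> \<bar>g t\<bar> \<le> G"
    using has_cfc_range_bounded[OF A T] by metis
  have "\<exists>p. (\<forall>t\<in>Re ` op_spectrum H A. \<bar>poly p t - f t * g t\<bar> \<le> d) \<and>
      (\<forall>x\<in>carrier H. cnorm H (poly_op H p A x \<ominus> S (T x)) \<le> d * cnorm H x)" if d: "0 < d" for d
  proof -
    define e where "e = min 1 (d / (KS + KT + F + G + 1))"
    have e: "0 < e" "e \<le> 1" using d KS KT F G by (auto simp: e_def)
    have "e \<le> d / (KS + KT + F + G + 1)" by (simp add: e_def)
    then have "e * (KS + KT + F + G + 1) \<le> d"
      using KS(1) KT(1) F(1) G(1) by (simp add: pos_le_divide_eq)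
    moreover have "e * (KS + 1 + KT) \<le> e * (KS + KT + F + G + 1)"
      "e * (F + 1 + G) \<le> e * (KS + KT + F + G + 1)"
      using e KS(1) KT(1) F(1) G(1) by (auto intro!: mult_left_mono)
    ultimately have d1: "e * (KS + 1 + KT) \<le> d" and d2: "e * (F + 1 + G) \<le> d" by linarith+
    obtain p where p: "\<And>t. t \<in> Re ` op_spectrum H A \<Longrightarrow> \<bar>poly p t - f t\<bar> \<le> e"
      "\<And>x. x \<in> carrier H \<Longrightarrow> cnorm H (poly_op H p A x \<ominus> S x) \<le> e * cnorm H x"
      using has_cfc_approx[OF S e(1)] by metis
    obtain q where q: "\<And>t. t \<in> Re ` op_spectrum H A \<Longrightarrow> \<bar>poly q t - g t\<bar> \<le> e"
      "\<And>x. x \<in> carrier H \<Longrightarrow> cnorm H (poly_op H q A x \<ominus> T x) \<le> e * cnorm H x"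
      using has_cfc_approx[OF T e(1)] by metis
    have "\<bar>poly (p * q) t - f t * g t\<bar> \<le> d" if t: "t \<in> Re ` op_spectrum H A" for t
    proof -
      have "poly (p * q) t - f t * g t = poly p t * (poly q t - g t) + (poly p t - f t) * g t"
        by (simp add: algebra_simps)
      then have "\<bar>poly (p * q) t - f t * g t\<bar> \<le> \<bar>poly p t\<bar> * \<bar>poly q t - g t\<bar> + \<bar>poly p t - f t\<bar> * \<bar>g t\<bar>"
        by (metis abs_mult abs_triangle_ineq)
      also have "\<dots> \<le> (F + 1) * e + e * G"
        using p(1)[OF t] q(1)[OF t] F(2)[OF t] G(2)[OF t] F(1) e by (intro add_mono mult_mono) auto
      also have "\<dots> \<le> d" using d2 by (simp add: algebra_simps)
      finally show ?thesis .
    qed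
    moreover have "cnorm H (poly_op H (p * q) A x \<ominus> S (T x)) \<le> d * cnorm H x" if x: "x \<in> carrier H" for x
    proof -
      define P where "P = poly_op H p A"
      define Q where "Q = poly_op H q A"
      have bP: "bounded_op H P" and bQ: "bounded_op H Q" using b by (auto simp: P_def Q_def bounded_poly_op)
      note [simp] = bounded_op_in[OF bP] bounded_op_in[OF bQ] bounded_op_in[OF bS] bounded_op_in[OF bT]
      define w where "w = Q x \<ominus> T x"
      have w: "w \<in> carrier H" using x by (simp add: w_def)
      have w_le: "cnorm H w \<le> e * cnorm H x" using q(2)[OF x] by (simp add: w_def Q_def)
      have Sw: "cnorm H (S w) \<le> KS * (e * cnorm H x)"
        using KS(2)[OF w] w_le KS(1) by (meson mult_left_mono less_imp_le order_trans)
      have Pw: "cnorm H (P w \<ominus> S w) \<le> e * cnorm H x"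
      proof -
        have "cnorm H (P w \<ominus> S w) \<le> e * cnorm H w" using p(2)[OF w] by (simp add: P_def)
        also have "\<dots> \<le> 1 * cnorm H w" using e w by (intro mult_right_mono) (auto simp: cnorm_nonneg)
        finally show ?thesis using w_le by simp
      qed
      have PT: "cnorm H (P (T x) \<ominus> S (T x)) \<le> e * (KT * cnorm H x)"
      proof -
        have "cnorm H (P (T x) \<ominus> S (T x)) \<le> e * cnorm H (T x)" using p(2)[of "T x"] x by (simp add: P_def)
        also have "\<dots> \<le> e * (KT * cnorm H x)" using KT(2)[OF x] e by (intro mult_left_mono) auto
        finally show ?thesis .
      qed
      have "P (Q x) \<ominus> S (T x) = ((P w \<ominus> S w) \<oplus> S w) \<oplus> (P (T x) \<ominus> S (T x))"
        using x w bP by (intro vec_eqI) (auto simp: w_def bounded_op_diff inner_simps)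
      then have "cnorm H (P (Q x) \<ominus> S (T x))
          \<le> cnorm H (P w \<ominus> S w) + cnorm H (S w) + cnorm H (P (T x) \<ominus> S (T x))"
        using cnorm_triangle[of "(P w \<ominus> S w) \<oplus> S w" "P (T x) \<ominus> S (T x)"]
          cnorm_triangle[of "P w \<ominus> S w" "S w"] x w by simp
      also have "\<dots> \<le> e * (KS + 1 + KT) * cnorm H x"
        using Sw Pw PT by (simp add: algebra_simps)
      also have "\<dots> \<le> d * cnorm H x"
        using d1 x by (intro mult_right_mono) (auto simp: cnorm_nonneg)
      finally show ?thesis using b x by (simp add: poly_op_mult P_def Q_def)
    qed
    ultimately show ?thesis by blast
  qed
  then show ?thesis
    unfolding has_cfc_def using bounded_op_comp[OF bS bT] by blast
qed

text \<open>
  If \<open>\<sigma>(A) \<subseteq> [0, K]\<close>, then \<open>\<bar>K - t\<bar> \<le> K\<close> on the spectrum, so \<open>\<parallel>K - A\<parallel> \<le> K\<close>, and thus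
  \<open>\<langle>(K - A)x, x\<rangle> \<le> K\<parallel>x\<parallel>\<^sup>2\<close>.
\<close>

lemma nonneg_if_spectrum_nonneg:
  assumes A: "selfadjoint_op H A" and spec: "\<And>t. t \<in> Re ` op_spectrum H A \<Longrightarrow> 0 \<le> t"
    and x: "x \<in> carrier H"
  shows "0 \<le> Re (cinner H (A x) x)"
proof -
  have b: "bounded_op H A" using A by (rule selfadjoint_bounded)
  obtain K where K: "0 < K" "op_spectrum H A \<subseteq> complex_of_real ` {-K..K}"
    using selfadjoint_spectrum_bounded[OF A] by metis
  have "cnorm H (poly_op H ([:K:] - [:0, 1:]) A x) \<le> K * cnorm H x"
  proof (rule norm_poly_op_le[OF A _ _ x])
    fix t assume t: "t \<in> Re ` op_spectrum H A"
    then have "t \<le> K" using K by auto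
    then show "\<bar>poly ([:K:] - [:0, 1:]) t\<bar> \<le> K" using spec[OF t] by simp
  qed (use K in simp)
  then have le: "cnorm H (complex_of_real K \<odot> x \<ominus> A x) \<le> K * cnorm H x"
    using b x by (simp only: poly_op_diff poly_op_const poly_op_X)
  have "Re (cinner H (complex_of_real K \<odot> x \<ominus> A x) x) \<le> cnorm H (complex_of_real K \<odot> x \<ominus> A x) * cnorm H x"
    by (rule order_trans[OF complex_Re_le_cmod Cauchy_Schwarz]) (use b x in \<open>auto simp: bounded_op_in\<close>)
  also have "\<dots> \<le> (K * cnorm H x) * cnorm H x"
    using le x by (intro mult_right_mono) (auto simp: cnorm_nonneg)
  finally have "K * (cnorm H x)\<^sup>2 - Re (cinner H (A x) x) \<le> K * (cnorm H x)\<^sup>2"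
    using b x by (simp add: inner_simps bounded_op_in inner_self power2_eq_square)
  then show ?thesis by simp
qed

end

text \<open>
  If \<open>JA = DJ\<close>, then \<open>J p(A) = p(D) J\<close> for polynomials and therefore \<open>J f(A) = f(D) J\<close>. With the inclusion
  of a direct summand as \<open>J\<close> this computes \<open>f\<close> of a direct sum on that summand; with a unitary map onto
  another space it transports \<open>f(A)\<close> to that space.
\<close>

lemma cfc_intertwine:
  assumes H: "complex_hilbert_space H" and K: "complex_hilbert_space K"
    and A: "selfadjoint_op H A" and D: "selfadjoint_op K D"
    and specA: "Re ` op_spectrum H A \<subseteq> {m..M}" and specD: "Re ` op_spectrum K D \<subseteq> {m..M}"
    and f: "continuous_on {m..M} f"
    and J_in: "\<And>x. x \<in> carrier H \<Longrightarrow> J x \<in> carrier K"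
    and J_add: "\<And>x y. x \<in> carrier H \<Longrightarrow> y \<in> carrier H \<Longrightarrow> J (x \<oplus>\<^bsub>H\<^esub> y) = J x \<oplus>\<^bsub>K\<^esub> J y"
    and J_smult: "\<And>c x. x \<in> carrier H \<Longrightarrow> J (c \<odot>\<^bsub>H\<^esub> x) = c \<odot>\<^bsub>K\<^esub> J x"
    and J_norm: "\<And>x. x \<in> carrier H \<Longrightarrow> cnorm K (J x) = cnorm H x"
    and J_A: "\<And>x. x \<in> carrier H \<Longrightarrow> J (A x) = D (J x)"
    and x: "x \<in> carrier H"
  shows "J (cfc H f A x) = cfc K f D (J x)"
proof -
  interpret H: complex_hilbert_space H by (rule H)
  interpret K: complex_hilbert_space K by (rule K)
  have bA: "bounded_op H A" using A by (rule H.selfadjoint_bounded)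
  have bD: "bounded_op K D" using D by (rule K.selfadjoint_bounded)
  have J_diff: "J (u \<ominus>\<^bsub>H\<^esub> v) = J u \<ominus>\<^bsub>K\<^esub> J v" if "u \<in> carrier H" "v \<in> carrier H" for u v
    using that by (simp add: H.diff_eq_smult K.diff_eq_smult J_add J_smult J_in)
  have J_zero: "J \<zero>\<^bsub>H\<^esub> = \<zero>\<^bsub>K\<^esub>"
    using J_norm[OF H.zero_in] K.cnorm_eq_0[OF J_in[OF H.zero_in]] by (simp add: H.cnorm_zero)
  have J_poly: "J (cpoly_op H q A u) = cpoly_op K q D (J u)" if u: "u \<in> carrier H" for q u
  proof (induction q)
    case (pCons a q)
    then show ?case
      using u bA bD by (simp add: H.cpoly_op_pCons K.cpoly_op_pCons J_add J_smult J_A J_in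
          H.bounded_op_in H.cpoly_op_in)
  qed (use u bA bD in \<open>simp add: H.cpoly_op_0 K.cpoly_op_0 J_in J_zero\<close>)
  have fA: "H.has_cfc A f (cfc H f A)" by (rule H.has_cfc_cfc[OF A specA f])
  have fD: "K.has_cfc D f (cfc K f D)" by (rule K.has_cfc_cfc[OF D specD f])
  define u where "u = cfc H f A x"
  define v where "v = cfc K f D (J x)"
  have u: "u \<in> carrier H" using H.bounded_op_in[OF H.has_cfc_bounded[OF fA] x] by (simp add: u_def)
  have v: "v \<in> carrier K" using K.bounded_op_in[OF K.has_cfc_bounded[OF fD] J_in[OF x]] by (simp add: v_def)
  have "cnorm K (J u \<ominus>\<^bsub>K\<^esub> v) \<le> 0"
  proof (rule le_if_le_add_mult)
    fix e :: real assume e: "0 < e"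
    obtain p where p: "\<And>t. t \<in> {m..M} \<Longrightarrow> \<bar>poly p t - f t\<bar> \<le> e"
      using polynomial_approximation[OF f e] by metis
    define w where "w = poly_op H p A x"
    have w: "w \<in> carrier H" using bA x by (simp add: w_def H.bounded_op_in H.bounded_poly_op)
    have Jw: "J w = poly_op K p D (J x)"
      using x by (simp add: w_def poly_op_eq_cpoly_op J_poly)
    have "cnorm H (w \<ominus>\<^bsub>H\<^esub> u) \<le> e * cnorm H x"
      unfolding w_def u_def
      by (rule H.has_cfc_dist[OF A H.has_cfc_poly[OF bA] fA _ _ x]) (use e p specA in auto)
    then have "cnorm K (J w \<ominus>\<^bsub>K\<^esub> J u) \<le> e * cnorm H x"
      using J_norm[of "w \<ominus>\<^bsub>H\<^esub> u"] u w by (simp add: J_diff)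
    moreover have "cnorm K (J w \<ominus>\<^bsub>K\<^esub> v) \<le> e * cnorm K (J x)"
      unfolding Jw v_def
      by (rule K.has_cfc_dist[OF D K.has_cfc_poly[OF bD] fD _ _ J_in[OF x]]) (use e p specD in auto)
    ultimately show "cnorm K (J u \<ominus>\<^bsub>K\<^esub> v) \<le> 0 + e * (2 * cnorm H x)"
      using K.cnorm_diff_triangle[of "J u" "J w" v] K.cnorm_diff_commute[of "J u" "J w"]
        J_in[OF u] J_in[OF w] v J_norm[OF x] by simp
  qed (use x in \<open>simp add: H.cnorm_nonneg\<close>)
  then have "cnorm K (J u \<ominus>\<^bsub>K\<^esub> v) = 0"
    using K.cnorm_nonneg[of "J u \<ominus>\<^bsub>K\<^esub> v"] J_in[OF u] v by simp
  then show ?thesis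
    using K.eqI_diff J_in[OF u] v by (simp add: u_def v_def)
qed

section \<open>Powers and anticommutators\<close>

text \<open>
  A point \<open>x\<close> outside \<open>S\<close> lies in a gap \<open>(a, b)\<close> of \<open>S\<close> with \<open>a, b \<in> S\<close>, but the midpoint of the gap belongs
  to \<open>S\<close>.
\<close>

lemma midpoint_closed_eq_interval:
  fixes S :: "real set"
  assumes "closed S" "0 \<in> S" "1 \<in> S"
    and mid: "\<And>p q. p \<in> S \<Longrightarrow> q \<in> S \<Longrightarrow> p \<le> q \<Longrightarrow> (p + q) / 2 \<in> S"
    and x: "0 \<le> x" "x \<le> 1"
  shows "x \<in> S"
proof (rule ccontr)
  assume "x \<notin> S"
  define a where "a = Sup (S \<inter> {0..x})"
  define b where "b = Inf (S \<inter> {x..1})"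
  have "a \<in> S \<inter> {0..x}"
    unfolding a_def using assms by (intro closed_contains_Sup closed_Int) (auto intro: bdd_aboveI[of _ x])
  moreover have "b \<in> S \<inter> {x..1}"
    unfolding b_def using assms by (intro closed_contains_Inf closed_Int) (auto intro: bdd_belowI[of _ x])
  ultimately have ab: "a \<in> S" "b \<in> S" "0 \<le> a" "a < x" "x < b" "b \<le> 1"
    using \<open>x \<notin> S\<close> by (auto simp: less_le)
  have c: "(a + b) / 2 \<in> S" using mid[OF ab(1,2)] ab by simp
  show False
  proof (cases "(a + b) / 2 \<le> x")
    case True
    then have "(a + b) / 2 \<le> a"
      unfolding a_def using c ab by (intro cSup_upper) (auto simp: a_def intro: bdd_aboveI[of _ x])
    then show False using ab by simp
  next
    case False
    then have "b \<le> (a + b) / 2"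
      unfolding b_def using c ab by (intro cInf_lower) (auto simp: b_def intro: bdd_belowI[of _ x])
    then show False using ab by simp
  qed
qed

context pre_hilbert
begin

lemma Re_inner_commute: "x \<in> carrier H \<Longrightarrow> y \<in> carrier H \<Longrightarrow> Re (cinner H x y) = Re (cinner H y x)"
  using inner_commute[of x y] by simp

lemma anticommutator_selfadjoint:
  assumes S: "selfadjoint_op H S" and T: "selfadjoint_op H T"
  shows "selfadjoint_op H (\<lambda>x. S (T x) \<oplus> T (S x))"
proof -
  note b = selfadjoint_bounded[OF S] selfadjoint_bounded[OF T]
  have "bounded_op H (\<lambda>x. S (T x) \<oplus> T (S x))"
    by (rule bounded_op_plus[OF bounded_op_comp[OF b] bounded_op_comp[OF b(2,1)]])
  then show ?thesis
    using b selfadjoint_swap[OF S] selfadjoint_swap[OF T]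
    by (simp add: selfadjoint_op_def inner_simps bounded_op_in)
qed

lemma Re_anticommutator:
  assumes S: "selfadjoint_op H S" and T: "selfadjoint_op H T" and x: "x \<in> carrier H"
  shows "Re (cinner H (S (T x) \<oplus> T (S x)) x) = 2 * Re (cinner H (S x) (T x))"
proof -
  note b = selfadjoint_bounded[OF S] selfadjoint_bounded[OF T]
  have "cinner H (S (T x)) x = cinner H (T x) (S x)" "cinner H (T (S x)) x = cinner H (S x) (T x)"
    using selfadjoint_swap[OF S, of "T x" x] selfadjoint_swap[OF T, of "S x" x] b x
    by (simp_all add: bounded_op_in)
  then show ?thesis
    using Re_inner_commute[of "T x" "S x"] b x by (simp add: inner_simps bounded_op_in)
qed

lemma anticommutator_positive_iff:
  assumes "selfadjoint_op H S" "selfadjoint_op H T"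
  shows "positive_op H (\<lambda>x. S (T x) \<oplus> T (S x)) \<longleftrightarrow> (\<forall>x\<in>carrier H. 0 \<le> Re (cinner H (S x) (T x)))"
  using anticommutator_selfadjoint[OF assms] Re_anticommutator[OF assms] by (simp add: positive_op_iff)

end

context complex_hilbert_space
begin

text \<open>
  Evaluating the positive form of \<open>A\<close> at \<open>x - sAx\<close> with \<open>s = 1/M\<close> and \<open>\<langle>Ay, y\<rangle> \<le> M\<parallel>y\<parallel>\<^sup>2\<close> gives
  \<open>\<parallel>Ax\<parallel>\<^sup>2 \<le> M \<langle>Ax, x\<rangle>\<close>. As an invertible \<open>A\<close> is bounded below in norm, its form is then bounded below as
  well.
\<close>

lemma positive_invertible_bounds:
  assumes pos: "positive_op H A" and inv: "invertible_op H A"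
  obtains m M where "0 < m" "\<And>x. x \<in> carrier H \<Longrightarrow> m * (cnorm H x)\<^sup>2 \<le> Re (cinner H (A x) x)"
    "\<And>x. x \<in> carrier H \<Longrightarrow> Re (cinner H (A x) x) \<le> M * (cnorm H x)\<^sup>2"
    "Re ` op_spectrum H A \<subseteq> {m..M}"
proof -
  have A: "selfadjoint_op H A" using pos by (rule positive_selfadjoint)
  have b: "bounded_op H A" using A by (rule selfadjoint_bounded)
  obtain M where M: "0 < M" "\<And>x. x \<in> carrier H \<Longrightarrow> \<bar>Re (cinner H (A x) x)\<bar> \<le> M * (cnorm H x)\<^sup>2"
    using quadratic_form_bound[OF b] by metis
  obtain c where c: "0 < c" "\<And>x. x \<in> carrier H \<Longrightarrow> c * cnorm H x \<le> cnorm H (A x)"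
    using invertible_op_below[OF inv] by metis
  have lower: "c\<^sup>2 / M * (cnorm H x)\<^sup>2 \<le> Re (cinner H (A x) x)" if x: "x \<in> carrier H" for x
  proof -
    define s where "s = 1 / M"
    define y where "y = A x"
    have y: "y \<in> carrier H" using b x by (simp add: y_def bounded_op_in)
    have Ay: "A y \<in> carrier H" using b y by (simp add: bounded_op_in)
    have "0 \<le> Re (cinner H (A (x \<ominus> complex_of_real s \<odot> y)) (x \<ominus> complex_of_real s \<odot> y))"
      by (rule positive_op_Re[OF pos]) (use x y in simp)
    also have "cinner H (A (x \<ominus> complex_of_real s \<odot> y)) (x \<ominus> complex_of_real s \<odot> y)
        = cinner H (A x) x - 2 * complex_of_real s * cinner H y y + complex_of_real (s\<^sup>2) * cinner H (A y) y"
      using selfadjoint_swap[OF A y x] b x y Ay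
      by (simp add: bounded_op_diff bounded_op_smult y_def[symmetric] inner_simps)
        (simp add: algebra_simps power2_eq_square)
    also have "Re \<dots> = Re (cinner H (A x) x) - 2 * s * (cnorm H y)\<^sup>2 + s\<^sup>2 * Re (cinner H (A y) y)"
      using y by (simp add: inner_self)
    also have "\<dots> \<le> Re (cinner H (A x) x) - 2 * s * (cnorm H y)\<^sup>2 + s\<^sup>2 * (M * (cnorm H y)\<^sup>2)"
      using M(2)[OF y] by (intro add_left_mono mult_left_mono) auto
    also have "s\<^sup>2 * (M * (cnorm H y)\<^sup>2) = s * (cnorm H y)\<^sup>2"
      using M(1) by (simp add: s_def power2_eq_square)
    finally have "s * (cnorm H y)\<^sup>2 \<le> Re (cinner H (A x) x)" by simp
    moreover have "(c * cnorm H x)\<^sup>2 \<le> (cnorm H y)\<^sup>2"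
      unfolding y_def using c x by (intro power_mono) (auto simp: cnorm_nonneg)
    then have "s * (c * cnorm H x)\<^sup>2 \<le> s * (cnorm H y)\<^sup>2"
      using M(1) by (intro mult_left_mono) (auto simp: s_def)
    ultimately show ?thesis by (simp add: s_def power_mult_distrib)
  qed
  have upper: "Re (cinner H (A x) x) \<le> M * (cnorm H x)\<^sup>2" if "x \<in> carrier H" for x
    using M(2)[OF that] by simp
  have "0 < c\<^sup>2 / M" using c(1) M(1) by simp
  moreover have "Re ` op_spectrum H A \<subseteq> {c\<^sup>2 / M..M}"
    using selfadjoint_spectrum_bounds[OF A lower upper] by force
  ultimately show ?thesis using lower upper by (intro that[of "c\<^sup>2 / M" M]) auto
qed

lemma positive_invertibleI:
  assumes A: "selfadjoint_op H A" and c: "0 < c"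
    and "\<And>x. x \<in> carrier H \<Longrightarrow> c * (cnorm H x)\<^sup>2 \<le> Re (cinner H (A x) x)"
  shows "positive_op H A" "invertible_op H A"
proof -
  show "invertible_op H A"
    using selfadjoint_bounded[OF A] c assms(3) by (rule coercive_invertible)
  have "0 \<le> c * (cnorm H x)\<^sup>2" for x using c by simp
  then show "positive_op H A"
    using A assms(3) by (meson positive_op_iff order_trans)
qed

lemma has_cfc_powr:
  assumes "positive_op H A" "invertible_op H A"
  shows "has_cfc A (\<lambda>t. t powr p) (powr_op H A p)"
proof -
  obtain m M where m: "0 < m" and spec: "Re ` op_spectrum H A \<subseteq> {m..M}"
    using positive_invertible_bounds[OF assms] by metis
  have "continuous_on {m..M} (\<lambda>t. t powr p)"
    using m by (intro continuous_intros) auto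
  then show ?thesis
    unfolding powr_op_def by (intro has_cfc_cfc[OF positive_selfadjoint[OF assms(1)] spec])
qed

lemma spectrum_positive:
  assumes "positive_op H A" "invertible_op H A" "t \<in> Re ` op_spectrum H A"
  shows "0 < t"
proof -
  obtain m M where "0 < m" "Re ` op_spectrum H A \<subseteq> {m..M}"
    using positive_invertible_bounds[OF assms(1,2)] by metis
  then show ?thesis using assms(3) by force
qed

lemma powr_op_bounded:
  assumes "positive_op H A" "invertible_op H A"
  shows "bounded_op H (powr_op H A p)"
  using has_cfc_bounded[OF has_cfc_powr[OF assms]] .

lemma powr_op_selfadjoint:
  assumes "positive_op H A" "invertible_op H A"
  shows "selfadjoint_op H (powr_op H A p)"
  using has_cfc_selfadjoint[OF positive_selfadjoint[OF assms(1)] has_cfc_powr[OF assms]] .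

lemma powr_op_add:
  assumes A: "positive_op H A" "invertible_op H A" and x: "x \<in> carrier H"
  shows "powr_op H A (p + q) x = powr_op H A p (powr_op H A q x)"
proof (rule has_cfc_unique[OF positive_selfadjoint[OF A(1)] has_cfc_powr[OF A] _ x])
  show "has_cfc A (\<lambda>t. t powr (p + q)) (\<lambda>x. powr_op H A p (powr_op H A q x))"
    by (rule has_cfc_cong[OF has_cfc_mult[OF positive_selfadjoint[OF A(1)] has_cfc_powr[OF A] has_cfc_powr[OF A]]])
      (simp_all add: powr_add)
qed

lemma powr_op_0:
  assumes A: "positive_op H A" "invertible_op H A" and x: "x \<in> carrier H"
  shows "powr_op H A 0 x = x"
proof (rule has_cfc_unique[OF positive_selfadjoint[OF A(1)] has_cfc_powr[OF A] _ x])
  have b: "bounded_op H A" by (rule selfadjoint_bounded[OF positive_selfadjoint[OF A(1)]])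
  have one: "1 \<odot> y = y" if "y \<in> carrier H" for y
    using smult_one[OF that] by simp
  show "has_cfc A (\<lambda>t. t powr 0) (\<lambda>x. x)"
    by (rule has_cfc_cong[OF has_cfc_poly[OF b, of "[:1:]"]])
      (use spectrum_positive[OF A] b in \<open>force simp: poly_op_const one\<close>)+
qed

lemma powr_op_1:
  assumes A: "positive_op H A" "invertible_op H A" and x: "x \<in> carrier H"
  shows "powr_op H A 1 x = A x"
proof (rule has_cfc_unique[OF positive_selfadjoint[OF A(1)] has_cfc_powr[OF A] _ x])
  have b: "bounded_op H A" by (rule selfadjoint_bounded[OF positive_selfadjoint[OF A(1)]])
  show "has_cfc A (\<lambda>t. t powr 1) A"
    by (rule has_cfc_cong[OF has_cfc_poly[OF b, of "[:0, 1:]"]])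
      (use spectrum_positive[OF A] b in \<open>force simp: poly_op_X\<close>)+
qed

lemma powr_op_inverse:
  assumes A: "positive_op H A" "invertible_op H A" and x: "x \<in> carrier H"
  shows "powr_op H A p (powr_op H A (- p) x) = x"
  using powr_op_add[OF A x, of p "- p"] powr_op_0[OF A x] by simp

lemma powr_op_positive_invertible:
  assumes A: "positive_op H A" "invertible_op H A"
  shows "positive_op H (powr_op H A p)" "invertible_op H (powr_op H A p)"
proof -
  note b = powr_op_bounded[OF A]
  show "invertible_op H (powr_op H A p)"
    unfolding invertible_op_def using b powr_op_inverse[OF A, of _ p] powr_op_inverse[OF A, of _ "- p"]
    by (intro conjI exI[of _ "powr_op H A (- p)"]) auto
  have "0 \<le> Re (cinner H (powr_op H A p x) x)" if x: "x \<in> carrier H" for x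
  proof -
    have "powr_op H A p x = powr_op H A (p / 2) (powr_op H A (p / 2) x)"
      using powr_op_add[OF A x, of "p / 2" "p / 2"] by simp
    then have "cinner H (powr_op H A p x) x = cinner H (powr_op H A (p / 2) x) (powr_op H A (p / 2) x)"
      using selfadjoint_swap[OF powr_op_selfadjoint[OF A]] x b by (simp add: bounded_op_in)
    then show ?thesis using Re_inner_self_nonneg x b by (simp add: bounded_op_in)
  qed
  then show "positive_op H (powr_op H A p)"
    using positive_op_iff[OF powr_op_selfadjoint[OF A]] by blast
qed

text \<open>
  For \<open>t < 0\<close> the operator \<open>T(D - t)\<close> is coercive, because
  \<open>Re \<langle>T(D - t)x, x\<rangle> = Re \<langle>Dx, Tx\<rangle> - t \<langle>Tx, x\<rangle> \<ge> -t \<langle>Tx, x\<rangle>\<close>. So it is invertible, and \<open>D - t\<close> is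
  invertible as well. Hence the spectrum of \<open>D\<close> is nonnegative.
\<close>

lemma Lyapunov_positive:
  assumes T: "positive_op H T" "invertible_op H T" and D: "selfadjoint_op H D"
    and TD: "\<And>x. x \<in> carrier H \<Longrightarrow> 0 \<le> Re (cinner H (T x) (D x))"
    and x: "x \<in> carrier H"
  shows "0 \<le> Re (cinner H (D x) x)"
proof (rule nonneg_if_spectrum_nonneg[OF D _ x])
  fix t assume "t \<in> Re ` op_spectrum H D"
  then have t: "complex_of_real t \<in> op_spectrum H D"
    using selfadjoint_spectrum_real[OF D] by force
  show "0 \<le> t"
  proof (rule ccontr)
    assume neg: "\<not> 0 \<le> t"
    have sT: "selfadjoint_op H T" by (rule positive_selfadjoint[OF T(1)])
    note bT = selfadjoint_bounded[OF sT] and bD = selfadjoint_bounded[OF D]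
    obtain m M where m: "0 < m" "\<And>x. x \<in> carrier H \<Longrightarrow> m * (cnorm H x)\<^sup>2 \<le> Re (cinner H (T x) x)"
      using positive_invertible_bounds[OF T] by metis
    define E where "E = (\<lambda>x. D x \<ominus> complex_of_real t \<odot> x)"
    have bE: "bounded_op H E"
      unfolding E_def by (intro bounded_op_minus bD bounded_op_scale bounded_op_ident)
    have "invertible_op H (\<lambda>x. T (E x))"
    proof (rule coercive_invertible[OF bounded_op_comp[OF bT bE], of "- t * m"])
      show "0 < - t * m" using m(1) neg by (simp add: mult_neg_pos)
      fix x assume x: "x \<in> carrier H"
      have "cinner H (T (E x)) x = cinner H (E x) (T x)"
        by (rule selfadjoint_swap[OF sT]) (use bE x in \<open>simp_all add: bounded_op_in\<close>)
      also have "\<dots> = cinner H (D x) (T x) - complex_of_real t * cinner H x (T x)"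
        using bD bT x by (simp add: E_def inner_simps bounded_op_in)
      finally have "Re (cinner H (T (E x)) x) = Re (cinner H (T x) (D x)) + (- t) * Re (cinner H (T x) x)"
        using Re_inner_commute[of "D x" "T x"] Re_inner_commute[of x "T x"] bD bT x
        by (simp add: bounded_op_in)
      moreover have "(- t) * (m * (cnorm H x)\<^sup>2) \<le> (- t) * Re (cinner H (T x) x)"
        using m(2)[OF x] neg by (intro mult_left_mono) auto
      ultimately show "- t * m * (cnorm H x)\<^sup>2 \<le> Re (cinner H (T (E x)) x)"
        using TD[OF x] by (simp add: mult.assoc)
    qed
    then have "invertible_op H E"
      using T(2) bE by (rule invertible_op_cancel_left)
    then show False using t by (simp add: op_spectrum_def E_def)
  qed
qed

lemma powr_op_continuous:
  assumes A: "positive_op H A" "invertible_op H A" and x: "x \<in> carrier H" and z: "z \<in> carrier H"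
  shows "continuous_on {a..b} (\<lambda>p. cinner H (powr_op H A p x) z)"
proof -
  obtain m M where m: "0 < m" and spec: "Re ` op_spectrum H A \<subseteq> {m..M}"
    using positive_invertible_bounds[OF A] by metis
  have "continuous_on ({a..b} \<times> {m..M}) (\<lambda>w :: real \<times> real. snd w powr fst w)"
    using m by (intro continuous_intros) auto
  then have unif: "uniformly_continuous_on ({a..b} \<times> {m..M}) (\<lambda>w :: real \<times> real. snd w powr fst w)"
    by (intro compact_uniformly_continuous compact_Times) auto
  show ?thesis
    unfolding continuous_on_iff
  proof (intro ballI allI impI)
    fix p e :: real assume p: "p \<in> {a..b}" and e: "0 < e"
    define k where "k = e / (cnorm H x * cnorm H z + 1)"
    have nn: "0 \<le> cnorm H x * cnorm H z" using x z by (simp add: cnorm_nonneg)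
    have k: "0 < k" using e nn by (simp add: k_def)
    obtain d where d: "0 < d"
      "\<And>v w. v \<in> {a..b} \<times> {m..M} \<Longrightarrow> w \<in> {a..b} \<times> {m..M} \<Longrightarrow> dist w v < d
        \<Longrightarrow> dist (snd w powr fst w) (snd v powr fst v) < k"
      using unif k unfolding uniformly_continuous_on_def by metis
    have "dist (cinner H (powr_op H A q x) z) (cinner H (powr_op H A p x) z) < e"
      if q: "q \<in> {a..b}" and qp: "dist q p < d" for q
    proof -
      have "cnorm H (powr_op H A q x \<ominus> powr_op H A p x) \<le> k * cnorm H x"
      proof (rule has_cfc_dist[OF positive_selfadjoint[OF A(1)] has_cfc_powr[OF A] has_cfc_powr[OF A] _ _ x])
        fix t assume "t \<in> Re ` op_spectrum H A"
        then have "t \<in> {m..M}" using spec by blast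
        then show "\<bar>t powr q - t powr p\<bar> \<le> k"
          using d(2)[of "(p, t)" "(q, t)"] p q qp by (simp add: dist_Pair_Pair dist_real_def)
      qed (use k in simp)
      then have "cnorm H (powr_op H A q x \<ominus> powr_op H A p x) * cnorm H z \<le> (k * cnorm H x) * cnorm H z"
        using z by (intro mult_right_mono) (auto simp: cnorm_nonneg)
      moreover have "cmod (cinner H (powr_op H A q x \<ominus> powr_op H A p x) z)
          \<le> cnorm H (powr_op H A q x \<ominus> powr_op H A p x) * cnorm H z"
        using x z powr_op_bounded[OF A] by (intro Cauchy_Schwarz) (auto simp: bounded_op_in)
      moreover have "(k * cnorm H x) * cnorm H z < e"
        using e nn by (simp add: k_def field_simps)
      ultimately show ?thesis
        using x z powr_op_bounded[OF A] by (simp add: dist_norm inner_diff_left bounded_op_in)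
    qed
    then show "\<exists>d>0. \<forall>q\<in>{a..b}. dist q p < d \<longrightarrow>
        dist (cinner H (powr_op H A q x) z) (cinner H (powr_op H A p x) z) < e"
      using d(1) by blast
  qed
qed

text \<open>
  By \<open>anticommutator_positive_iff\<close> the hypothesis and the conclusion say that \<open>AB + BA\<close> and
  \<open>A\<^sup>pB + BA\<^sup>p\<close> are positive. The exponents in \<open>[0, 1]\<close> are reached from \<open>0\<close> and \<open>1\<close> by midpoints and limits.
\<close>

lemma powr_op_anticommutator:
  assumes A: "positive_op H A" "invertible_op H A" and B: "positive_op H B"
    and AB: "\<And>x. x \<in> carrier H \<Longrightarrow> 0 \<le> Re (cinner H (A x) (B x))"
    and p: "-1 \<le> p" "p \<le> 1" and x: "x \<in> carrier H"
  shows "0 \<le> Re (cinner H (powr_op H A p x) (B x))"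
proof -
  have sB: "selfadjoint_op H B" using B by (rule positive_selfadjoint)
  note bB = selfadjoint_bounded[OF sB]
  let ?P = "powr_op H A"
  have sP: "selfadjoint_op H (?P p)" and bP: "bounded_op H (?P p)" for p
    using powr_op_selfadjoint[OF A] powr_op_bounded[OF A] by auto
  note [simp] = bounded_op_in[OF bP] bounded_op_in[OF bB]
  define good where "good = (\<lambda>p. \<forall>x\<in>carrier H. 0 \<le> Re (cinner H (?P p x) (B x)))"
  have good_D: "0 \<le> Re (cinner H x (B (?P p x)))" if "good p" "x \<in> carrier H" for p x
  proof -
    have "cinner H x (B (?P p x)) = cinner H (B x) (?P p x)"
      using selfadjoint_swap[OF sB, of x "?P p x"] that by simp
    then show ?thesis
      using that Re_inner_commute[of "B x" "?P p x"] by (simp add: good_def)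
  qed
  \<comment> \<open>The two summands of \<open>\<langle>A\<^sup>dx, (A\<^sup>rB + BA\<^sup>r)x\<rangle>\<close> are \<open>\<langle>A\<^sup>qx, Bx\<rangle>\<close>, as \<open>r + d = q\<close>, and
      \<open>\<langle>y, BA\<^sup>py\<rangle>\<close> for \<open>y = A\<^sup>dx\<close>, as \<open>r = p + d\<close>.\<close>
  have mid: "good ((p + q) / 2)" if pq: "good p" "good q" "p \<le> q" "0 \<le> p" for p q
  proof -
    define r where "r = (p + q) / 2"
    define d where "d = (q - p) / 2"
    define D where "D = (\<lambda>x. ?P r (B x) \<oplus> B (?P r x))"
    have D: "selfadjoint_op H D"
      unfolding D_def by (rule anticommutator_selfadjoint[OF sP sB])
    have XD: "0 \<le> Re (cinner H (?P d x) (D x))" if x: "x \<in> carrier H" for x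
    proof -
      have "cinner H (?P d x) (?P r (B x)) = cinner H (?P r (?P d x)) (B x)"
        using selfadjoint_swap[OF sP[of r], of "?P d x" "B x"] x by simp
      also have "?P r (?P d x) = ?P q x"
        using powr_op_add[OF A x, of r d] by (simp add: r_def d_def diff_divide_distrib add_divide_distrib)
      finally have "0 \<le> Re (cinner H (?P d x) (?P r (B x)))"
        using pq(2) x by (simp add: good_def)
      moreover have "?P r x = ?P p (?P d x)"
        using powr_op_add[OF A x, of p d] by (simp add: r_def d_def diff_divide_distrib add_divide_distrib)
      then have "0 \<le> Re (cinner H (?P d x) (B (?P r x)))"
        using good_D[OF pq(1), of "?P d x"] x by simp
      ultimately show ?thesis using x by (simp add: D_def inner_simps)
    qed
    have "0 \<le> Re (cinner H (D x) x)" if "x \<in> carrier H" for x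
      by (rule Lyapunov_positive[OF powr_op_positive_invertible[OF A] D XD that])
    then show ?thesis
      using Re_anticommutator[OF sP[of r] sB] by (simp add: good_def D_def r_def)
  qed
  have good01: "good p" if "0 \<le> p" "p \<le> 1" for p
  proof -
    define S where "S = {p \<in> {0..1}. good p}"
    have "S = (\<Inter>x\<in>carrier H. {p \<in> {0..1}. 0 \<le> Re (cinner H (?P p x) (B x))})"
      using zero_in by (auto simp: S_def good_def)
    moreover have "closed {p \<in> {0..1}. 0 \<le> Re (cinner H (?P p x) (B x))}" if x: "x \<in> carrier H" for x
    proof -
      have "continuous_on {0..1} (\<lambda>p. Re (cinner H (?P p x) (B x)))"
        using x by (intro continuous_intros powr_op_continuous[OF A]) auto
      then show ?thesis
        using continuous_on_closed_Collect_le[OF continuous_on_const] closed_atLeastAtMost by blast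
    qed
    ultimately have "closed S" by auto
    moreover have "good 0"
      unfolding good_def using powr_op_0[OF A] Re_inner_commute positive_op_Re[OF B] by simp
    moreover have "good 1"
      unfolding good_def using powr_op_1[OF A] AB by simp
    ultimately have "p \<in> S"
      using mid that by (intro midpoint_closed_eq_interval[of S p]) (auto simp: S_def)
    then show ?thesis by (simp add: S_def)
  qed
  have "good p"
  proof (cases "0 \<le> p")
    case False
    show ?thesis
      unfolding good_def
    proof
      fix x assume x: "x \<in> carrier H"
      have "good (- p)" using good01[of "- p"] p False by simp
      then show "0 \<le> Re (cinner H (?P p x) (B x))"
        using good_D[of "- p" "?P p x"] powr_op_inverse[OF A x, of "- p"] x by simp
    qed
  qed (use p good01 in simp)
  then show ?thesis using x by (simp add: good_def)
qed

end

section \<open>Direct sums and ranges of projections\<close>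

text \<open>
  The orthogonal sum \<open>H \<oplus> H\<close>, coded into the element type of \<open>H\<close> by an injection \<open>\<phi>\<close> of pairs, because
  \<open>SOC TYPE('a)\<close> only speaks about Hilbert spaces with elements of type \<open>'a\<close>.
\<close>

definition hilbert_double :: "('a \<times> 'a \<Rightarrow> 'a) \<Rightarrow> 'a hilbert \<Rightarrow> 'a hilbert" where
  "hilbert_double \<phi> H =
    \<lparr>carrier = \<phi> ` (carrier H \<times> carrier H), mult = mult H, one = one H,
     zero = \<phi> (\<zero>\<^bsub>H\<^esub>, \<zero>\<^bsub>H\<^esub>),
     add = (\<lambda>u v. \<phi> (fst (the_inv \<phi> u) \<oplus>\<^bsub>H\<^esub> fst (the_inv \<phi> v), snd (the_inv \<phi> u) \<oplus>\<^bsub>H\<^esub> snd (the_inv \<phi> v))),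
     smult = (\<lambda>c u. \<phi> (c \<odot>\<^bsub>H\<^esub> fst (the_inv \<phi> u), c \<odot>\<^bsub>H\<^esub> snd (the_inv \<phi> u))),
     cinner = (\<lambda>u v. cinner H (fst (the_inv \<phi> u)) (fst (the_inv \<phi> v))
                   + cinner H (snd (the_inv \<phi> u)) (snd (the_inv \<phi> v)))\<rparr>"

lemma hilbert_double_simps:
  assumes "inj \<phi>"
  shows "\<zero>\<^bsub>hilbert_double \<phi> H\<^esub> = \<phi> (\<zero>\<^bsub>H\<^esub>, \<zero>\<^bsub>H\<^esub>)"
    and "\<phi> (a, b) \<oplus>\<^bsub>hilbert_double \<phi> H\<^esub> \<phi> (c, d) = \<phi> (a \<oplus>\<^bsub>H\<^esub> c, b \<oplus>\<^bsub>H\<^esub> d)"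
    and "k \<odot>\<^bsub>hilbert_double \<phi> H\<^esub> \<phi> (a, b) = \<phi> (k \<odot>\<^bsub>H\<^esub> a, k \<odot>\<^bsub>H\<^esub> b)"
    and "cinner (hilbert_double \<phi> H) (\<phi> (a, b)) (\<phi> (c, d)) = cinner H a c + cinner H b d"
  using assms by (simp_all add: hilbert_double_def the_inv_f_f)

lemma in_hilbert_double:
  "u \<in> carrier (hilbert_double \<phi> H) \<longleftrightarrow> (\<exists>a\<in>carrier H. \<exists>b\<in>carrier H. u = \<phi> (a, b))"
  by (auto simp: hilbert_double_def)

lemma hilbert_doubleE:
  assumes "u \<in> carrier (hilbert_double \<phi> H)"
  obtains a b where "a \<in> carrier H" "b \<in> carrier H" "u = \<phi> (a, b)"
  using assms by (auto simp: hilbert_double_def)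

lemma pair_in_hilbert_double:
  assumes "inj \<phi>"
  shows "\<phi> (a, b) \<in> carrier (hilbert_double \<phi> H) \<longleftrightarrow> a \<in> carrier H \<and> b \<in> carrier H"
  using assms by (simp add: hilbert_double_def inj_image_mem_iff)

lemma hilbert_double_pre_hilbert:
  fixes H :: "'a hilbert" (structure)
  assumes H: "complex_hilbert_space H" and \<phi>: "inj \<phi>"
  shows "pre_hilbert (hilbert_double \<phi> H)"
proof -
  interpret complex_hilbert_space H by (rule H)
  note sim = hilbert_double_simps[OF \<phi>]
  have "abelian_group (hilbert_double \<phi> H)"
  proof (rule abelian_groupI)
    fix u assume "u \<in> carrier (hilbert_double \<phi> H)"
    then obtain a b where u: "a \<in> carrier H" "b \<in> carrier H" "u = \<phi> (a, b)"
      by (auto simp: in_hilbert_double)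
    then show "\<exists>v\<in>carrier (hilbert_double \<phi> H). v \<oplus>\<^bsub>hilbert_double \<phi> H\<^esub> u = \<zero>\<^bsub>hilbert_double \<phi> H\<^esub>"
      by (intro bexI[of _ "\<phi> (\<ominus> a, \<ominus> b)"]) (auto simp: sim M.l_neg in_hilbert_double)
  qed (auto simp: sim pair_in_hilbert_double[OF \<phi>] M.add.m_ac
      elim!: hilbert_doubleE)
  then have "module (ring_of_type_algebra :: complex ring) (hilbert_double \<phi> H)"
    using smult_one by (intro moduleI cring_from_type_algebra)
      (auto simp: sim pair_in_hilbert_double[OF \<phi>] smult_l_distr[simplified] smult_r_distr[simplified]
        smult_assoc1[simplified] elim!: hilbert_doubleE)
  moreover have "pre_hilbert_axioms (hilbert_double \<phi> H)"
  proof
    fix u assume "u \<in> carrier (hilbert_double \<phi> H)" and nz: "u \<noteq> \<zero>\<^bsub>hilbert_double \<phi> H\<^esub>"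
    then obtain a b where u: "a \<in> carrier H" "b \<in> carrier H" "u = \<phi> (a, b)"
      by (auto simp: in_hilbert_double)
    then have "0 < Re (cinner H a a) \<or> 0 < Re (cinner H b b)"
      using nz inner_pos by (auto simp: sim)
    then show "0 < Re (cinner (hilbert_double \<phi> H) u u)"
      using u Re_inner_self_nonneg[of a] Re_inner_self_nonneg[of b] by (auto simp: sim)
  next
    fix u v assume "u \<in> carrier (hilbert_double \<phi> H)" "v \<in> carrier (hilbert_double \<phi> H)"
    then obtain a b c d where "a \<in> carrier H" "b \<in> carrier H" "u = \<phi> (a, b)"
      "c \<in> carrier H" "d \<in> carrier H" "v = \<phi> (c, d)"
      by (auto simp: in_hilbert_double)
    then show "cinner (hilbert_double \<phi> H) v u = cnj (cinner (hilbert_double \<phi> H) u v)"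
      using inner_commute[of a c] inner_commute[of b d] by (simp add: sim)
  qed (auto simp: sim inner_simps algebra_simps elim!: hilbert_doubleE)
  ultimately show ?thesis by (simp add: pre_hilbert_def)
qed

lemma cnorm_hilbert_double:
  fixes H :: "'a hilbert" (structure)
  assumes H: "complex_hilbert_space H" and \<phi>: "inj \<phi>"
    and "a \<in> carrier H" "b \<in> carrier H"
  shows "(cnorm (hilbert_double \<phi> H) (\<phi> (a, b)))\<^sup>2 = (cnorm H a)\<^sup>2 + (cnorm H b)\<^sup>2"
proof -
  interpret complex_hilbert_space H by (rule H)
  interpret K: pre_hilbert "hilbert_double \<phi> H" by (rule hilbert_double_pre_hilbert[OF H \<phi>])
  have "\<phi> (a, b) \<in> carrier (hilbert_double \<phi> H)" using assms(3,4) by (auto simp: in_hilbert_double)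
  then show ?thesis
    using assms(3,4) by (simp add: K.cnorm_power2 cnorm_power2 hilbert_double_simps[OF \<phi>])
qed

lemma hilbert_double_diff:
  fixes H :: "'a hilbert" (structure)
  assumes H: "complex_hilbert_space H" and \<phi>: "inj \<phi>"
    and "a \<in> carrier H" "b \<in> carrier H" "c \<in> carrier H" "d \<in> carrier H"
  shows "\<phi> (a, b) \<ominus>\<^bsub>hilbert_double \<phi> H\<^esub> \<phi> (c, d) = \<phi> (a \<ominus>\<^bsub>H\<^esub> c, b \<ominus>\<^bsub>H\<^esub> d)"
proof -
  interpret complex_hilbert_space H by (rule H)
  interpret K: pre_hilbert "hilbert_double \<phi> H" by (rule hilbert_double_pre_hilbert[OF H \<phi>])
  have "\<phi> (a, b) \<in> carrier (hilbert_double \<phi> H)" "\<phi> (c, d) \<in> carrier (hilbert_double \<phi> H)"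
    using assms(3-) by (auto simp: in_hilbert_double)
  then show ?thesis
    using assms(3-) by (simp add: K.diff_eq_smult diff_eq_smult hilbert_double_simps[OF \<phi>])
qed

lemma hilbert_double_hilbert:
  fixes H :: "'a hilbert" (structure)
  assumes H: "complex_hilbert_space H" and \<phi>: "inj \<phi>"
  shows "complex_hilbert_space (hilbert_double \<phi> H)"
proof -
  interpret complex_hilbert_space H by (rule H)
  interpret K: pre_hilbert "hilbert_double \<phi> H" by (rule hilbert_double_pre_hilbert[OF H \<phi>])
  note nrm = cnorm_hilbert_double[OF H \<phi>] and dif = hilbert_double_diff[OF H \<phi>]
  show ?thesis
  proof (rule K.complex_hilbert_spaceI)
    fix s assume s: "K.Cauchy_seq s"
    then have "s n \<in> carrier (hilbert_double \<phi> H)" for n by (simp add: K.Cauchy_seq_def)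
    then obtain a b where ab: "\<And>n. a n \<in> carrier H" "\<And>n. b n \<in> carrier H" "\<And>n. s n = \<phi> (a n, b n)"
      unfolding in_hilbert_double by metis
    have d2: "(cnorm (hilbert_double \<phi> H) (s m \<ominus>\<^bsub>hilbert_double \<phi> H\<^esub> s n))\<^sup>2
        = (cnorm H (a m \<ominus> a n))\<^sup>2 + (cnorm H (b m \<ominus> b n))\<^sup>2" for m n
      using ab by (simp add: dif nrm)
    have "s n \<in> carrier (hilbert_double \<phi> H)" for n using s by (simp add: K.Cauchy_seq_def)
    then have nn: "0 \<le> cnorm (hilbert_double \<phi> H) (s m \<ominus>\<^bsub>hilbert_double \<phi> H\<^esub> s n)" for m n
      by (simp add: K.cnorm_nonneg)
    have le: "cnorm H (a m \<ominus> a n) \<le> cnorm (hilbert_double \<phi> H) (s m \<ominus>\<^bsub>hilbert_double \<phi> H\<^esub> s n)"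
      "cnorm H (b m \<ominus> b n) \<le> cnorm (hilbert_double \<phi> H) (s m \<ominus>\<^bsub>hilbert_double \<phi> H\<^esub> s n)" for m n
      using d2[of m n] nn[of m n] by (auto intro: power2_le_imp_le)
    have "Cauchy_seq a" "Cauchy_seq b"
      using s ab le unfolding K.Cauchy_seq_def Cauchy_seq_def by (meson le_less_trans)+
    then obtain l k where "converges a l" "converges b k"
      using Cauchy_converges by blast
    then have lk: "l \<in> carrier H" "k \<in> carrier H" and lim: "(\<lambda>n. cnorm H (a n \<ominus> l)) \<longlonglongrightarrow> 0"
      "(\<lambda>n. cnorm H (b n \<ominus> k)) \<longlonglongrightarrow> 0" by (auto simp: converges_def)
    have "K.converges s (\<phi> (l, k))"
      unfolding K.converges_def
    proof
      show "\<phi> (l, k) \<in> carrier (hilbert_double \<phi> H)" using lk by (auto simp: in_hilbert_double)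
      have "cnorm (hilbert_double \<phi> H) (s n \<ominus>\<^bsub>hilbert_double \<phi> H\<^esub> \<phi> (l, k))
          = sqrt ((cnorm H (a n \<ominus> l))\<^sup>2 + (cnorm H (b n \<ominus> k))\<^sup>2)" for n
      proof -
        have "s n \<ominus>\<^bsub>hilbert_double \<phi> H\<^esub> \<phi> (l, k) \<in> carrier (hilbert_double \<phi> H)"
          using ab lk by (intro K.diff_in) (simp_all add: pair_in_hilbert_double[OF \<phi>])
        then show ?thesis
          using nrm[of "a n \<ominus> l" "b n \<ominus> k"] ab lk K.cnorm_nonneg
          by (simp add: dif real_sqrt_unique)
      qed
      moreover have "(\<lambda>n. sqrt ((cnorm H (a n \<ominus> l))\<^sup>2 + (cnorm H (b n \<ominus> k))\<^sup>2)) \<longlonglongrightarrow> sqrt (0\<^sup>2 + 0\<^sup>2)"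
        using lim by (intro tendsto_intros)
      ultimately show "(\<lambda>n. cnorm (hilbert_double \<phi> H) (s n \<ominus>\<^bsub>hilbert_double \<phi> H\<^esub> \<phi> (l, k))) \<longlonglongrightarrow> 0"
        by simp
    qed
    then show "\<exists>l. K.converges s l" by blast
  qed
qed

lemma range_space_simps:
  "carrier (range_space H P) = P ` carrier H"
  "x \<oplus>\<^bsub>range_space H P\<^esub> y = x \<oplus>\<^bsub>H\<^esub> y"
  "c \<odot>\<^bsub>range_space H P\<^esub> x = c \<odot>\<^bsub>H\<^esub> x"
  "\<zero>\<^bsub>range_space H P\<^esub> = \<zero>\<^bsub>H\<^esub>"
  "cinner (range_space H P) x y = cinner H x y"
  "cnorm (range_space H P) x = cnorm H x"
  by (simp_all add: range_space_def cnorm_def)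

lemma (in complex_hilbert_space) in_range_projection:
  assumes "projection_op H P"
  shows "x \<in> P ` carrier H \<longleftrightarrow> x \<in> carrier H \<and> P x = x"
proof -
  have "bounded_op H P" using assms by (simp add: projection_op_def selfadjoint_bounded)
  then show ?thesis
    using assms by (auto simp: projection_op_def bounded_op_in intro: image_eqI[of _ _ x])
qed

text \<open>
  The range of a projection is the set of its fixed points, and this set is closed.
\<close>

lemma range_space_hilbert:
  fixes H :: "'a hilbert" (structure)
  assumes H: "complex_hilbert_space H" and P: "projection_op H P"
  shows "complex_hilbert_space (range_space H P)"
proof -
  interpret complex_hilbert_space H by (rule H)
  have b: "bounded_op H P" using P by (simp add: projection_op_def selfadjoint_bounded)
  note mem = in_range_projection[OF P]
  note sim = range_space_simps mem
  have "abelian_group (range_space H P)"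
  proof (rule abelian_groupI)
    fix x assume "x \<in> carrier (range_space H P)"
    then show "\<exists>y\<in>carrier (range_space H P). y \<oplus>\<^bsub>range_space H P\<^esub> x = \<zero>\<^bsub>range_space H P\<^esub>"
      using b M.l_neg[of x]
      by (intro bexI[of _ "(-1) \<odot> x"]) (auto simp: sim bounded_op_smult uminus_eq_smult)
  qed (use b in \<open>auto simp: sim bounded_op_add bounded_op_zero M.a_assoc intro!: M.a_comm\<close>)
  then have "module (ring_of_type_algebra :: complex ring) (range_space H P)"
    using smult_one b by (intro moduleI cring_from_type_algebra)
      (auto simp: sim bounded_op_smult smult_l_distr[simplified] smult_r_distr[simplified] smult_assoc1[simplified])
  moreover have "pre_hilbert_axioms (range_space H P)"
    by unfold_locales (auto simp: sim inner_simps intro: inner_commute inner_pos)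
  ultimately interpret R: pre_hilbert "range_space H P" by (simp add: pre_hilbert_def)
  have dif: "x \<ominus>\<^bsub>range_space H P\<^esub> y = x \<ominus> y" if "x \<in> P ` carrier H" "y \<in> P ` carrier H" for x y
    using that R.diff_eq_smult[of x y] diff_eq_smult[of x y] by (simp add: sim)
  show ?thesis
  proof (rule R.complex_hilbert_spaceI)
    fix s assume s: "R.Cauchy_seq s"
    then have s_in: "s n \<in> P ` carrier H" for n by (simp add: R.Cauchy_seq_def range_space_simps)
    then have s_H: "s n \<in> carrier H" "P (s n) = s n" for n using mem by auto
    have "Cauchy_seq s"
      using s s_H dif[OF s_in s_in] by (simp add: R.Cauchy_seq_def Cauchy_seq_def range_space_simps)
    then obtain l where "converges s l" using Cauchy_converges by blast
    then have l: "l \<in> carrier H" and lim: "(\<lambda>n. cnorm H (s n \<ominus> l)) \<longlonglongrightarrow> 0"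
      by (auto simp: converges_def)
    have "P l = l"
    proof (rule vec_eqI)
      fix z assume z: "z \<in> carrier H"
      have sw: "cinner H (P x) z = cinner H x (P z)" if "x \<in> carrier H" for x
        using that z P by (simp add: projection_op_def selfadjoint_swap)
      have Pz: "P z \<in> carrier H" using b z by (simp add: bounded_op_in)
      have "(\<lambda>n. cinner H (s n) (P z)) \<longlonglongrightarrow> cinner H l (P z)"
        using converges_inner[OF \<open>converges s l\<close> s_H(1) Pz] .
      then have "(\<lambda>n. cinner H (s n) z) \<longlonglongrightarrow> cinner H (P l) z"
        using sw[OF s_H(1)] sw[OF l] s_H(2) by simp
      then show "cinner H (P l) z = cinner H l z"
        using converges_inner[OF \<open>converges s l\<close> s_H(1) z] LIMSEQ_unique by blast
    qed (use l b in \<open>auto simp: bounded_op_in\<close>)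
    then have l_in: "l \<in> P ` carrier H" using l mem by simp
    then have "R.converges s l"
      using lim dif[OF s_in l_in] by (simp add: R.converges_def range_space_simps)
    then show "\<exists>l. R.converges s l" by blast
  qed
qed

text \<open>
  A nonzero vector has infinitely many scalar multiples, so the type \<open>'a\<close> is infinite and
  equipotent with its square.
\<close>

lemma (in complex_hilbert_space) pairing_injection:
  assumes "carrier H \<noteq> {\<zero>}"
  obtains \<phi> :: "'a \<times> 'a \<Rightarrow> 'a" where "inj \<phi>"
proof -
  obtain u where u: "u \<in> carrier H" "u \<noteq> \<zero>" using assms by auto
  have "c = d" if "c \<odot> u = d \<odot> u" for c d
  proof -
    have "c * cinner H u u = d * cinner H u u"
      using that u by (metis inner_smult_left)
    then show ?thesis using inner_pos[OF u] by auto
  qed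
  then have "inj (\<lambda>c. c \<odot> u)" by (auto intro: injI)
  then have "infinite (UNIV :: 'a set)"
    using infinite_UNIV_char_0[where 'a = complex] finite_imageD finite_subset by (metis subset_UNIV)
  then obtain \<phi> where "bij_betw \<phi> (UNIV \<times> UNIV :: ('a \<times> 'a) set) (UNIV :: 'a set)"
    using card_of_Times_same_infinite card_of_ordIso by metis
  then show ?thesis using that by (auto simp: bij_betw_def)
qed

section \<open>Strongly operator convex functions\<close>

text \<open>
  The Hansen type inequality \<open>C g(CAC + SYS) C \<le> g(A)\<close> for self-adjoint \<open>C\<close> and \<open>S\<close> with \<open>C\<^sup>2 + S\<^sup>2 = 1\<close>.
  In \<open>H \<oplus> H\<close> the operator \<open>V = (C, S)\<close> is an isometry with adjoint \<open>W = (C S)\<close>, the projection \<open>P = VW\<close>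
  has the range of \<open>V\<close> as its range, and \<open>V\<close> carries \<open>Z = CAC + SYS\<close> over to the compression of
  \<open>D = A \<oplus> Y\<close> to that range. The inequality is the upper left corner of \<open>P g(PDP) P \<le> g(D)\<close>.
\<close>

lemma SOC_contraction:
  fixes H :: "'a hilbert" (structure) and A Y Z C S :: "'a \<Rightarrow> 'a"
  assumes H: "complex_hilbert_space H" and ne: "carrier H \<noteq> {\<zero>\<^bsub>H\<^esub>}"
    and g: "g \<in> SOC TYPE('a) {0<..}"
    and A: "positive_op H A" "invertible_op H A"
    and Y: "positive_op H Y" "invertible_op H Y"
    and Z: "selfadjoint_op H Z"
    and C: "selfadjoint_op H C" and S: "selfadjoint_op H S"
    and CS: "\<And>x. x \<in> carrier H \<Longrightarrow> C (C x) \<oplus>\<^bsub>H\<^esub> S (S x) = x"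
    and Z_eq: "\<And>x. x \<in> carrier H \<Longrightarrow> C (A (C x)) \<oplus>\<^bsub>H\<^esub> S (Y (S x)) = Z x"
    and x: "x \<in> carrier H"
  shows "Re (cinner H (cfc H g Z (C x)) (C x)) \<le> Re (cinner H (cfc H g A x) x)"
proof -
  interpret complex_hilbert_space H by (rule H)
  obtain \<phi> :: "'a \<times> 'a \<Rightarrow> 'a" where \<phi>: "inj \<phi>" using pairing_injection[OF ne] by metis
  define K where "K = hilbert_double \<phi> H"
  interpret K: complex_hilbert_space K
    unfolding K_def by (rule hilbert_double_hilbert[OF H \<phi>])
  note sim = hilbert_double_simps[OF \<phi>, of H, folded K_def]
  note K_E = hilbert_doubleE[of _ \<phi> H, folded K_def]
  have pair: "\<phi> (a, b) \<in> carrier K \<longleftrightarrow> a \<in> carrier H \<and> b \<in> carrier H" for a b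
    unfolding K_def by (rule pair_in_hilbert_double[OF \<phi>])
  have nrm: "(cnorm K (\<phi> (a, b)))\<^sup>2 = (cnorm H a)\<^sup>2 + (cnorm H b)\<^sup>2" if "a \<in> carrier H" "b \<in> carrier H" for a b
    unfolding K_def by (rule cnorm_hilbert_double[OF H \<phi> that])
  have inj: "\<phi> (a, b) = \<phi> (c, d) \<longleftrightarrow> a = c \<and> b = d" for a b c d
    using inj_eq[OF \<phi>] by simp
  have sA: "selfadjoint_op H A" and sY: "selfadjoint_op H Y"
    using A Y by (auto intro: positive_selfadjoint)
  note bA = selfadjoint_bounded[OF sA] and bY = selfadjoint_bounded[OF sY]
    and bC = selfadjoint_bounded[OF C] and bS = selfadjoint_bounded[OF S] and bZ = selfadjoint_bounded[OF Z]
  note [simp] = bA[THEN bounded_op_in] bY[THEN bounded_op_in] bC[THEN bounded_op_in]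
    bS[THEN bounded_op_in] bZ[THEN bounded_op_in]
  note lin = bA[THEN bounded_op_add] bY[THEN bounded_op_add] bC[THEN bounded_op_add] bS[THEN bounded_op_add]
    bA[THEN bounded_op_smult] bY[THEN bounded_op_smult] bC[THEN bounded_op_smult] bS[THEN bounded_op_smult]

  define D where "D = (\<lambda>u. \<phi> (A (fst (the_inv \<phi> u)), Y (snd (the_inv \<phi> u))))"
  define V where "V = (\<lambda>z. \<phi> (C z, S z))"
  define W where "W = (\<lambda>u. C (fst (the_inv \<phi> u)) \<oplus> S (snd (the_inv \<phi> u)))"
  define P where "P = (\<lambda>u. V (W u))"
  have D_eq: "D (\<phi> (a, b)) = \<phi> (A a, Y b)" for a b using \<phi> by (simp add: D_def the_inv_f_f)
  have W_eq: "W (\<phi> (a, b)) = C a \<oplus> S b" for a b using \<phi> by (simp add: W_def the_inv_f_f)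

  obtain mA MA where mA: "0 < mA" "\<And>x. x \<in> carrier H \<Longrightarrow> mA * (cnorm H x)\<^sup>2 \<le> Re (cinner H (A x) x)"
    "\<And>x. x \<in> carrier H \<Longrightarrow> Re (cinner H (A x) x) \<le> MA * (cnorm H x)\<^sup>2"
    using positive_invertible_bounds[OF A] by metis
  obtain mY MY where mY: "0 < mY" "\<And>x. x \<in> carrier H \<Longrightarrow> mY * (cnorm H x)\<^sup>2 \<le> Re (cinner H (Y x) x)"
    "\<And>x. x \<in> carrier H \<Longrightarrow> Re (cinner H (Y x) x) \<le> MY * (cnorm H x)\<^sup>2"
    using positive_invertible_bounds[OF Y] by metis
  define m where "m = min mA mY"
  define M where "M = max MA MY"
  have m: "0 < m" using mA(1) mY(1) by (simp add: m_def)
  have A_bd: "m * (cnorm H x)\<^sup>2 \<le> Re (cinner H (A x) x)" "Re (cinner H (A x) x) \<le> M * (cnorm H x)\<^sup>2"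
    if "x \<in> carrier H" for x
  proof -
    have "m * (cnorm H x)\<^sup>2 \<le> mA * (cnorm H x)\<^sup>2" "MA * (cnorm H x)\<^sup>2 \<le> M * (cnorm H x)\<^sup>2"
      by (auto simp: m_def M_def intro: mult_right_mono)
    then show "m * (cnorm H x)\<^sup>2 \<le> Re (cinner H (A x) x)" "Re (cinner H (A x) x) \<le> M * (cnorm H x)\<^sup>2"
      using mA(2,3)[OF that] by linarith+
  qed
  have Y_bd: "m * (cnorm H x)\<^sup>2 \<le> Re (cinner H (Y x) x)" "Re (cinner H (Y x) x) \<le> M * (cnorm H x)\<^sup>2"
    if "x \<in> carrier H" for x
  proof -
    have "m * (cnorm H x)\<^sup>2 \<le> mY * (cnorm H x)\<^sup>2" "MY * (cnorm H x)\<^sup>2 \<le> M * (cnorm H x)\<^sup>2"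
      by (auto simp: m_def M_def intro: mult_right_mono)
    then show "m * (cnorm H x)\<^sup>2 \<le> Re (cinner H (Y x) x)" "Re (cinner H (Y x) x) \<le> M * (cnorm H x)\<^sup>2"
      using mY(2,3)[OF that] by linarith+
  qed

  have bD: "bounded_op K D"
  proof -
    obtain KA where KA: "0 < KA" "\<And>x. x \<in> carrier H \<Longrightarrow> cnorm H (A x) \<le> KA * cnorm H x"
      using bounded_op_bound[OF bA] by metis
    obtain KY where KY: "0 < KY" "\<And>x. x \<in> carrier H \<Longrightarrow> cnorm H (Y x) \<le> KY * cnorm H x"
      using bounded_op_bound[OF bY] by metis
    show ?thesis
    proof (rule K.bounded_opI[where K = "KA + KY"])
      fix u assume "u \<in> carrier K"
      then obtain a b where u: "a \<in> carrier H" "b \<in> carrier H" "u = \<phi> (a, b)" by (rule K_E)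
      show Du: "D u \<in> carrier K"
        using u by (simp add: D_eq pair)
      show "cnorm K (D u) \<le> (KA + KY) * cnorm K u"
      proof (rule power2_le_imp_le)
        have "(cnorm K (D u))\<^sup>2 = (cnorm H (A a))\<^sup>2 + (cnorm H (Y b))\<^sup>2"
          using u by (simp add: D_eq nrm)
        also have "\<dots> \<le> ((KA + KY) * cnorm H a)\<^sup>2 + ((KA + KY) * cnorm H b)\<^sup>2"
        proof (intro add_mono power_mono)
          show "cnorm H (A a) \<le> (KA + KY) * cnorm H a" "cnorm H (Y b) \<le> (KA + KY) * cnorm H b"
            using KA(2)[OF u(1)] KY(2)[OF u(2)] KA(1) KY(1) cnorm_nonneg[OF u(1)] cnorm_nonneg[OF u(2)]
            by (smt (verit) mult_right_mono)+
        qed (use u in \<open>auto simp: cnorm_nonneg\<close>)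
        also have "\<dots> = ((KA + KY) * cnorm K u)\<^sup>2"
          unfolding power_mult_distrib using u by (simp add: nrm distrib_left)
        finally show "(cnorm K (D u))\<^sup>2 \<le> ((KA + KY) * cnorm K u)\<^sup>2" .
        have "u \<in> carrier K" using u by (simp add: pair)
        then show "0 \<le> (KA + KY) * cnorm K u" using KA(1) KY(1) by (simp add: K.cnorm_nonneg)
      qed
    qed (auto simp: sim D_eq lin elim!: K_E)
  qed
  have D: "selfadjoint_op K D"
    unfolding selfadjoint_op_def
    using bD selfadjoint_swap[OF sA] selfadjoint_swap[OF sY] by (auto simp: sim D_eq elim!: K_E)
  have D_bd: "m * (cnorm K u)\<^sup>2 \<le> Re (cinner K (D u) u)" "Re (cinner K (D u) u) \<le> M * (cnorm K u)\<^sup>2"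
    if u_in: "u \<in> carrier K" for u
  proof -
    obtain a b where u: "a \<in> carrier H" "b \<in> carrier H" "u = \<phi> (a, b)" using u_in by (rule K_E)
    show "m * (cnorm K u)\<^sup>2 \<le> Re (cinner K (D u) u)" "Re (cinner K (D u) u) \<le> M * (cnorm K u)\<^sup>2"
      using A_bd[OF u(1)] Y_bd[OF u(2)] u by (auto simp: D_eq sim nrm distrib_left)
  qed
  have specD: "op_spectrum K D \<subseteq> complex_of_real ` {m..M}"
    by (rule K.selfadjoint_spectrum_bounds[OF D D_bd])

  have V_in: "V z \<in> carrier K" if "z \<in> carrier H" for z using that by (simp add: V_def pair)
  have W_in: "W u \<in> carrier H" if "u \<in> carrier K" for u using that by (auto simp: W_eq elim!: K_E)
  have WV: "W (V z) = z" if "z \<in> carrier H" for z using that CS by (simp add: V_def W_eq)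
  have inner_V: "cinner K (V z) u = cinner H z (W u)" if "z \<in> carrier H" "u \<in> carrier K" for z u
    using that selfadjoint_swap[OF C] selfadjoint_swap[OF S] by (auto simp: V_def W_eq sim inner_simps elim!: K_E)
  have V_norm: "cnorm K (V z) = cnorm H z" if z: "z \<in> carrier H" for z
    using inner_V[OF z V_in[OF z]] WV[OF z] by (simp add: cnorm_def)
  have V_add: "V (y \<oplus> z) = V y \<oplus>\<^bsub>K\<^esub> V z" if "y \<in> carrier H" "z \<in> carrier H" for y z
    using that by (simp add: V_def sim lin)
  have V_smult: "V (c \<odot> z) = c \<odot>\<^bsub>K\<^esub> V z" if "z \<in> carrier H" for c z
    using that by (simp add: V_def sim lin)
  have W_add: "W (u \<oplus>\<^bsub>K\<^esub> v) = W u \<oplus> W v" if "u \<in> carrier K" "v \<in> carrier K" for u v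
    using that by (auto simp: sim W_eq lin intro!: vec_eqI elim!: K_E) (simp_all add: inner_simps)
  have W_smult: "W (c \<odot>\<^bsub>K\<^esub> u) = c \<odot> W u" if "u \<in> carrier K" for c u
    using that by (auto simp: sim W_eq lin intro!: vec_eqI elim!: K_E) (simp_all add: inner_simps algebra_simps)
  have W_norm: "cnorm H (W u) \<le> cnorm K u" if u: "u \<in> carrier K" for u
  proof (cases "cnorm H (W u) = 0")
    case False
    have "cinner K (V (W u)) u = cinner H (W u) (W u)"
      by (rule inner_V[OF W_in[OF u] u])
    then have "(cnorm H (W u))\<^sup>2 = Re (cinner K (V (W u)) u)"
      using W_in[OF u] by (simp add: cnorm_power2)
    also have "\<dots> \<le> cnorm K (V (W u)) * cnorm K u"
      by (rule order_trans[OF complex_Re_le_cmod K.Cauchy_Schwarz[OF V_in[OF W_in[OF u]] u]])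
    also have "\<dots> = cnorm H (W u) * cnorm K u" using V_norm[OF W_in[OF u]] by simp
    finally show ?thesis
      using False cnorm_nonneg[OF W_in[OF u]] by (simp add: power2_eq_square)
  qed (use u in \<open>simp add: K.cnorm_nonneg\<close>)
  have bP: "bounded_op K P"
    by (rule K.bounded_opI[where K = 1])
      (auto simp: P_def V_in W_in V_add W_add V_smult W_smult V_norm W_norm)
  have P: "projection_op K P"
    unfolding projection_op_def selfadjoint_op_def
  proof (intro conjI ballI bP)
    fix u v assume u: "u \<in> carrier K" and v: "v \<in> carrier K"
    have "cinner K u (P v) = cnj (cinner K (P v) u)"
      using u v bP by (intro K.inner_commute) (auto simp: K.bounded_op_in)
    also have "\<dots> = cinner H (W u) (W v)"
      using inner_V[OF W_in[OF v] u] inner_commute[OF W_in[OF v] W_in[OF u]] by (simp add: P_def)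
    finally show "cinner K (P u) v = cinner K u (P v)"
      using inner_V[OF W_in[OF u] v] by (simp add: P_def)
  qed (simp add: P_def WV W_in)

  define R where "R = range_space K P"
  interpret R: complex_hilbert_space R
    unfolding R_def by (rule range_space_hilbert[OF K.complex_hilbert_space_axioms P])
  note Rsim = range_space_simps[of K P, folded R_def]
  have R_mem: "u \<in> carrier R \<longleftrightarrow> u \<in> carrier K \<and> P u = u" for u
    using K.in_range_projection[OF P] by (simp add: Rsim)
  define E where "E = (\<lambda>y. P (D y))"
  have bE: "bounded_op K E" unfolding E_def by (rule K.bounded_op_comp[OF bP bD])
  have E_swap: "cinner K (E u) v = cinner K (D u) v" if "u \<in> carrier K" "v \<in> carrier R" for u v
    using that P bD by (simp add: E_def R_mem projection_op_def K.selfadjoint_swap K.bounded_op_in)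
  have bE_R: "bounded_op R E"
  proof -
    obtain k where "0 < k" "\<And>u. u \<in> carrier K \<Longrightarrow> cnorm K (E u) \<le> k * cnorm K u"
      using K.bounded_op_bound[OF bE] by metis
    moreover have "P (E u) = E u" if "u \<in> carrier K" for u
      using that P bD by (simp add: E_def projection_op_def K.bounded_op_in)
    ultimately show ?thesis
      by (intro R.bounded_opI[where K = k])
        (auto simp: Rsim(2-) R_mem K.bounded_op_in[OF bE] K.bounded_op_add[OF bE] K.bounded_op_smult[OF bE])
  qed
  have E: "selfadjoint_op R E"
    unfolding selfadjoint_op_def
  proof (intro conjI ballI bE_R)
    fix u v assume uv: "u \<in> carrier R" "v \<in> carrier R"
    then have uv': "u \<in> carrier K" "v \<in> carrier K" by (auto simp: R_mem)
    have "cinner K (D u) v = cinner K u (D v)"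
      by (rule K.selfadjoint_swap[OF D uv'])
    also have "\<dots> = cnj (cinner K (D v) u)"
      by (rule K.inner_commute) (use uv' bD in \<open>auto simp: K.bounded_op_in\<close>)
    also have "\<dots> = cnj (cinner K (E v) u)"
      using E_swap[of v u] uv uv' by simp
    also have "\<dots> = cinner K u (E v)"
      by (rule K.inner_commute[symmetric]) (use uv' bE in \<open>auto simp: K.bounded_op_in\<close>)
    finally show "cinner R (E u) v = cinner R u (E v)"
      using E_swap[of u v] uv uv' by (simp add: Rsim)
  qed
  have specE: "op_spectrum R E \<subseteq> complex_of_real ` {m..M}"
    by (rule R.selfadjoint_spectrum_bounds[OF E])
      (use D_bd E_swap in \<open>auto simp: Rsim(2-) R_mem\<close>)
  have VE: "V (Z z) = E (V z)" if z: "z \<in> carrier H" for z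
    using Z_eq[OF z] by (simp add: E_def P_def) (simp add: V_def D_eq W_eq)
  have V_R: "V z \<in> carrier R" if "z \<in> carrier H" for z
    using V_in[OF that] WV[OF that] by (simp add: R_mem P_def)
  have Z_bd: "m * (cnorm H z)\<^sup>2 \<le> Re (cinner H (Z z) z)" "Re (cinner H (Z z) z) \<le> M * (cnorm H z)\<^sup>2"
    if z: "z \<in> carrier H" for z
  proof -
    have "cinner K (D (V z)) (V z) = cinner K (E (V z)) (V z)"
      using E_swap[OF V_in[OF z] V_R[OF z]] by simp
    also have "\<dots> = cinner H (Z z) z"
      using VE[OF z] inner_V[of "Z z" "V z"] WV[OF z] V_in[OF z] z by simp
    finally show "m * (cnorm H z)\<^sup>2 \<le> Re (cinner H (Z z) z)" "Re (cinner H (Z z) z) \<le> M * (cnorm H z)\<^sup>2"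
      using D_bd[OF V_in[OF z]] V_norm[OF z] by simp_all
  qed
  have specZ: "op_spectrum H Z \<subseteq> complex_of_real ` {m..M}"
    by (rule selfadjoint_spectrum_bounds[OF Z Z_bd])
  have specA: "op_spectrum H A \<subseteq> complex_of_real ` {m..M}"
    by (rule selfadjoint_spectrum_bounds[OF sA A_bd])
  have g_cont: "continuous_on {m..M} g"
    using g m by (auto simp: SOC_def intro: continuous_on_subset)

  \<comment> \<open>\<open>V\<close> is unitary onto the range of \<open>P\<close> and transports \<open>g(Z)\<close> to the compression; the inclusion of the
      first summand turns \<open>g(A)\<close> into the upper left corner of \<open>g(D)\<close>.\<close>
  have gZ: "V (cfc H g Z (C x)) = cfc R g E (V (C x))"
    by (rule cfc_intertwine[OF H R.complex_hilbert_space_axioms Z E _ _ g_cont])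
      (use specZ specE x in \<open>auto simp: V_R V_add V_smult V_norm VE Rsim(2-)\<close>)
  have gA: "\<phi> (cfc H g A x, \<zero>) = cfc K g D (\<phi> (x, \<zero>))"
  proof (rule cfc_intertwine[OF H K.complex_hilbert_space_axioms sA D _ _ g_cont, where J = "\<lambda>z. \<phi> (z, \<zero>)"])
    fix c z assume z: "z \<in> carrier H"
    have "c \<odot> \<zero> = \<zero>" by (intro vec_eqI) (auto simp: inner_simps)
    then show "\<phi> (c \<odot> z, \<zero>) = c \<odot>\<^bsub>K\<^esub> \<phi> (z, \<zero>)" by (simp add: sim)
    have "\<phi> (z, \<zero>) \<in> carrier K" using z by (simp add: pair)
    then show "cnorm K (\<phi> (z, \<zero>)) = cnorm H z"
      using nrm[OF z zero_in] z by (simp add: cnorm_zero cnorm_nonneg K.cnorm_nonneg)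
    show "\<phi> (A z, \<zero>) = D (\<phi> (z, \<zero>))"
      using bounded_op_zero[OF bY] by (simp add: D_eq)
  qed (use specA specD x in \<open>auto simp: pair sim\<close>)

  \<comment> \<open>Testing against vectors of the first summand reads off the upper left corner; note \<open>Pu = VCx\<close>.\<close>
  define u where "u = \<phi> (x, \<zero>)"
  have u: "u \<in> carrier K" using x by (simp add: u_def pair)
  have Wu: "W u = C x"
    using x bounded_op_zero[OF bS] by (simp add: u_def W_eq)
  have re: "Re ` op_spectrum H Z \<subseteq> {m..M}" "Re ` op_spectrum H A \<subseteq> {m..M}"
    using specZ specA by auto
  have hZ: "cfc H g Z (C x) \<in> carrier H"
    by (rule bounded_op_in[OF has_cfc_bounded[OF has_cfc_cfc[OF Z re(1) g_cont]]]) (use x in simp)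
  have hA: "cfc H g A x \<in> carrier H"
    by (rule bounded_op_in[OF has_cfc_bounded[OF has_cfc_cfc[OF sA re(2) g_cont]] x])
  have "op_spectrum K D \<subseteq> complex_of_real ` {0<..}"
    using specD m by force
  then have "op_le K (\<lambda>x. P (cfc R g E (P x))) (cfc K g D)"
    using g K.complex_hilbert_space_axioms D P unfolding SOC_def R_def E_def by blast
  then have "positive_op K (\<lambda>x. cfc K g D x \<ominus>\<^bsub>K\<^esub> P (cfc R g E (P x)))"
    by (simp add: op_le_def)
  then have "0 \<le> Re (cinner K (cfc K g D u \<ominus>\<^bsub>K\<^esub> P (cfc R g E (P u))) u)"
    using u by (rule K.positive_op_Re)
  moreover have "P (cfc R g E (P u)) = V (cfc H g Z (C x))"
    using gZ Wu V_R[OF hZ] by (simp add: P_def R_mem)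
  moreover have "cinner K (V (cfc H g Z (C x))) u = cinner H (cfc H g Z (C x)) (C x)"
    using inner_V[OF hZ u] Wu by simp
  moreover have "cfc K g D u = \<phi> (cfc H g A x, \<zero>)" using gA by (simp add: u_def)
  moreover have "\<phi> (cfc H g A x, \<zero>) \<in> carrier K" using hA by (simp add: pair)
  ultimately show ?thesis
    using V_in[OF hZ] u x hA by (simp add: K.inner_simps) (simp add: u_def sim inner_simps)
qed

lemma nonneg_if_perturbed_nonneg:
  fixes a b :: real
  assumes "0 < r" "\<And>t. 0 < t \<Longrightarrow> t \<le> r \<Longrightarrow> 0 \<le> a + t * b"
  shows "0 \<le> a"
proof (rule tendsto_lowerbound)
  show "((\<lambda>t. a + t * b) \<longlongrightarrow> a) (at_right 0)"
    by (auto intro!: tendsto_eq_intros)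
  show "\<forall>\<^sub>F t in at_right 0. 0 \<le> a + t * b"
    using assms by (auto simp: eventually_at_right_field intro!: exI[of _ r])
qed simp

lemma (in pre_hilbert) selfadjoint_ident: "selfadjoint_op H (\<lambda>x. x)"
  by (simp add: selfadjoint_op_def bounded_op_ident)

lemma (in pre_hilbert) Re_form_perturbed:
  assumes T: "selfadjoint_op H T" and x: "x \<in> carrier H" and y: "y \<in> carrier H"
  shows "Re (cinner H (T (x \<ominus> complex_of_real t \<odot> y)) (x \<ominus> complex_of_real t \<odot> y))
    = Re (cinner H (T x) x) - 2 * t * Re (cinner H (T x) y) + t * t * Re (cinner H (T y) y)"
proof -
  note b = selfadjoint_bounded[OF T]
  have "cinner H (T (x \<ominus> complex_of_real t \<odot> y)) (x \<ominus> complex_of_real t \<odot> y)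
      = cinner H (T x) x - complex_of_real t * (cinner H y (T x) + cinner H (T x) y)
        + complex_of_real (t * t) * cinner H (T y) y"
    using selfadjoint_swap[OF T y x] x y b
    by (simp add: bounded_op_in bounded_op_diff bounded_op_smult inner_simps) (simp add: algebra_simps)
  then show ?thesis
    using Re_inner_commute[of y "T x"] x y b by (simp only:) (simp add: bounded_op_in algebra_simps)
qed

text \<open>
  The contraction inequality with \<open>C = 1 - tB\<close>, \<open>S = (1 - C\<^sup>2)\<^bsup>1/2\<^esup>\<close> and \<open>Y = S\<^bsup>-1\<^esup>(A - CAC)S\<^bsup>-1\<^esup>\<close>, which
  satisfy \<open>CAC + SYS = A\<close>, gives \<open>\<langle>g(A)Cx, Cx\<rangle> \<le> \<langle>g(A)x, x\<rangle>\<close> for all small \<open>t > 0\<close>. Its first order term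
  in \<open>t\<close> is the claim.
\<close>

lemma SOC_anticommutator_strict:
  fixes H :: "'a hilbert" (structure)
  assumes H: "complex_hilbert_space H" and ne: "carrier H \<noteq> {\<zero>\<^bsub>H\<^esub>}"
    and g: "g \<in> SOC TYPE('a) {0<..}"
    and A: "positive_op H A" "invertible_op H A" and B: "selfadjoint_op H B"
    and e: "0 < e"
    and B_lower: "\<And>x. x \<in> carrier H \<Longrightarrow> e * (cnorm H x)\<^sup>2 \<le> Re (cinner H (B x) x)"
    and AB_lower: "\<And>x. x \<in> carrier H \<Longrightarrow> e * (cnorm H x)\<^sup>2 \<le> Re (cinner H (A x) (B x))"
    and x: "x \<in> carrier H"
  shows "0 \<le> Re (cinner H (cfc H g A x) (B x))"
proof -
  interpret complex_hilbert_space H by (rule H)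
  have sA: "selfadjoint_op H A" using A by (auto intro: positive_selfadjoint)
  note bA = selfadjoint_bounded[OF sA] and bB = selfadjoint_bounded[OF B]
  note [simp] = bA[THEN bounded_op_in] bB[THEN bounded_op_in]
  obtain KA where KA: "0 < KA" "\<And>x. x \<in> carrier H \<Longrightarrow> \<bar>Re (cinner H (A x) x)\<bar> \<le> KA * (cnorm H x)\<^sup>2"
    using quadratic_form_bound[OF bA] by metis
  obtain KB where KB: "0 < KB" "\<And>x. x \<in> carrier H \<Longrightarrow> cnorm H (B x) \<le> KB * cnorm H x"
    using bounded_op_bound[OF bB] by metis
  have B2: "(cnorm H (B y))\<^sup>2 \<le> KB\<^sup>2 * (cnorm H y)\<^sup>2" if "y \<in> carrier H" for y
    using power_mono[OF KB(2)[OF that], of 2] that by (simp add: cnorm_nonneg power_mult_distrib)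
  obtain m M where m: "0 < m" and spec: "Re ` op_spectrum H A \<subseteq> {m..M}"
    using positive_invertible_bounds[OF A] by metis
  have g_cont: "continuous_on {m..M} g"
    using g m by (auto simp: SOC_def intro: continuous_on_subset)
  have gA: "has_cfc A g (cfc H g A)" by (rule has_cfc_cfc[OF sA spec g_cont])
  have sg: "selfadjoint_op H (cfc H g A)" by (rule has_cfc_selfadjoint[OF sA gA])
  note [simp] = bounded_op_in[OF selfadjoint_bounded[OF sg]]

  have contraction: "Re (cinner H (cfc H g A (x \<ominus> complex_of_real t \<odot> B x)) (x \<ominus> complex_of_real t \<odot> B x))
      \<le> Re (cinner H (cfc H g A x) x)"
    if t: "0 < t" and tB: "t * KB\<^sup>2 \<le> e" and tAB: "t * (KA * KB\<^sup>2) \<le> e" for t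
  proof -
    define C where "C = (\<lambda>y. y \<ominus> complex_of_real t \<odot> B y)"
    have bC: "bounded_op H C"
      unfolding C_def by (intro bounded_op_minus bounded_op_ident bounded_op_scale bB)
    note [simp] = bounded_op_in[OF bC]
    have C: "selfadjoint_op H C"
      using bC selfadjoint_swap[OF B] by (simp add: selfadjoint_op_def C_def inner_simps)

    define W where "W = (\<lambda>y. y \<ominus> C (C y))"
    have bW: "bounded_op H W"
      unfolding W_def by (rule bounded_op_minus[OF bounded_op_ident bounded_op_comp[OF bC bC]])
    have sW: "selfadjoint_op H W"
      using bW selfadjoint_swap[OF C] by (simp add: selfadjoint_op_def W_def inner_simps)
    \<comment> \<open>\<open>\<langle>Wy, y\<rangle> = 2t\<langle>By, y\<rangle> - t\<^sup>2\<parallel>By\<parallel>\<^sup>2\<close>; the smallness of \<open>t\<close> lets half of the first term absorb the second.\<close>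
    have W_lower: "t * e * (cnorm H y)\<^sup>2 \<le> Re (cinner H (W y) y)" if y: "y \<in> carrier H" for y
    proof -
      have "cinner H (W y) y = cinner H y y - cinner H (C y) (C y)"
        using y selfadjoint_swap[OF C, of "C y" y] by (simp add: W_def inner_simps)
      then have "Re (cinner H (W y) y) = 2 * t * Re (cinner H (B y) y) - t * t * (cnorm H (B y))\<^sup>2"
        using Re_form_perturbed[OF selfadjoint_ident y, of "B y" t] Re_inner_commute[of y "B y"] y
        by (simp add: C_def cnorm_power2)
      moreover have "t * t * (cnorm H (B y))\<^sup>2 \<le> t * e * (cnorm H y)\<^sup>2"
      proof -
        have "t * t * (cnorm H (B y))\<^sup>2 \<le> t * t * (KB\<^sup>2 * (cnorm H y)\<^sup>2)"
          using B2[OF y] t by (intro mult_left_mono) auto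
        also have "\<dots> = t * (t * KB\<^sup>2) * (cnorm H y)\<^sup>2" by simp
        also have "\<dots> \<le> t * e * (cnorm H y)\<^sup>2"
          using tB t by (intro mult_right_mono mult_left_mono) auto
        finally show ?thesis .
      qed
      moreover have "2 * t * (e * (cnorm H y)\<^sup>2) \<le> 2 * t * Re (cinner H (B y) y)"
        using B_lower[OF y] t by (intro mult_left_mono) auto
      ultimately show ?thesis by (simp add: mult.assoc)
    qed
    have te: "0 < t * e" using t e by simp
    note W = positive_invertibleI[OF sW te W_lower]

    define T where "T = (\<lambda>y. A y \<ominus> C (A (C y)))"
    have bAC: "bounded_op H (\<lambda>y. A (C y))" by (rule bounded_op_comp[OF bA bC])
    have bT: "bounded_op H T"
      unfolding T_def by (rule bounded_op_minus[OF bA bounded_op_comp[OF bC bAC]])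
    note [simp] = bounded_op_in[OF bT]
    have sT: "selfadjoint_op H T"
      using bT selfadjoint_swap[OF C] selfadjoint_swap[OF sA]
      by (simp add: selfadjoint_op_def T_def inner_simps)
    \<comment> \<open>\<open>\<langle>Ty, y\<rangle> = 2t Re \<langle>Ay, By\<rangle> - t\<^sup>2\<langle>ABy, By\<rangle>\<close>, estimated in the same way.\<close>
    have T_lower: "t * e * (cnorm H y)\<^sup>2 \<le> Re (cinner H (T y) y)" if y: "y \<in> carrier H" for y
    proof -
      have "cinner H (T y) y = cinner H (A y) y - cinner H (A (C y)) (C y)"
        using y selfadjoint_swap[OF C, of "A (C y)" y] by (simp add: T_def inner_simps)
      then have "Re (cinner H (T y) y)
          = 2 * t * Re (cinner H (A y) (B y)) - t * t * Re (cinner H (A (B y)) (B y))"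
        using Re_form_perturbed[OF sA y, of "B y" t] y by (simp add: C_def)
      moreover have "t * t * Re (cinner H (A (B y)) (B y)) \<le> t * e * (cnorm H y)\<^sup>2"
      proof -
        have "Re (cinner H (A (B y)) (B y)) \<le> KA * (cnorm H (B y))\<^sup>2"
          using KA(2)[of "B y"] y by simp
        also have "\<dots> \<le> KA * (KB\<^sup>2 * (cnorm H y)\<^sup>2)"
          using B2[OF y] KA(1) by (intro mult_left_mono) auto
        finally have "t * t * Re (cinner H (A (B y)) (B y)) \<le> t * t * (KA * (KB\<^sup>2 * (cnorm H y)\<^sup>2))"
          using t by (intro mult_left_mono) auto
        also have "\<dots> = t * (t * (KA * KB\<^sup>2)) * (cnorm H y)\<^sup>2" by simp
        also have "\<dots> \<le> t * e * (cnorm H y)\<^sup>2"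
          using tAB t by (intro mult_right_mono mult_left_mono) auto
        finally show ?thesis .
      qed
      moreover have "2 * t * (e * (cnorm H y)\<^sup>2) \<le> 2 * t * Re (cinner H (A y) (B y))"
        using AB_lower[OF y] t by (intro mult_left_mono) auto
      ultimately show ?thesis by (simp add: mult.assoc)
    qed
    note T = positive_invertibleI[OF sT te T_lower]

    define S where "S = powr_op H W (1 / 2)"
    define S' where "S' = powr_op H W (- 1 / 2)"
    have S: "selfadjoint_op H S" and S': "selfadjoint_op H S'" and S'_inv: "invertible_op H S'"
      unfolding S_def S'_def
      using powr_op_selfadjoint[OF W] powr_op_positive_invertible[OF W] by auto
    note bS = selfadjoint_bounded[OF S] and bS' = selfadjoint_bounded[OF S']
    note [simp] = bounded_op_in[OF bS] bounded_op_in[OF bS']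
    have SS: "S (S y) = W y" if "y \<in> carrier H" for y
      using powr_op_add[OF W that, of "1 / 2" "1 / 2"] powr_op_1[OF W that] by (simp add: S_def)
    have SS': "S (S' y) = y" "S' (S y) = y" if "y \<in> carrier H" for y
      using powr_op_inverse[OF W that, of "1 / 2"] powr_op_inverse[OF W that, of "- 1 / 2"]
      by (simp_all add: S_def S'_def)

    define Y where "Y = (\<lambda>y. S' (T (S' y)))"
    have bTS': "bounded_op H (\<lambda>y. T (S' y))" by (rule bounded_op_comp[OF bT bS'])
    have bY: "bounded_op H Y" unfolding Y_def by (rule bounded_op_comp[OF bS' bTS'])
    have sY: "selfadjoint_op H Y"
      using bY selfadjoint_swap[OF S'] selfadjoint_swap[OF sT] by (simp add: selfadjoint_op_def Y_def)
    have Y_pos: "positive_op H Y"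
      using positive_op_Re[OF T(1)] selfadjoint_swap[OF S']
      unfolding positive_op_iff[OF sY] by (simp add: Y_def)
    have Y_inv: "invertible_op H Y"
      unfolding Y_def using invertible_op_comp[OF S'_inv invertible_op_comp[OF T(2) S'_inv]] .

    have "Re (cinner H (cfc H g A (C x)) (C x)) \<le> Re (cinner H (cfc H g A x) x)"
    proof (rule SOC_contraction[OF H ne g A Y_pos Y_inv sA C S _ _ x])
      fix y assume y: "y \<in> carrier H"
      show "C (C y) \<oplus> S (S y) = y"
        using y by (intro vec_eqI) (simp_all add: SS W_def inner_simps)
      show "C (A (C y)) \<oplus> S (Y (S y)) = A y"
        using y by (intro vec_eqI) (simp_all add: Y_def SS' T_def inner_simps)
    qed
    then show ?thesis by (simp add: C_def)
  qed

  define r where "r = min (e / KB\<^sup>2) (e / (KA * KB\<^sup>2))"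
  have r: "0 < r" using e KA(1) KB(1) by (simp add: r_def)
  have "0 \<le> 2 * Re (cinner H (cfc H g A x) (B x)) + t * (- Re (cinner H (cfc H g A (B x)) (B x)))"
    if t: "0 < t" "t \<le> r" for t
  proof -
    have "t \<le> e / KB\<^sup>2" "t \<le> e / (KA * KB\<^sup>2)" using t(2) by (simp_all add: r_def)
    then have "t * KB\<^sup>2 \<le> e" "t * (KA * KB\<^sup>2) \<le> e"
      using KA(1) KB(1) by (simp_all add: pos_le_divide_eq)
    then have le: "Re (cinner H (cfc H g A (x \<ominus> complex_of_real t \<odot> B x)) (x \<ominus> complex_of_real t \<odot> B x))
        \<le> Re (cinner H (cfc H g A x) x)"
      by (rule contraction[OF t(1)])
    have "0 \<le> t * (2 * Re (cinner H (cfc H g A x) (B x)) + t * (- Re (cinner H (cfc H g A (B x)) (B x))))"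
      using le Re_form_perturbed[OF sg x, of "B x" t] x by (simp add: algebra_simps)
    then show ?thesis using t(1) by (simp add: zero_le_mult_iff)
  qed
  then have "0 \<le> 2 * Re (cinner H (cfc H g A x) (B x))"
    by (rule nonneg_if_perturbed_nonneg[OF r])
  then show ?thesis by simp
qed

text \<open>
  Replacing \<open>B\<close> by \<open>B + s\<close> makes both forms in the strict version bounded below, since \<open>A\<close> is; then
  \<open>s \<rightarrow> 0\<close>.
\<close>

lemma SOC_anticommutator:
  fixes H :: "'a hilbert" (structure)
  assumes H: "complex_hilbert_space H" and ne: "carrier H \<noteq> {\<zero>\<^bsub>H\<^esub>}"
    and g: "g \<in> SOC TYPE('a) {0<..}"
    and A: "positive_op H A" "invertible_op H A" and B: "positive_op H B"
    and AB: "\<And>x. x \<in> carrier H \<Longrightarrow> 0 \<le> Re (cinner H (A x) (B x))"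
    and x: "x \<in> carrier H"
  shows "0 \<le> Re (cinner H (cfc H g A x) (B x))"
proof -
  interpret complex_hilbert_space H by (rule H)
  have sA: "selfadjoint_op H A" and sB: "selfadjoint_op H B"
    using A B by (auto intro: positive_selfadjoint)
  note bA = selfadjoint_bounded[OF sA] and bB = selfadjoint_bounded[OF sB]
  note [simp] = bounded_op_in[OF bA] bounded_op_in[OF bB]
  obtain m M where m: "0 < m" "\<And>x. x \<in> carrier H \<Longrightarrow> m * (cnorm H x)\<^sup>2 \<le> Re (cinner H (A x) x)"
    and spec: "Re ` op_spectrum H A \<subseteq> {m..M}"
    using positive_invertible_bounds[OF A] by metis
  have g_cont: "continuous_on {m..M} g"
    using g m(1) by (auto simp: SOC_def intro: continuous_on_subset)
  have gx: "cfc H g A x \<in> carrier H"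
    by (rule bounded_op_in[OF has_cfc_bounded[OF has_cfc_cfc[OF sA spec g_cont]] x])
  have "0 \<le> Re (cinner H (cfc H g A x) (B x)) + s * Re (cinner H (cfc H g A x) x)"
    if s: "0 < s" "s \<le> 1" for s
  proof -
    define B' where "B' = (\<lambda>y. B y \<oplus> complex_of_real s \<odot> y)"
    have bB': "bounded_op H B'"
      unfolding B'_def by (intro bounded_op_plus bounded_op_scale bounded_op_ident bB)
    have sB': "selfadjoint_op H B'"
      using bB' selfadjoint_swap[OF sB] by (simp add: selfadjoint_op_def B'_def inner_simps)
    have "0 \<le> Re (cinner H (cfc H g A x) (B' x))"
    proof (rule SOC_anticommutator_strict[OF H ne g A sB' _ _ _ x])
      show "0 < s * min 1 m" using s m(1) by simp
      fix y assume y: "y \<in> carrier H"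
      have "s * min 1 m * (cnorm H y)\<^sup>2 \<le> s * 1 * (cnorm H y)\<^sup>2"
        using s by (intro mult_right_mono mult_left_mono) auto
      then show "s * min 1 m * (cnorm H y)\<^sup>2 \<le> Re (cinner H (B' y) y)"
        using positive_op_Re[OF B y] y by (simp add: B'_def inner_simps inner_self)
      have "s * min 1 m * (cnorm H y)\<^sup>2 \<le> s * m * (cnorm H y)\<^sup>2"
        using s by (intro mult_right_mono mult_left_mono) auto
      also have "\<dots> \<le> s * Re (cinner H (A y) y)"
        using m(2)[OF y] s by (simp add: mult.assoc)
      finally show "s * min 1 m * (cnorm H y)\<^sup>2 \<le> Re (cinner H (A y) (B' y))"
        using AB[OF y] y by (simp add: B'_def inner_simps)
    qed
    then show ?thesis using x gx by (simp add: B'_def inner_simps)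
  qed
  then show ?thesis by (rule nonneg_if_perturbed_nonneg[OF zero_less_one])
qed

theorem corollary2p15:
  fixes H :: "'a hilbert" and A B :: "'a \<Rightarrow> 'a" and g :: "real \<Rightarrow> real" and p :: real
  assumes "complex_hilbert_space H"
    and "carrier H \<noteq> {\<zero>\<^bsub>H\<^esub>}"
    and "g \<in> SOC TYPE('a) {0<..}"
    and "\<exists>t\<in>{0<..}. g t \<noteq> 0"
    and "-1 \<le> p" and "p \<le> 1"
    and "positive_op H A" and "invertible_op H A"
    and "positive_op H B" and "invertible_op H B"
    and "positive_op H (\<lambda>x. A (B x) \<oplus>\<^bsub>H\<^esub> B (A x))"
  shows "positive_op H (\<lambda>x. cfc H g (powr_op H A p) (B x) \<oplus>\<^bsub>H\<^esub> B (cfc H g (powr_op H A p) x))"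
proof -
  interpret complex_hilbert_space H by (rule assms(1))
  note A = \<open>positive_op H A\<close> \<open>invertible_op H A\<close> and B = \<open>positive_op H B\<close>
  have sA: "selfadjoint_op H A" and sB: "selfadjoint_op H B"
    using A B by (auto intro: positive_selfadjoint)
  have AB: "0 \<le> Re (cinner H (A x) (B x))" if "x \<in> carrier H" for x
    using assms(11) that anticommutator_positive_iff[OF sA sB] by blast
  note Ap = powr_op_positive_invertible[OF A, of p]
  obtain m M where m: "0 < m" and spec: "Re ` op_spectrum H (powr_op H A p) \<subseteq> {m..M}"
    using positive_invertible_bounds[OF Ap] by metis
  have "continuous_on {m..M} g"
    using assms(3) m by (auto simp: SOC_def intro: continuous_on_subset)
  with powr_op_selfadjoint[OF A] spec
  have "has_cfc (powr_op H A p) g (cfc H g (powr_op H A p))"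
    by (rule has_cfc_cfc)
  with powr_op_selfadjoint[OF A] have "selfadjoint_op H (cfc H g (powr_op H A p))"
    by (rule has_cfc_selfadjoint)
  moreover have "0 \<le> Re (cinner H (cfc H g (powr_op H A p) x) (B x))" if "x \<in> carrier H" for x
    by (rule SOC_anticommutator[OF assms(1-3) Ap B _ that],
        rule powr_op_anticommutator[OF A B AB assms(5,6)])
  ultimately show ?thesis
    using anticommutator_positive_iff sB by blast
qed

end
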